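(* Let $A$ be a vector space and $\Phi:A\otimes A\longrightarrow A\otimes A$ a linear map. For any vector space $V$, define bilinear products $*_a$ ($a\in A$) on $T_A(V)=\bigoplus_{n=1}^\infty A^{\otimes(n-1)}\otimes V^{\otimes n}$, by induction on the length of $A$-typed words, by $$w*_az=w\cdot az,\qquad u*_a(v\cdot bz)=\sum(u*_{a''\triangleright b''}v)\cdot(a'\rightarrow b')z,$$ where $u,v,w\in T_A(V)$, $z\in V$ and $a,b\in A$. The following conditions are equivalent: 1. $(A,\Phi)$ is an $\ell$EAS. 2. For any vector space $V$, $(T_A(V),* )$ is a $\Phi$-associative algebra. 3. There exists a nonzero vector space $V$ such that $(T_A(V),* )$ is a $\Phi$-associative algebra. Moreover, if these conditions hold, then $(T_A(V),* )$ is the free $\Phi$-associative algebra generated by $V$.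
   Context: All vector spaces are over a field $\mathbb{K}$. Sweedler-like notation: $\Phi(a\otimes b)=\sum a'\rightarrow b'\otimes a''\triangleright b''$ (purely symbolic). $(A,\Phi)$ is a linear extended associative semigroup ($\ell$EAS) if $$(\mathrm{Id}\otimes\Phi)\circ(\Phi\otimes\mathrm{Id})\circ(\mathrm{Id}\otimes\Phi)=(\Phi\otimes\mathrm{Id})\circ(\mathrm{Id}\otimes\tau)\circ(\Phi\otimes\mathrm{Id})$$ on $A^{\otimes 3}$, where $\tau(a\otimes b)=b\otimes a$. For any linear map $\Phi:A\otimes A\to A\otimes A$, a $\Phi$-associative algebra is a vector space $V$ with a linear map $A\to\mathrm{Hom}(V\otimes V,V)$, $a\mapsto *_a$, such that for all $x,y,z\in V$, $a,b\in A$, $x*_a(y*_bz)=\sum(x*_{a''\triangleright b''}y)*_{a'\rightarrow b'}z$. Elements $a_1\ldots a_{n-1}x_1\ldots x_n$ of $A^{\otimes(n-1)}\otimes V^{\otimes n}$ (tensors of $a_i\in A$ and $x_j\in V$) are called $A$-typed words of length $n$, and $\cdot:T_A(V)\otimes A\otimes V\to T_A(V)$ is the linear map given by $a_1\ldots a_{n-1}x_1\ldots x_n\cdot ax=a_1\ldots a_{n-1}a\,x_1\ldots x_nx$. *)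

theory Defs
  imports "HOL-Algebra.Module" "HOL-Algebra.AbelCoset"
begin

text \<open>
  A vector space over a field \<open>K\<close> is \<open>module K V\<close> with \<open>field K\<close>, as in HOL-Algebra.
  The fields \<open>mult\<close> and \<open>one\<close> that the record type of modules inherits from rings play no role.
\<close>

definition linear_maps ::
    "('k, 'r) ring_scheme \<Rightarrow> ('k, 'm, 'p) module_scheme \<Rightarrow> ('k, 'n, 'q) module_scheme
     \<Rightarrow> ('m \<Rightarrow> 'n) set" where
  "linear_maps K M N = {f \<in> carrier M \<rightarrow> carrier N.
     (\<forall>x\<in>carrier M. \<forall>y\<in>carrier M. f (x \<oplus>\<^bsub>M\<^esub> y) = f x \<oplus>\<^bsub>N\<^esub> f y) \<and>
     (\<forall>c\<in>carrier K. \<forall>x\<in>carrier M. f (c \<odot>\<^bsub>M\<^esub> x) = c \<odot>\<^bsub>N\<^esub> f x)}"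


section \<open>Modules given by generators and relations\<close>

text \<open>The free module on \<open>X\<close>: finitely supported functions, vanishing outside \<open>X\<close>.\<close>

definition free_module :: "('k, 'r) ring_scheme \<Rightarrow> 'x set \<Rightarrow> ('k, 'x \<Rightarrow> 'k) module" where
  "free_module K X =
     \<lparr>carrier = {f. range f \<subseteq> carrier K \<and> finite {x. f x \<noteq> \<zero>\<^bsub>K\<^esub>} \<and> {x. f x \<noteq> \<zero>\<^bsub>K\<^esub>} \<subseteq> X},
      mult = (\<lambda>_ _. undefined), one = undefined,
      zero = (\<lambda>_. \<zero>\<^bsub>K\<^esub>), add = (\<lambda>f g x. f x \<oplus>\<^bsub>K\<^esub> g x),
      smult = (\<lambda>c f x. c \<otimes>\<^bsub>K\<^esub> f x)\<rparr>"

definition basis_elt :: "('k, 'r) ring_scheme \<Rightarrow> 'x \<Rightarrow> 'x \<Rightarrow> 'k" where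
  "basis_elt K x = (\<lambda>y. if y = x then \<one>\<^bsub>K\<^esub> else \<zero>\<^bsub>K\<^esub>)"

definition submodule_generated ::
    "('k, 'r) ring_scheme \<Rightarrow> ('k, 'm, 'p) module_scheme \<Rightarrow> 'm set \<Rightarrow> 'm set" where
  "submodule_generated K M R = \<Inter>{H. submodule H K M \<and> R \<subseteq> H}"

definition quotient_module ::
    "('k, 'm, 'p) module_scheme \<Rightarrow> 'm set \<Rightarrow> ('k, 'm set) module" where
  "quotient_module M H =
     \<lparr>carrier = a_rcosets\<^bsub>M\<^esub> H,
      mult = (\<lambda>_ _. undefined), one = undefined,
      zero = H, add = set_add M,
      smult = (\<lambda>c S. \<Union>s\<in>S. H +>\<^bsub>M\<^esub> (c \<odot>\<^bsub>M\<^esub> s))\<rparr>"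

definition presented_module ::
    "('k, 'r) ring_scheme \<Rightarrow> 'x set \<Rightarrow> ('x \<Rightarrow> 'k) set \<Rightarrow> ('k, ('x \<Rightarrow> 'k) set) module" where
  "presented_module K X R =
     quotient_module (free_module K X) (submodule_generated K (free_module K X) R)"

definition presented_gen ::
    "('k, 'r) ring_scheme \<Rightarrow> 'x set \<Rightarrow> ('x \<Rightarrow> 'k) set \<Rightarrow> 'x \<Rightarrow> ('x \<Rightarrow> 'k) set" where
  "presented_gen K X R x =
     submodule_generated K (free_module K X) R +>\<^bsub>free_module K X\<^esub> basis_elt K x"

text \<open>
  Linear extension to a presented module of a map \<open>h\<close> given on the generators: the element \<open>t\<close>
  is a coset of formal linear combinations, and the value does not depend on the chosen
  combination as soon as \<open>h\<close> respects the relations.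
\<close>

definition lin_ext ::
    "('k, 'r) ring_scheme \<Rightarrow> ('k, 'n, 'q) module_scheme \<Rightarrow> ('x \<Rightarrow> 'n) \<Rightarrow> ('x \<Rightarrow> 'k) set \<Rightarrow> 'n" where
  "lin_ext K N h t =
     (let f = (SOME f. f \<in> t)
      in \<Oplus>\<^bsub>N\<^esub>x \<in> {x. f x \<noteq> \<zero>\<^bsub>K\<^esub>}. f x \<odot>\<^bsub>N\<^esub> h x)"

text \<open>
  Linearity relations in one tensor slot: \<open>s m\<close> is the generator with \<open>m\<close> in the slot
  and all other entries fixed.
\<close>

definition slot_relations ::
    "('k, 'r) ring_scheme \<Rightarrow> 'x set \<Rightarrow> ('k, 'm, 'p) module_scheme \<Rightarrow> ('m \<Rightarrow> 'x) \<Rightarrow> ('x \<Rightarrow> 'k) set" where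
  "slot_relations K X M s =
     {basis_elt K (s (m \<oplus>\<^bsub>M\<^esub> m')) \<ominus>\<^bsub>free_module K X\<^esub>
        (basis_elt K (s m) \<oplus>\<^bsub>free_module K X\<^esub> basis_elt K (s m')) | m m'.
        m \<in> carrier M \<and> m' \<in> carrier M} \<union>
     {basis_elt K (s (c \<odot>\<^bsub>M\<^esub> m)) \<ominus>\<^bsub>free_module K X\<^esub>
        (c \<odot>\<^bsub>free_module K X\<^esub> basis_elt K (s m)) | c m.
        c \<in> carrier K \<and> m \<in> carrier M}"


section \<open>Tensor powers\<close>

definition tensor_words :: "('k, 'a, 'p) module_scheme \<Rightarrow> nat \<Rightarrow> 'a list set" where
  "tensor_words A n = {w \<in> lists (carrier A). length w = n}"

definition tensor_relations ::
    "('k, 'r) ring_scheme \<Rightarrow> ('k, 'a, 'p) module_scheme \<Rightarrow> nat \<Rightarrow> ('a list \<Rightarrow> 'k) set" where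
  "tensor_relations K A n =
     \<Union>{slot_relations K (tensor_words A n) A (\<lambda>a. u @ a # v) | u v.
        u \<in> lists (carrier A) \<and> v \<in> lists (carrier A) \<and> length u + length v + 1 = n}"

text \<open>\<open>tensor_power K A n\<close> is the \<open>n\<close>-fold tensor product of \<open>A\<close> with itself,
  \<open>pure_tensor K A [a\<^sub>1, \<dots>, a\<^sub>n]\<close> its element \<open>a\<^sub>1 \<otimes> \<dots> \<otimes> a\<^sub>n\<close>.\<close>

definition tensor_power ::
    "('k, 'r) ring_scheme \<Rightarrow> ('k, 'a, 'p) module_scheme \<Rightarrow> nat \<Rightarrow> ('k, ('a list \<Rightarrow> 'k) set) module" where
  "tensor_power K A n = presented_module K (tensor_words A n) (tensor_relations K A n)"

definition pure_tensor ::
    "('k, 'r) ring_scheme \<Rightarrow> ('k, 'a, 'p) module_scheme \<Rightarrow> 'a list \<Rightarrow> ('a list \<Rightarrow> 'k) set" where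
  "pure_tensor K A w =
     presented_gen K (tensor_words A (length w)) (tensor_relations K A (length w)) w"

text \<open>For an endomorphism \<open>\<Psi>\<close> of \<open>A \<otimes> A\<close>, the endomorphisms \<open>\<Psi> \<otimes> Id\<close> and
  \<open>Id \<otimes> \<Psi>\<close> of \<open>A \<otimes> A \<otimes> A\<close>.\<close>

definition tensor_id ::
    "('k, 'r) ring_scheme \<Rightarrow> ('k, 'a, 'p) module_scheme \<Rightarrow>
     (('a list \<Rightarrow> 'k) set \<Rightarrow> ('a list \<Rightarrow> 'k) set) \<Rightarrow> ('a list \<Rightarrow> 'k) set \<Rightarrow> ('a list \<Rightarrow> 'k) set" where
  "tensor_id K A \<Psi> = lin_ext K (tensor_power K A 3)
     (\<lambda>w. lin_ext K (tensor_power K A 3) (\<lambda>p. pure_tensor K A [p ! 0, p ! 1, w ! 2])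
        (\<Psi> (pure_tensor K A [w ! 0, w ! 1])))"

definition id_tensor ::
    "('k, 'r) ring_scheme \<Rightarrow> ('k, 'a, 'p) module_scheme \<Rightarrow>
     (('a list \<Rightarrow> 'k) set \<Rightarrow> ('a list \<Rightarrow> 'k) set) \<Rightarrow> ('a list \<Rightarrow> 'k) set \<Rightarrow> ('a list \<Rightarrow> 'k) set" where
  "id_tensor K A \<Psi> = lin_ext K (tensor_power K A 3)
     (\<lambda>w. lin_ext K (tensor_power K A 3) (\<lambda>p. pure_tensor K A [w ! 0, p ! 0, p ! 1])
        (\<Psi> (pure_tensor K A [w ! 1, w ! 2])))"

definition tensor_flip ::
    "('k, 'r) ring_scheme \<Rightarrow> ('k, 'a, 'p) module_scheme \<Rightarrow> ('a list \<Rightarrow> 'k) set \<Rightarrow> ('a list \<Rightarrow> 'k) set" where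
  "tensor_flip K A = lin_ext K (tensor_power K A 2) (\<lambda>w. pure_tensor K A [w ! 1, w ! 0])"

definition lEAS ::
    "('k, 'r) ring_scheme \<Rightarrow> ('k, 'a, 'p) module_scheme \<Rightarrow>
     (('a list \<Rightarrow> 'k) set \<Rightarrow> ('a list \<Rightarrow> 'k) set) \<Rightarrow> bool" where
  "lEAS K A \<Phi> \<longleftrightarrow>
     module K A \<and> \<Phi> \<in> linear_maps K (tensor_power K A 2) (tensor_power K A 2) \<and>
     (\<forall>t \<in> carrier (tensor_power K A 3).
        id_tensor K A \<Phi> (tensor_id K A \<Phi> (id_tensor K A \<Phi> t)) =
        tensor_id K A \<Phi> (id_tensor K A (tensor_flip K A) (tensor_id K A \<Phi> t)))"


section \<open>\<open>\<Phi>\<close>-associative algebras\<close>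

text \<open>
  \<open>sweedler K A N \<Phi> h a b\<close> is the sum of all \<open>h (a' \<rightarrow> b') (a'' \<triangleright> b'')\<close>, taken in \<open>N\<close>,
  where \<open>\<Phi> (a \<otimes> b) = \<Sum> (a' \<rightarrow> b') \<otimes> (a'' \<triangleright> b'')\<close>.
\<close>

definition sweedler ::
    "('k, 'r) ring_scheme \<Rightarrow> ('k, 'a, 'p) module_scheme \<Rightarrow> ('k, 'n, 'q) module_scheme \<Rightarrow>
     (('a list \<Rightarrow> 'k) set \<Rightarrow> ('a list \<Rightarrow> 'k) set) \<Rightarrow> ('a \<Rightarrow> 'a \<Rightarrow> 'n) \<Rightarrow> 'a \<Rightarrow> 'a \<Rightarrow> 'n" where
  "sweedler K A N \<Phi> h a b = lin_ext K N (\<lambda>p. h (p ! 0) (p ! 1)) (\<Phi> (pure_tensor K A [a, b]))"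

text \<open>Linear maps \<open>A \<rightarrow> Hom(V \<otimes> V, V)\<close>, as maps \<open>a, x, y \<mapsto> x *\<^sub>a y\<close> linear in each argument.\<close>

definition typed_products ::
    "('k, 'r) ring_scheme \<Rightarrow> ('k, 'a, 'p) module_scheme \<Rightarrow> ('k, 'v, 'q) module_scheme \<Rightarrow>
     ('a \<Rightarrow> 'v \<Rightarrow> 'v \<Rightarrow> 'v) set" where
  "typed_products K A V = {star.
     (\<forall>x\<in>carrier V. \<forall>y\<in>carrier V. (\<lambda>a. star a x y) \<in> linear_maps K A V) \<and>
     (\<forall>a\<in>carrier A. \<forall>y\<in>carrier V. (\<lambda>x. star a x y) \<in> linear_maps K V V) \<and>
     (\<forall>a\<in>carrier A. \<forall>x\<in>carrier V. (\<lambda>y. star a x y) \<in> linear_maps K V V)}"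

definition phi_assoc_algebra ::
    "('k, 'r) ring_scheme \<Rightarrow> ('k, 'a, 'p) module_scheme \<Rightarrow>
     (('a list \<Rightarrow> 'k) set \<Rightarrow> ('a list \<Rightarrow> 'k) set) \<Rightarrow>
     ('k, 'v, 'q) module_scheme \<Rightarrow> ('a \<Rightarrow> 'v \<Rightarrow> 'v \<Rightarrow> 'v) \<Rightarrow> bool" where
  "phi_assoc_algebra K A \<Phi> V star \<longleftrightarrow>
     module K V \<and> star \<in> typed_products K A V \<and>
     (\<forall>x\<in>carrier V. \<forall>y\<in>carrier V. \<forall>z\<in>carrier V. \<forall>a\<in>carrier A. \<forall>b\<in>carrier A.
        star a x (star b y z) = sweedler K A V \<Phi> (\<lambda>p q. star p (star q x y) z) a b)"

definition phi_assoc_homs ::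
    "('k, 'r) ring_scheme \<Rightarrow> ('k, 'a, 'p) module_scheme \<Rightarrow>
     ('k, 'v, 'q) module_scheme \<Rightarrow> ('a \<Rightarrow> 'v \<Rightarrow> 'v \<Rightarrow> 'v) \<Rightarrow>
     ('k, 'w, 's) module_scheme \<Rightarrow> ('a \<Rightarrow> 'w \<Rightarrow> 'w \<Rightarrow> 'w) \<Rightarrow> ('v \<Rightarrow> 'w) set" where
  "phi_assoc_homs K A V starV W starW = {F \<in> linear_maps K V W.
     \<forall>a\<in>carrier A. \<forall>x\<in>carrier V. \<forall>y\<in>carrier V. F (starV a x y) = starW a (F x) (F y)}"

text \<open>
  \<open>(T, star)\<close> together with \<open>\<iota> : V \<rightarrow> T\<close> is the free \<open>\<Phi>\<close>-associative algebra generated by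
  \<open>V\<close>. The algebras against which the universal property is tested have their carriers in the
  type given as first argument.
\<close>

definition free_phi_assoc_algebra ::
    "'w itself \<Rightarrow> ('k, 'r) ring_scheme \<Rightarrow> ('k, 'a, 'p) module_scheme \<Rightarrow>
     (('a list \<Rightarrow> 'k) set \<Rightarrow> ('a list \<Rightarrow> 'k) set) \<Rightarrow> ('k, 'v, 'q) module_scheme \<Rightarrow>
     ('k, 't, 's) module_scheme \<Rightarrow> ('a \<Rightarrow> 't \<Rightarrow> 't \<Rightarrow> 't) \<Rightarrow> ('v \<Rightarrow> 't) \<Rightarrow> bool" where
  "free_phi_assoc_algebra _ K A \<Phi> V T star \<iota> \<longleftrightarrow>
     phi_assoc_algebra K A \<Phi> T star \<and> \<iota> \<in> linear_maps K V T \<and>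
     (\<forall>(W :: ('k, 'w) module) starW f.
        phi_assoc_algebra K A \<Phi> W starW \<and> f \<in> linear_maps K V W \<longrightarrow>
        (\<exists>!F. F \<in> extensional (carrier T) \<and> F \<in> phi_assoc_homs K A T star W starW \<and>
              (\<forall>x\<in>carrier V. F (\<iota> x) = f x)))"


section \<open>The space of \<open>A\<close>-typed words and its products\<close>

text \<open>
  The pair \<open>([a\<^sub>1, \<dots>, a\<^bsub>n-1\<^esub>], [x\<^sub>1, \<dots>, x\<^sub>n])\<close> generates the word \<open>a\<^sub>1 \<dots> a\<^bsub>n-1\<^esub> x\<^sub>1 \<dots> x\<^sub>n\<close>.
  Generators of all lengths \<open>n \<ge> 1\<close> are taken together; since each relation only involves generators
  of one length, the quotient is the direct sum over \<open>n \<ge> 1\<close> of the tensor products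
  \<open>A \<otimes> \<dots> \<otimes> A \<otimes> V \<otimes> \<dots> \<otimes> V\<close> with \<open>n - 1\<close> factors \<open>A\<close> and \<open>n\<close> factors \<open>V\<close>.
\<close>

definition typed_word_gens ::
    "('k, 'a, 'p) module_scheme \<Rightarrow> ('k, 'v, 'q) module_scheme \<Rightarrow> ('a list \<times> 'v list) set" where
  "typed_word_gens A V = {(as, xs).
     as \<in> lists (carrier A) \<and> xs \<in> lists (carrier V) \<and> length xs = length as + 1}"

definition typed_word_relations ::
    "('k, 'r) ring_scheme \<Rightarrow> ('k, 'a, 'p) module_scheme \<Rightarrow> ('k, 'v, 'q) module_scheme \<Rightarrow>
     ('a list \<times> 'v list \<Rightarrow> 'k) set" where
  "typed_word_relations K A V =
     \<Union>{slot_relations K (typed_word_gens A V) A (\<lambda>a. (u @ a # v, xs)) | u v xs.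
        u \<in> lists (carrier A) \<and> v \<in> lists (carrier A) \<and> xs \<in> lists (carrier V) \<and>
        length xs = length u + length v + 2} \<union>
     \<Union>{slot_relations K (typed_word_gens A V) V (\<lambda>x. (as, u @ x # v)) | as u v.
        as \<in> lists (carrier A) \<and> u \<in> lists (carrier V) \<and> v \<in> lists (carrier V) \<and>
        length u + length v = length as}"

definition typed_word_space ::
    "('k, 'r) ring_scheme \<Rightarrow> ('k, 'a, 'p) module_scheme \<Rightarrow> ('k, 'v, 'q) module_scheme \<Rightarrow>
     ('k, ('a list \<times> 'v list \<Rightarrow> 'k) set) module" where
  "typed_word_space K A V = presented_module K (typed_word_gens A V) (typed_word_relations K A V)"

definition typed_word ::
    "('k, 'r) ring_scheme \<Rightarrow> ('k, 'a, 'p) module_scheme \<Rightarrow> ('k, 'v, 'q) module_scheme \<Rightarrow>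
     'a list \<Rightarrow> 'v list \<Rightarrow> ('a list \<times> 'v list \<Rightarrow> 'k) set" where
  "typed_word K A V as xs =
     presented_gen K (typed_word_gens A V) (typed_word_relations K A V) (as, xs)"

text \<open>\<open>append_letter K A V w a x\<close> is \<open>w \<cdot> a x\<close>.\<close>

definition append_letter ::
    "('k, 'r) ring_scheme \<Rightarrow> ('k, 'a, 'p) module_scheme \<Rightarrow> ('k, 'v, 'q) module_scheme \<Rightarrow>
     ('a list \<times> 'v list \<Rightarrow> 'k) set \<Rightarrow> 'a \<Rightarrow> 'v \<Rightarrow> ('a list \<times> 'v list \<Rightarrow> 'k) set" where
  "append_letter K A V w a x =
     lin_ext K (typed_word_space K A V) (\<lambda>(as, xs). typed_word K A V (as @ [a]) (xs @ [x])) w"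

definition letter ::
    "('k, 'r) ring_scheme \<Rightarrow> ('k, 'a, 'p) module_scheme \<Rightarrow> ('k, 'v, 'q) module_scheme \<Rightarrow>
     'v \<Rightarrow> ('a list \<times> 'v list \<Rightarrow> 'k) set" where
  "letter K A V x = typed_word K A V [] [x]"

text \<open>
  The products defined by induction on the length of the right factor. Linearity in \<open>a\<close> is
  what gives a meaning to the Sweedler sum in the inductive clause.
\<close>

definition is_word_product ::
    "('k, 'r) ring_scheme \<Rightarrow> ('k, 'a, 'p) module_scheme \<Rightarrow>
     (('a list \<Rightarrow> 'k) set \<Rightarrow> ('a list \<Rightarrow> 'k) set) \<Rightarrow> ('k, 'v, 'q) module_scheme \<Rightarrow>
     ('a \<Rightarrow> ('a list \<times> 'v list \<Rightarrow> 'k) set \<Rightarrow> ('a list \<times> 'v list \<Rightarrow> 'k) set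
       \<Rightarrow> ('a list \<times> 'v list \<Rightarrow> 'k) set) \<Rightarrow> bool" where
  "is_word_product K A \<Phi> V star \<longleftrightarrow>
     (let T = typed_word_space K A V in
       star \<in> carrier A \<rightarrow>\<^sub>E carrier T \<rightarrow>\<^sub>E carrier T \<rightarrow>\<^sub>E carrier T \<and>
       star \<in> typed_products K A T \<and>
       (\<forall>a\<in>carrier A. \<forall>w\<in>carrier T. \<forall>z\<in>carrier V.
          star a w (letter K A V z) = append_letter K A V w a z) \<and>
       (\<forall>a\<in>carrier A. \<forall>b\<in>carrier A. \<forall>u\<in>carrier T. \<forall>v\<in>carrier T. \<forall>z\<in>carrier V.
          star a u (append_letter K A V v b z) =
            sweedler K A T \<Phi> (\<lambda>p q. append_letter K A V (star q u v) p z) a b))"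

definition word_product ::
    "('k, 'r) ring_scheme \<Rightarrow> ('k, 'a, 'p) module_scheme \<Rightarrow>
     (('a list \<Rightarrow> 'k) set \<Rightarrow> ('a list \<Rightarrow> 'k) set) \<Rightarrow> ('k, 'v, 'q) module_scheme \<Rightarrow>
     ('a \<Rightarrow> ('a list \<times> 'v list \<Rightarrow> 'k) set \<Rightarrow> ('a list \<times> 'v list \<Rightarrow> 'k) set
       \<Rightarrow> ('a list \<times> 'v list \<Rightarrow> 'k) set)" where
  "word_product K A \<Phi> V = (THE star. is_word_product K A \<Phi> V star)"

end

theory Submission
  imports Defs
begin

text \<open>
  A linear map out of \<open>T\<^sub>A(V)\<close> is determined freely by its values on letters and by a
  trilinear rule for appending \<open>ax\<close>. Applied with values in
  \<open>Hom(T\<^sub>A(V), Hom(A, T\<^sub>A(V)))\<close>, this recursion gives the products \<open>*\<^sub>a\<close>; applied with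
  values in a \<open>\<Phi>\<close>-associative algebra, it gives the universal property.

  For the equivalence, let \<open>G(p \<otimes> q \<otimes> r) = ((u *\<^sub>r v) *\<^sub>q w) \<cdot> pt\<close>. If
  associativity holds at \<open>u, v, w\<close>, then the two sides of associativity at \<open>u, v, w \<cdot> ct\<close> are the
  images under \<open>G\<close> of the two sides of the \<open>\<ell>\<close>EAS equation at \<open>a \<otimes> b \<otimes> c\<close>. So an
  \<open>\<ell>\<close>EAS gives associativity by induction on the last factor. Conversely, for
  \<open>u = v = w = t = x \<noteq> 0\<close> the map \<open>G\<close> has a left inverse, obtained by applying to each letter a
  linear form with value \<open>1\<close> at \<open>x\<close>.
\<close>

section \<open>Linear maps\<close>

text \<open>Tensors are cosets of formal combinations, and a Sweedler sum is read off a
  representative picked by choice. The pick depends on the tensor alone, so congruence, pushing a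
  linear map inside and linearity in a parameter hold term by term; only linearity in the tensor
  itself has to be paid for by multilinearity.

  The recursion for the product cannot run at a fixed type: \<open>star a u (snoc v b z)\<close>
  calls for \<open>star q u v\<close> at every type q in the second tensor factor of \<Phi>(a
  \<otimes> b), and the Sweedler sum makes sense only if this is linear in q. So the recursive value
  at v has to contain all types together with linearity in them; Hom spaces as targets achieve this.

  In the converse direction, G vanishes as soon as one of u, v, w, t is zero, and for V = 0
  associativity is trivial. A vector detected by a linear form is therefore indispensable; it is for
  this form that scalars are inverted and a maximal submodule is chosen.\<close>

lemma linear_mapsI:
  assumes "\<And>x. x \<in> carrier M \<Longrightarrow> f x \<in> carrier N"
    and "\<And>x y. x \<in> carrier M \<Longrightarrow> y \<in> carrier M \<Longrightarrow> f (x \<oplus>\<^bsub>M\<^esub> y) = f x \<oplus>\<^bsub>N\<^esub> f y"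
    and "\<And>c x. c \<in> carrier K \<Longrightarrow> x \<in> carrier M \<Longrightarrow> f (c \<odot>\<^bsub>M\<^esub> x) = c \<odot>\<^bsub>N\<^esub> f x"
  shows "f \<in> linear_maps K M N"
  using assms by (auto simp: linear_maps_def)

lemma linear_maps_closed:
  "f \<in> linear_maps K M N \<Longrightarrow> x \<in> carrier M \<Longrightarrow> f x \<in> carrier N"
  by (auto simp: linear_maps_def)

lemma linear_maps_add:
  "f \<in> linear_maps K M N \<Longrightarrow> x \<in> carrier M \<Longrightarrow> y \<in> carrier M \<Longrightarrow>
    f (x \<oplus>\<^bsub>M\<^esub> y) = f x \<oplus>\<^bsub>N\<^esub> f y"
  by (auto simp: linear_maps_def)

lemma linear_maps_smult:
  "f \<in> linear_maps K M N \<Longrightarrow> c \<in> carrier K \<Longrightarrow> x \<in> carrier M \<Longrightarrow>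
    f (c \<odot>\<^bsub>M\<^esub> x) = c \<odot>\<^bsub>N\<^esub> f x"
  by (auto simp: linear_maps_def)

text \<open>Linearity is tested on the carrier only; this is how a map and its restriction to the
  carrier are exchanged.\<close>

lemma linear_maps_cong:
  assumes "module K M" "\<And>x. x \<in> carrier M \<Longrightarrow> f x = g x"
  shows "f \<in> linear_maps K M N \<longleftrightarrow> g \<in> linear_maps K M N"
proof -
  interpret M: module K M by fact
  show ?thesis unfolding linear_maps_def using assms(2) by (auto simp: Pi_iff)
qed

lemma linear_maps_comp:
  "f \<in> linear_maps K M N \<Longrightarrow> g \<in> linear_maps K N P \<Longrightarrow> (\<lambda>x. g (f x)) \<in> linear_maps K M P"
  by (auto simp: linear_maps_def Pi_iff)

lemma linear_maps_zero:
  assumes "module K M" "module K N" "f \<in> linear_maps K M N"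
  shows "f \<zero>\<^bsub>M\<^esub> = \<zero>\<^bsub>N\<^esub>"
proof -
  interpret M: module K M by fact
  interpret N: module K N by fact
  have "f (\<zero>\<^bsub>K\<^esub> \<odot>\<^bsub>M\<^esub> \<zero>\<^bsub>M\<^esub>) = \<zero>\<^bsub>K\<^esub> \<odot>\<^bsub>N\<^esub> f \<zero>\<^bsub>M\<^esub>"
    using assms(3) by (intro linear_maps_smult) auto
  then show ?thesis using linear_maps_closed[OF assms(3) M.M.zero_closed] by simp
qed

lemma linear_maps_uminus:
  assumes "module K M" "module K N" "f \<in> linear_maps K M N" "x \<in> carrier M"
  shows "f (\<ominus>\<^bsub>M\<^esub> x) = \<ominus>\<^bsub>N\<^esub> f x"
proof -
  interpret M: module K M by fact
  interpret N: module K N by fact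
  have "f (\<ominus>\<^bsub>M\<^esub> x) \<oplus>\<^bsub>N\<^esub> f x = f (\<ominus>\<^bsub>M\<^esub> x \<oplus>\<^bsub>M\<^esub> x)"
    using assms by (intro linear_maps_add[symmetric]) auto
  also have "\<dots> = \<zero>\<^bsub>N\<^esub>"
    using assms by (simp add: M.M.l_neg linear_maps_zero[OF assms(1-3)])
  finally show ?thesis
    using assms by (metis N.M.minus_equality linear_maps_closed M.M.a_inv_closed)
qed

lemma linear_maps_minus:
  assumes "module K M" "module K N" "f \<in> linear_maps K M N" "x \<in> carrier M" "y \<in> carrier M"
  shows "f (x \<ominus>\<^bsub>M\<^esub> y) = f x \<ominus>\<^bsub>N\<^esub> f y"
proof -
  interpret M: module K M by fact
  show ?thesis using assms
    by (simp add: a_minus_def linear_maps_add[OF assms(3)] linear_maps_uminus[OF assms(1-3)])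
qed

lemma linear_maps_finsum:
  assumes "module K M" "module K N" "f \<in> linear_maps K M N" "finite S" "g \<in> S \<rightarrow> carrier M"
  shows "f (\<Oplus>\<^bsub>M\<^esub>x\<in>S. g x) = (\<Oplus>\<^bsub>N\<^esub>x\<in>S. f (g x))"
proof -
  interpret M: module K M by fact
  interpret N: module K N by fact
  show ?thesis using assms(4,5)
  proof (induction S)
    case empty
    then show ?case using linear_maps_zero[OF assms(1-3)] by simp
  next
    case (insert x S)
    then show ?case
      by (simp add: Pi_iff linear_maps_add[OF assms(3)] linear_maps_closed[OF assms(3)]
          M.M.finsum_closed)
  qed
qed

lemma linear_maps_finsum_fun:
  assumes "module K M" "module K N" "finite S" "\<And>i. i \<in> S \<Longrightarrow> f i \<in> linear_maps K M N"
  shows "(\<lambda>x. \<Oplus>\<^bsub>N\<^esub>i\<in>S. f i x) \<in> linear_maps K M N"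
proof -
  interpret M: module K M by fact
  interpret N: module K N by fact
  have cl: "(\<lambda>i. f i x) \<in> S \<rightarrow> carrier N" if "x \<in> carrier M" for x
    using assms(4) that by (auto intro: linear_maps_closed)
  show ?thesis
  proof (rule linear_mapsI)
    fix x assume "x \<in> carrier M"
    then show "(\<Oplus>\<^bsub>N\<^esub>i\<in>S. f i x) \<in> carrier N" using cl by (simp add: N.M.finsum_closed)
  next
    fix x y assume xy: "x \<in> carrier M" "y \<in> carrier M"
    have "(\<Oplus>\<^bsub>N\<^esub>i\<in>S. f i (x \<oplus>\<^bsub>M\<^esub> y)) = (\<Oplus>\<^bsub>N\<^esub>i\<in>S. f i x \<oplus>\<^bsub>N\<^esub> f i y)"
      using xy cl by (intro N.M.finsum_cong') (auto intro: linear_maps_add[OF assms(4)])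
    also have "\<dots> = (\<Oplus>\<^bsub>N\<^esub>i\<in>S. f i x) \<oplus>\<^bsub>N\<^esub> (\<Oplus>\<^bsub>N\<^esub>i\<in>S. f i y)"
      using cl xy by (intro N.M.finsum_addf) auto
    finally show "(\<Oplus>\<^bsub>N\<^esub>i\<in>S. f i (x \<oplus>\<^bsub>M\<^esub> y)) = (\<Oplus>\<^bsub>N\<^esub>i\<in>S. f i x) \<oplus>\<^bsub>N\<^esub> (\<Oplus>\<^bsub>N\<^esub>i\<in>S. f i y)" .
  next
    fix c x assume cx: "c \<in> carrier K" "x \<in> carrier M"
    have "(\<Oplus>\<^bsub>N\<^esub>i\<in>S. f i (c \<odot>\<^bsub>M\<^esub> x)) = (\<Oplus>\<^bsub>N\<^esub>i\<in>S. c \<odot>\<^bsub>N\<^esub> f i x)"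
      using cx cl by (intro N.M.finsum_cong') (auto intro: linear_maps_smult[OF assms(4)])
    also have "\<dots> = c \<odot>\<^bsub>N\<^esub> (\<Oplus>\<^bsub>N\<^esub>i\<in>S. f i x)"
      using cl cx assms(3) by (intro N.finsum_smult_ldistr[symmetric]) auto
    finally show "(\<Oplus>\<^bsub>N\<^esub>i\<in>S. f i (c \<odot>\<^bsub>M\<^esub> x)) = c \<odot>\<^bsub>N\<^esub> (\<Oplus>\<^bsub>N\<^esub>i\<in>S. f i x)" .
  qed
qed

lemma linear_maps_smult_fun:
  assumes "module K N" "f \<in> linear_maps K M N" "c \<in> carrier K"
  shows "(\<lambda>x. c \<odot>\<^bsub>N\<^esub> f x) \<in> linear_maps K M N"
proof -
  interpret N: module K N by fact
  note f = linear_maps_closed[OF assms(2)] linear_maps_add[OF assms(2)] linear_maps_smult[OF assms(2)]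
  show ?thesis using assms(3)
    by (intro linear_mapsI)
      (auto simp: f N.smult_r_distr N.R.m_comm simp flip: N.smult_assoc1)
qed

lemma linear_maps_zero_fun:
  assumes "module K N"
  shows "(\<lambda>x. \<zero>\<^bsub>N\<^esub>) \<in> linear_maps K M N"
proof -
  interpret N: module K N by fact
  show ?thesis by (intro linear_mapsI) auto
qed

text \<open>Coordinate functions and linear forms take values in the ring, which is not of module
  type; this copy of K makes them elements of \<open>linear_maps\<close>.\<close>

definition self_module :: "('k, 'r) ring_scheme \<Rightarrow> ('k, 'k) module" where
  "self_module K = \<lparr>carrier = carrier K, mult = mult K, one = one K, zero = zero K,
     add = add K, smult = mult K\<rparr>"

lemma self_module_module:
  assumes "cring K"
  shows "module K (self_module K)"
proof -
  interpret K: cring K by fact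
  show ?thesis unfolding self_module_def
    by (rule moduleI, fact, rule abelian_groupI)
      (auto simp: K.a_ac K.l_distr K.r_distr K.m_assoc
        intro: bexI[of _ "\<ominus>\<^bsub>K\<^esub> x" for x] K.l_neg)
qed

section \<open>Free modules\<close>

lemma mem_free_module_iff:
  "f \<in> carrier (free_module K X) \<longleftrightarrow>
    (\<forall>x. f x \<in> carrier K) \<and> finite {x. f x \<noteq> \<zero>\<^bsub>K\<^esub>} \<and> (\<forall>x. f x \<noteq> \<zero>\<^bsub>K\<^esub> \<longrightarrow> x \<in> X)"
  by (auto simp: free_module_def)

lemma free_module_simps:
  "\<zero>\<^bsub>free_module K X\<^esub> = (\<lambda>_. \<zero>\<^bsub>K\<^esub>)"
  "f \<oplus>\<^bsub>free_module K X\<^esub> g = (\<lambda>x. f x \<oplus>\<^bsub>K\<^esub> g x)"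
  "c \<odot>\<^bsub>free_module K X\<^esub> f = (\<lambda>x. c \<otimes>\<^bsub>K\<^esub> f x)"
  by (auto simp: free_module_def)

lemma free_module_module:
  assumes "cring K"
  shows "module K (free_module K X)"
proof -
  interpret K: cring K by fact
  have coeff: "f x \<in> carrier K" if "f \<in> carrier (free_module K X)" for f x
    using that by (simp add: mem_free_module_iff)
  have add: "(\<lambda>x. f x \<oplus>\<^bsub>K\<^esub> g x) \<in> carrier (free_module K X)"
    if "f \<in> carrier (free_module K X)" "g \<in> carrier (free_module K X)" for f g
  proof -
    have "{x. f x \<oplus>\<^bsub>K\<^esub> g x \<noteq> \<zero>\<^bsub>K\<^esub>} \<subseteq> {x. f x \<noteq> \<zero>\<^bsub>K\<^esub>} \<union> {x. g x \<noteq> \<zero>\<^bsub>K\<^esub>}" by auto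
    then have "finite {x. f x \<oplus>\<^bsub>K\<^esub> g x \<noteq> \<zero>\<^bsub>K\<^esub>}"
      using that by (auto simp: mem_free_module_iff elim!: finite_subset)
    moreover have "x \<in> X" if "f x \<oplus>\<^bsub>K\<^esub> g x \<noteq> \<zero>\<^bsub>K\<^esub>" for x
    proof (rule ccontr)
      assume "x \<notin> X"
      then have "f x = \<zero>\<^bsub>K\<^esub>" "g x = \<zero>\<^bsub>K\<^esub>"
        using \<open>f \<in> _\<close> \<open>g \<in> _\<close> by (auto simp: mem_free_module_iff)
      then show False using that by simp
    qed
    ultimately show ?thesis using that by (auto simp: mem_free_module_iff)
  qed
  have smult: "(\<lambda>x. c \<otimes>\<^bsub>K\<^esub> f x) \<in> carrier (free_module K X)"
    if "c \<in> carrier K" "f \<in> carrier (free_module K X)" for c f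
  proof -
    have "{x. c \<otimes>\<^bsub>K\<^esub> f x \<noteq> \<zero>\<^bsub>K\<^esub>} \<subseteq> {x. f x \<noteq> \<zero>\<^bsub>K\<^esub>}" using that by auto
    then show ?thesis
      using that by (auto simp: mem_free_module_iff intro: finite_subset)
  qed
  show ?thesis
  proof (rule moduleI)
    show "abelian_group (free_module K X)"
    proof (rule abelian_groupI)
      fix f assume f: "f \<in> carrier (free_module K X)"
      have "(\<lambda>x. \<ominus>\<^bsub>K\<^esub> \<one>\<^bsub>K\<^esub> \<otimes>\<^bsub>K\<^esub> f x) \<in> carrier (free_module K X)"
        using f by (intro smult) auto
      moreover have "(\<ominus>\<^bsub>K\<^esub> \<one>\<^bsub>K\<^esub> \<otimes>\<^bsub>K\<^esub> f x) \<oplus>\<^bsub>K\<^esub> f x = \<zero>\<^bsub>K\<^esub>" for x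
        using f by (simp add: mem_free_module_iff K.l_minus K.l_neg)
      ultimately show "\<exists>y\<in>carrier (free_module K X).
          y \<oplus>\<^bsub>free_module K X\<^esub> f = \<zero>\<^bsub>free_module K X\<^esub>"
        by (auto simp: free_module_simps intro!: bexI)
    next
      show "\<zero>\<^bsub>free_module K X\<^esub> \<in> carrier (free_module K X)"
        by (simp add: mem_free_module_iff free_module_simps)
    qed (simp_all add: add free_module_simps coeff K.a_ac)
  qed (simp_all add: assms smult free_module_simps coeff K.l_distr K.r_distr K.m_assoc)
qed

lemma basis_elt_in_free_module:
  assumes "cring K" "x \<in> X"
  shows "basis_elt K x \<in> carrier (free_module K X)"
proof -
  interpret K: cring K by fact
  have "{y. basis_elt K x y \<noteq> \<zero>\<^bsub>K\<^esub>} \<subseteq> {x}" by (auto simp: basis_elt_def)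
  then have "finite {y. basis_elt K x y \<noteq> \<zero>\<^bsub>K\<^esub>}" by (rule finite_subset) simp
  then show ?thesis using assms(2) by (auto simp: mem_free_module_iff basis_elt_def)
qed

text \<open>\<open>lin_ext\<close> splits into the choice of a representative and this map, which is
  linear in \<open>f\<close> for every \<open>h\<close> with values in \<open>N\<close>. Only the
  choice forces \<open>h\<close> to respect relations.\<close>

definition lin_comb ::
    "('k, 'r) ring_scheme \<Rightarrow> ('k, 'n, 'q) module_scheme \<Rightarrow> ('x \<Rightarrow> 'n) \<Rightarrow> ('x \<Rightarrow> 'k) \<Rightarrow> 'n" where
  "lin_comb K N h f = (\<Oplus>\<^bsub>N\<^esub>x \<in> {x. f x \<noteq> \<zero>\<^bsub>K\<^esub>}. f x \<odot>\<^bsub>N\<^esub> h x)"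

lemma lin_ext_eq_lin_comb: "lin_ext K N h t = lin_comb K N h (SOME f. f \<in> t)"
  by (simp add: lin_ext_def lin_comb_def Let_def)

text \<open>The supports of f, g and their sum differ, so sums over supports cannot be added
  directly; a common finite index set makes them comparable.\<close>

lemma lin_comb_superset:
  assumes "module K N" "h \<in> X \<rightarrow> carrier N" "f \<in> carrier (free_module K X)"
    and "finite S" "{x. f x \<noteq> \<zero>\<^bsub>K\<^esub>} \<subseteq> S" "S \<subseteq> X"
  shows "lin_comb K N h f = (\<Oplus>\<^bsub>N\<^esub>x\<in>S. f x \<odot>\<^bsub>N\<^esub> h x)"
proof -
  interpret N: module K N by fact
  show ?thesis unfolding lin_comb_def
    by (rule N.M.add.finprod_mono_neutral_cong_left)
      (use assms in \<open>auto simp: mem_free_module_iff Pi_iff\<close>)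
qed

lemma lin_comb_linear:
  assumes "module K N" "h \<in> X \<rightarrow> carrier N"
  shows "lin_comb K N h \<in> linear_maps K (free_module K X) N"
proof (rule linear_mapsI)
  interpret N: module K N by fact
  interpret F: module K "free_module K X" by (rule free_module_module) (rule N.R.is_cring)
  fix f assume f: "f \<in> carrier (free_module K X)"
  have fh: "(\<lambda>x. f x \<odot>\<^bsub>N\<^esub> h x) \<in> {x. f x \<noteq> \<zero>\<^bsub>K\<^esub>} \<rightarrow> carrier N"
    using f assms(2) by (auto simp: mem_free_module_iff)
  then show "lin_comb K N h f \<in> carrier N" unfolding lin_comb_def
    by (rule N.M.finsum_closed)
  {
    fix g assume g: "g \<in> carrier (free_module K X)"
    let ?S = "{x. f x \<noteq> \<zero>\<^bsub>K\<^esub>} \<union> {x. g x \<noteq> \<zero>\<^bsub>K\<^esub>}"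
    have S: "finite ?S" "?S \<subseteq> X" using f g by (auto simp: mem_free_module_iff)
    have "lin_comb K N h (f \<oplus>\<^bsub>free_module K X\<^esub> g) =
        (\<Oplus>\<^bsub>N\<^esub>x\<in>?S. (f \<oplus>\<^bsub>free_module K X\<^esub> g) x \<odot>\<^bsub>N\<^esub> h x)"
      using F.M.a_closed[OF f g] by (rule lin_comb_superset[OF assms _ S(1) _ S(2)])
        (auto simp: free_module_simps)
    also have "\<dots> = (\<Oplus>\<^bsub>N\<^esub>x\<in>?S. f x \<odot>\<^bsub>N\<^esub> h x \<oplus>\<^bsub>N\<^esub> g x \<odot>\<^bsub>N\<^esub> h x)"
      using assms f g S
      by (intro N.M.finsum_cong')
        (auto simp: free_module_simps mem_free_module_iff Pi_iff intro!: N.smult_l_distr)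
    also have "\<dots> = (\<Oplus>\<^bsub>N\<^esub>x\<in>?S. f x \<odot>\<^bsub>N\<^esub> h x) \<oplus>\<^bsub>N\<^esub> (\<Oplus>\<^bsub>N\<^esub>x\<in>?S. g x \<odot>\<^bsub>N\<^esub> h x)"
      using assms f g S
      by (intro N.M.finsum_addf) (auto simp: mem_free_module_iff Pi_iff)
    also have "\<dots> = lin_comb K N h f \<oplus>\<^bsub>N\<^esub> lin_comb K N h g"
      using assms f g S by (subst (1 2) lin_comb_superset[of K N h X _ ?S]) auto
    finally show "lin_comb K N h (f \<oplus>\<^bsub>free_module K X\<^esub> g) = lin_comb K N h f \<oplus>\<^bsub>N\<^esub> lin_comb K N h g" .
  }
  fix c assume c: "c \<in> carrier K"
  let ?S = "{x. f x \<noteq> \<zero>\<^bsub>K\<^esub>}"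
  have S: "finite ?S" "?S \<subseteq> X" using f by (auto simp: mem_free_module_iff)
  have "lin_comb K N h (c \<odot>\<^bsub>free_module K X\<^esub> f) =
      (\<Oplus>\<^bsub>N\<^esub>x\<in>?S. (c \<odot>\<^bsub>free_module K X\<^esub> f) x \<odot>\<^bsub>N\<^esub> h x)"
    using assms f c S F.smult_closed[OF c f] by (intro lin_comb_superset) (auto simp: free_module_simps)
  also have "\<dots> = (\<Oplus>\<^bsub>N\<^esub>x\<in>?S. c \<odot>\<^bsub>N\<^esub> (f x \<odot>\<^bsub>N\<^esub> h x))"
    using assms f c S
    by (intro N.M.finsum_cong')
      (auto simp: free_module_simps mem_free_module_iff Pi_iff intro!: N.smult_assoc1)
  also have "\<dots> = c \<odot>\<^bsub>N\<^esub> lin_comb K N h f"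
    unfolding lin_comb_def using c S fh by (intro N.finsum_smult_ldistr[symmetric]) auto
  finally show "lin_comb K N h (c \<odot>\<^bsub>free_module K X\<^esub> f) = c \<odot>\<^bsub>N\<^esub> lin_comb K N h f" .
qed

lemma lin_comb_basis_elt:
  assumes "module K N" "h x \<in> carrier N"
  shows "lin_comb K N h (basis_elt K x) = h x"
proof -
  interpret N: module K N by fact
  have "lin_comb K N h (basis_elt K x) = (\<Oplus>\<^bsub>N\<^esub>y\<in>{x}. basis_elt K x y \<odot>\<^bsub>N\<^esub> h y)"
    by (rule lin_comb_superset[where X = "{x}"])
      (use assms basis_elt_in_free_module[OF N.R.is_cring, of x "{x}"] in
        \<open>auto simp: basis_elt_def\<close>)
  also have "\<dots> = h x"
    using assms(2) by (subst N.M.finsum_insert) (auto simp: basis_elt_def)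
  finally show ?thesis .
qed

text \<open>Evaluation at a point y is linear, so it passes inside the sum, where only the summand x
  = y survives.\<close>

lemma lin_comb_basis_elt_self:
  assumes "cring K" "f \<in> carrier (free_module K X)"
  shows "lin_comb K (free_module K X) (basis_elt K) f = f"
proof -
  interpret F: module K "free_module K X" by (rule free_module_module) fact
  interpret K: module K "self_module K" by (rule self_module_module) fact
  have coord: "(\<lambda>g. g y) \<in> linear_maps K (free_module K X) (self_module K)" for y
    by (rule linear_mapsI) (auto simp: self_module_def free_module_simps mem_free_module_iff)
  show ?thesis
  proof
    fix y
    let ?S = "{x. f x \<noteq> \<zero>\<^bsub>K\<^esub>}"
    have S: "finite ?S" "?S \<subseteq> X" using assms(2) by (auto simp: mem_free_module_iff)
    have "lin_comb K (free_module K X) (basis_elt K) f y =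
        (\<Oplus>\<^bsub>self_module K\<^esub>x\<in>?S. (f x \<odot>\<^bsub>free_module K X\<^esub> basis_elt K x) y)"
      unfolding lin_comb_def
      by (intro linear_maps_finsum[OF F.module_axioms K.module_axioms coord S(1)])
        (use assms(2) S(2) in \<open>auto simp: mem_free_module_iff[of f]
          intro!: F.smult_closed basis_elt_in_free_module[OF assms(1)]\<close>)
    also have "\<dots> = (\<Oplus>\<^bsub>self_module K\<^esub>x\<in>?S. if y = x then f x else \<zero>\<^bsub>self_module K\<^esub>)"
      using assms(2)
      by (intro K.M.finsum_cong')
        (auto simp: free_module_simps basis_elt_def mem_free_module_iff self_module_def)
    also have "\<dots> = f y"
    proof (cases "y \<in> ?S")
      case True
      then show ?thesis
        using K.M.finsum_singleton[of y ?S f] S assms(2)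
        by (auto simp: mem_free_module_iff self_module_def)
    next
      case False
      then have "(\<Oplus>\<^bsub>self_module K\<^esub>x\<in>?S. if y = x then f x else \<zero>\<^bsub>self_module K\<^esub>) = \<zero>\<^bsub>K\<^esub>"
        by (intro K.M.add.finprod_one_eqI[THEN trans]) (auto simp: self_module_def)
      then show ?thesis using False by simp
    qed
    finally show "lin_comb K (free_module K X) (basis_elt K) f y = f y" .
  qed
qed

lemma (in abelian_group) minus_eq_zero_iff:
  assumes "x \<in> carrier G" "y \<in> carrier G"
  shows "x \<ominus> y = \<zero> \<longleftrightarrow> x = y"
proof
  assume "x \<ominus> y = \<zero>"
  then have "\<ominus> (\<ominus> y) = x" using assms unfolding a_minus_def by (intro minus_equality) auto
  then show "x = y" using assms by simp
qed (use assms in \<open>simp add: a_minus_def r_neg\<close>)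

section \<open>Quotients and presentations\<close>

lemma abelian_subgroup_of_submodule:
  assumes "module K M" "submodule H K M"
  shows "abelian_subgroup H M"
proof -
  interpret M: module K M by fact
  show ?thesis
    using assms(2) by (intro abelian_subgroupI3 additive_subgroupI M.M.abelian_group_axioms)
      (simp add: submodule_def)
qed

text \<open>Scalar multiplication is defined as a union over all elements s of the coset. The cosets
  united coincide, because c(s - x) stays in \<open>H\<close>, and the union is nonempty, because x
  lies in its own coset.\<close>

lemma quotient_module_smult:
  assumes "module K M" "submodule H K M" "c \<in> carrier K" "x \<in> carrier M"
  shows "c \<odot>\<^bsub>quotient_module M H\<^esub> (H +>\<^bsub>M\<^esub> x) = H +>\<^bsub>M\<^esub> (c \<odot>\<^bsub>M\<^esub> x)"
proof -
  interpret M: module K M by fact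
  interpret H: abelian_subgroup H M by (rule abelian_subgroup_of_submodule) fact+
  have "H +>\<^bsub>M\<^esub> (c \<odot>\<^bsub>M\<^esub> s) = H +>\<^bsub>M\<^esub> (c \<odot>\<^bsub>M\<^esub> x)" if s: "s \<in> H +>\<^bsub>M\<^esub> x" for s
  proof -
    have sM: "s \<in> carrier M" using s assms(4) by (rule H.a_elemrcos_carrier[rotated])
    have "s \<oplus>\<^bsub>M\<^esub> \<ominus>\<^bsub>M\<^esub> x \<in> H" using assms(4) s by (rule H.a_rcos_module_imp)
    then have "c \<odot>\<^bsub>M\<^esub> (s \<oplus>\<^bsub>M\<^esub> \<ominus>\<^bsub>M\<^esub> x) \<in> H"
      using assms by (intro submodule.smult_closed)
    then have "c \<odot>\<^bsub>M\<^esub> s \<oplus>\<^bsub>M\<^esub> \<ominus>\<^bsub>M\<^esub> (c \<odot>\<^bsub>M\<^esub> x) \<in> H"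
      using sM assms by (simp add: M.smult_r_distr M.smult_r_minus)
    then have "c \<odot>\<^bsub>M\<^esub> s \<in> H +>\<^bsub>M\<^esub> (c \<odot>\<^bsub>M\<^esub> x)"
      using sM assms by (intro H.a_rcos_module_rev) auto
    then show ?thesis using assms by (intro H.a_repr_independence'[symmetric]) auto
  qed
  moreover have "x \<in> H +>\<^bsub>M\<^esub> x" using assms(4) by (rule H.a_rcos_self)
  ultimately have "(\<Union>s\<in>H +>\<^bsub>M\<^esub> x. H +>\<^bsub>M\<^esub> (c \<odot>\<^bsub>M\<^esub> s)) = H +>\<^bsub>M\<^esub> (c \<odot>\<^bsub>M\<^esub> x)"
    by blast
  then show ?thesis by (simp add: quotient_module_def)
qed

lemma quotient_module_simps:
  "\<zero>\<^bsub>quotient_module M H\<^esub> = H"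
  "S \<oplus>\<^bsub>quotient_module M H\<^esub> S' = S <+>\<^bsub>M\<^esub> S'"
  "carrier (quotient_module M H) = a_rcosets\<^bsub>M\<^esub> H"
  by (auto simp: quotient_module_def)

lemma quotient_module_module:
  assumes "module K M" "submodule H K M"
  shows "module K (quotient_module M H)"
proof -
  interpret M: module K M by fact
  interpret H: abelian_subgroup H M by (rule abelian_subgroup_of_submodule) fact+
  let ?Q = "quotient_module M H"
  have coset: "\<exists>x\<in>carrier M. S = H +>\<^bsub>M\<^esub> x" if "S \<in> carrier ?Q" for S
    using that by (auto simp: quotient_module_simps A_RCOSETS_def')
  have rc: "H +>\<^bsub>M\<^esub> x \<in> carrier ?Q" if "x \<in> carrier M" for x
    using that by (auto simp: quotient_module_simps A_RCOSETS_def')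
  have sum: "(H +>\<^bsub>M\<^esub> x) \<oplus>\<^bsub>?Q\<^esub> (H +>\<^bsub>M\<^esub> y) = H +>\<^bsub>M\<^esub> (x \<oplus>\<^bsub>M\<^esub> y)"
    if "x \<in> carrier M" "y \<in> carrier M" for x y
    using that by (simp add: quotient_module_simps H.a_rcos_sum)
  have zero: "\<zero>\<^bsub>?Q\<^esub> = H +>\<^bsub>M\<^esub> \<zero>\<^bsub>M\<^esub>"
    using H.a_subset by (simp add: quotient_module_simps M.M.a_coset_add_zero)
  note smult = quotient_module_smult[OF assms]
  show ?thesis
  proof (rule moduleI)
    show "cring K" by (rule M.R.is_cring)
    show "abelian_group ?Q"
    proof (rule abelian_groupI)
      fix S assume "S \<in> carrier ?Q"
      then obtain x where x: "x \<in> carrier M" "S = H +>\<^bsub>M\<^esub> x" using coset by blast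
      show "\<exists>S'\<in>carrier ?Q. S' \<oplus>\<^bsub>?Q\<^esub> S = \<zero>\<^bsub>?Q\<^esub>"
        using x by (intro bexI[OF _ rc[of "\<ominus>\<^bsub>M\<^esub> x"]]) (simp_all add: sum zero M.M.l_neg)
    qed (auto dest!: coset simp: sum zero M.M.a_ac intro!: rc)
  qed (auto dest!: coset simp: sum smult M.smult_l_distr M.smult_r_distr M.smult_assoc1 intro!: rc)
qed

lemma quotient_map_linear:
  assumes "module K M" "submodule H K M"
  shows "(\<lambda>x. H +>\<^bsub>M\<^esub> x) \<in> linear_maps K M (quotient_module M H)"
proof -
  interpret M: module K M by fact
  interpret H: abelian_subgroup H M by (rule abelian_subgroup_of_submodule) fact+
  show ?thesis
    by (rule linear_mapsI)
      (use assms in \<open>auto simp: quotient_module_simps A_RCOSETS_def' H.a_rcos_sum quotient_module_smult\<close>)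
qed

text \<open>As \<open>R\<close> lies in \<open>carrier M\<close>, the carrier belongs to the family
  that is intersected, which keeps the intersection inside \<open>M\<close>.\<close>

lemma submodule_generated_submodule:
  assumes "module K M" "R \<subseteq> carrier M"
  shows "submodule (submodule_generated K M R) K M"
proof -
  interpret M: module K M by fact
  have "carrier M \<in> {H. submodule H K M \<and> R \<subseteq> H}"
    using assms M.carrier_is_submodule by simp
  then show ?thesis
    unfolding submodule_generated_def
    by (intro M.submoduleI) (auto intro: M.submoduleE(3-5)
        subgroup.one_closed[OF submodule.axioms(1), simplified])
qed

lemma linear_maps_kernel_submodule:
  assumes "module K M" "module K N" "f \<in> linear_maps K M N"
  shows "submodule {x \<in> carrier M. f x = \<zero>\<^bsub>N\<^esub>} K M"
proof -
  interpret M: module K M by fact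
  interpret N: module K N by fact
  show ?thesis
    by (rule M.submoduleI)
      (auto simp: linear_maps_zero[OF assms] linear_maps_add[OF assms(3)]
        linear_maps_smult[OF assms(3)] linear_maps_uminus[OF assms])
qed

text \<open>Tensor powers and spaces of typed words are both presented modules; their universal
  property is proved once, here.\<close>

locale presentation =
  fixes K :: "('k, 'r) ring_scheme" and X :: "'x set" and R :: "('x \<Rightarrow> 'k) set"
  assumes cring: "cring K" and relations: "R \<subseteq> carrier (free_module K X)"
begin

abbreviation "F \<equiv> free_module K X"
abbreviation "P \<equiv> presented_module K X R"
abbreviation "gen \<equiv> presented_gen K X R"
abbreviation "proj f \<equiv> submodule_generated K F R +>\<^bsub>F\<^esub> f"

lemma module_F: "module K F"
  by (rule free_module_module) (rule cring)

lemma submodule_relations: "submodule (submodule_generated K F R) K F"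
  by (rule submodule_generated_submodule[OF module_F relations])

lemma module_P: "module K P"
  unfolding presented_module_def
  by (rule quotient_module_module[OF module_F submodule_relations])

lemma proj_linear: "(\<lambda>f. proj f) \<in> linear_maps K F P"
  unfolding presented_module_def by (rule quotient_map_linear[OF module_F submodule_relations])

lemma proj_cases:
  assumes "t \<in> carrier P"
  obtains f where "f \<in> carrier F" "t = proj f"
  using assms by (auto simp: presented_module_def quotient_module_simps A_RCOSETS_def')

lemma proj_relation: "r \<in> R \<Longrightarrow> proj r = \<zero>\<^bsub>P\<^esub>"
  using abelian_subgroup.a_rcos_const[OF abelian_subgroup_of_submodule[OF module_F submodule_relations]]
  by (auto simp: presented_module_def quotient_module_simps submodule_generated_def)

lemma gen_closed: "x \<in> X \<Longrightarrow> gen x \<in> carrier P"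
  unfolding presented_gen_def
  by (rule linear_maps_closed[OF proj_linear basis_elt_in_free_module[OF cring]])

text \<open>A coset contains the combination it was built from, so the choice in
  \<open>lin_ext\<close> does return a representative.\<close>

lemma some_representative:
  assumes "t \<in> carrier P"
  shows "(SOME f. f \<in> t) \<in> carrier F" "proj (SOME f. f \<in> t) = t"
proof -
  interpret H: abelian_subgroup "submodule_generated K F R" F
    by (rule abelian_subgroup_of_submodule[OF module_F submodule_relations])
  obtain f where f: "f \<in> carrier F" "t = proj f" using assms by (rule proj_cases)
  have "f \<in> proj f" using f(1) by (rule H.a_rcos_self)
  then have *: "(SOME f. f \<in> t) \<in> proj f" unfolding f(2) by (rule someI[of "\<lambda>g. g \<in> proj f"])
  then show "(SOME f. f \<in> t) \<in> carrier F" using f(1) by (rule H.a_elemrcos_carrier[rotated])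
  show "proj (SOME f. f \<in> t) = t" using H.a_repr_independence'[OF * f(1)] f(2) by simp
qed

lemma proj_eq_lin_comb_gen:
  assumes "f \<in> carrier F"
  shows "proj f = lin_comb K P gen f"
proof -
  interpret F: module K F by (rule module_F)
  have f: "finite {x. f x \<noteq> \<zero>\<^bsub>K\<^esub>}" "\<And>x. f x \<in> carrier K" "\<And>x. f x \<noteq> \<zero>\<^bsub>K\<^esub> \<Longrightarrow> x \<in> X"
    using assms by (auto simp: mem_free_module_iff)
  have b: "basis_elt K x \<in> carrier F" if "x \<in> X" for x
    using that by (rule basis_elt_in_free_module[OF cring])
  have P: "gen x \<in> carrier P" if "x \<in> X" for x using that by (rule gen_closed)
  interpret P: module K P by (rule module_P)
  have "proj f = proj (lin_comb K F (basis_elt K) f)"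
    using lin_comb_basis_elt_self[OF cring assms] by simp
  also have "\<dots> = (\<Oplus>\<^bsub>P\<^esub>x\<in>{x. f x \<noteq> \<zero>\<^bsub>K\<^esub>}. proj (f x \<odot>\<^bsub>F\<^esub> basis_elt K x))"
    unfolding lin_comb_def
    by (rule linear_maps_finsum[OF module_F module_P proj_linear f(1)]) (use f b in auto)
  also have "\<dots> = lin_comb K P gen f"
    unfolding lin_comb_def
    by (rule P.M.finsum_cong')
      (use f b P in \<open>auto simp: linear_maps_smult[OF proj_linear] presented_gen_def\<close>)
  finally show ?thesis .
qed

text \<open>Every element is a finite combination of generators; the induction runs over the finite
  set of summands.\<close>

lemma gen_induct [consumes 1, case_names zero gen add smult]:
  assumes "t \<in> carrier P"
    and "Q \<zero>\<^bsub>P\<^esub>" "\<And>x. x \<in> X \<Longrightarrow> Q (gen x)"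
    and "\<And>s t. s \<in> carrier P \<Longrightarrow> t \<in> carrier P \<Longrightarrow> Q s \<Longrightarrow> Q t \<Longrightarrow> Q (s \<oplus>\<^bsub>P\<^esub> t)"
    and "\<And>c t. c \<in> carrier K \<Longrightarrow> t \<in> carrier P \<Longrightarrow> Q t \<Longrightarrow> Q (c \<odot>\<^bsub>P\<^esub> t)"
  shows "Q t"
proof -
  interpret P: module K P by (rule module_P)
  obtain f where f: "f \<in> carrier F" "t = proj f" using assms(1) by (rule proj_cases)
  have fS: "finite {x. f x \<noteq> \<zero>\<^bsub>K\<^esub>}" "{x. f x \<noteq> \<zero>\<^bsub>K\<^esub>} \<subseteq> X" "\<And>x. f x \<in> carrier K"
    using f(1) by (auto simp: mem_free_module_iff)
  have "Q (\<Oplus>\<^bsub>P\<^esub>x\<in>S. f x \<odot>\<^bsub>P\<^esub> gen x)" if "finite S" "S \<subseteq> X" for S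
    using that
  proof (induction S)
    case empty
    then show ?case using assms(2) by simp
  next
    case (insert x S)
    have "(\<lambda>x. f x \<odot>\<^bsub>P\<^esub> gen x) \<in> S \<rightarrow> carrier P" "f x \<odot>\<^bsub>P\<^esub> gen x \<in> carrier P"
      using insert.prems fS(3) by (auto intro!: P.smult_closed gen_closed)
    then show ?case
      using insert assms(3-5) fS(3)
      by (simp add: P.M.finsum_closed gen_closed)
  qed
  from this[OF fS(1,2)] show ?thesis
    unfolding f(2) proj_eq_lin_comb_gen[OF f(1)] lin_comb_def .
qed

lemma linear_maps_eqI:
  assumes "module K N" "f \<in> linear_maps K P N" "g \<in> linear_maps K P N"
    and "\<And>x. x \<in> X \<Longrightarrow> f (gen x) = g (gen x)" "t \<in> carrier P"
  shows "f t = g t"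
  using assms(5)
  by (induction rule: gen_induct)
    (simp_all add: assms(4) linear_maps_zero[OF module_P assms(1)] linear_maps_add[OF assms(2)]
      linear_maps_add[OF assms(3)] linear_maps_smult[OF assms(2)] linear_maps_smult[OF assms(3)]
      assms(2,3))

lemma lin_ext_closed:
  assumes "module K N" "h \<in> X \<rightarrow> carrier N" "t \<in> carrier P"
  shows "lin_ext K N h t \<in> carrier N"
  unfolding lin_ext_eq_lin_comb
  by (rule linear_maps_closed[OF lin_comb_linear[OF assms(1,2)] some_representative(1)[OF assms(3)]])

lemma lin_ext_cong:
  assumes "module K N" "\<And>x. x \<in> X \<Longrightarrow> h x = h' x" "h' \<in> X \<rightarrow> carrier N" "t \<in> carrier P"
  shows "lin_ext K N h t = lin_ext K N h' t"
proof -
  interpret N: module K N by fact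
  show ?thesis
    unfolding lin_ext_eq_lin_comb lin_comb_def
    by (rule N.M.finsum_cong')
      (use assms some_representative(1)[OF assms(4)] in \<open>auto simp: mem_free_module_iff Pi_iff\<close>)
qed

text \<open>The representative chosen by \<open>lin_ext\<close> depends neither on the target nor on
  the values on generators, so both sides are built from the same finite sum and \<open>g\<close>
  only has to pass through it.\<close>

lemma linear_map_lin_ext:
  assumes "module K N" "module K N'" "g \<in> linear_maps K N N'" "h \<in> X \<rightarrow> carrier N" "t \<in> carrier P"
  shows "g (lin_ext K N h t) = lin_ext K N' (\<lambda>x. g (h x)) t"
proof -
  interpret N: module K N by fact
  interpret N': module K N' by fact
  define f where "f = (SOME f. f \<in> t)"
  have f: "finite {x. f x \<noteq> \<zero>\<^bsub>K\<^esub>}" "\<And>x. f x \<in> carrier K" "\<And>x. f x \<noteq> \<zero>\<^bsub>K\<^esub> \<Longrightarrow> x \<in> X"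
    using some_representative(1)[OF assms(5)] by (auto simp: f_def mem_free_module_iff)
  have h: "f x \<noteq> \<zero>\<^bsub>K\<^esub> \<Longrightarrow> h x \<in> carrier N" for x using assms(4) f(3) by auto
  have "g (lin_comb K N h f) = (\<Oplus>\<^bsub>N'\<^esub>x\<in>{x. f x \<noteq> \<zero>\<^bsub>K\<^esub>}. g (f x \<odot>\<^bsub>N\<^esub> h x))"
    unfolding lin_comb_def
    by (rule linear_maps_finsum[OF assms(1-3) f(1)]) (use f h in auto)
  also have "\<dots> = lin_comb K N' (\<lambda>x. g (h x)) f"
    unfolding lin_comb_def
    by (rule N'.M.finsum_cong')
      (use f h in \<open>auto simp: linear_maps_smult[OF assms(3)]
        intro!: N'.smult_closed linear_maps_closed[OF assms(3)]\<close>)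
  finally show ?thesis unfolding lin_ext_eq_lin_comb f_def .
qed

text \<open>For fixed \<open>t\<close> the representative is the same for all \<open>m\<close>,
  which leaves a finite sum of linear maps of \<open>m\<close> with constant coefficients.\<close>

lemma lin_ext_linear_parameter:
  assumes "module K M" "module K N" "\<And>x. x \<in> X \<Longrightarrow> (\<lambda>m. h m x) \<in> linear_maps K M N"
    and "t \<in> carrier P"
  shows "(\<lambda>m. lin_ext K N (h m) t) \<in> linear_maps K M N"
  unfolding lin_ext_def Let_def
  by (rule linear_maps_finsum_fun[OF assms(1,2)])
    (use some_representative(1)[OF assms(4)] assms in
      \<open>auto simp: mem_free_module_iff intro!: linear_maps_smult_fun\<close>)

text \<open>Two representatives differ by an element of the generated submodule. That submodule lies
  in the kernel of \<open>lin_comb\<close>, a submodule containing \<open>R\<close>, so the choice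
  inside \<open>lin_ext\<close> does not matter.\<close>

lemma lin_ext_proj:
  assumes "module K N" "h \<in> X \<rightarrow> carrier N" "\<And>r. r \<in> R \<Longrightarrow> lin_comb K N h r = \<zero>\<^bsub>N\<^esub>"
    and "f \<in> carrier F"
  shows "lin_ext K N h (proj f) = lin_comb K N h f"
proof -
  interpret F: module K F by (rule module_F)
  interpret N: module K N by fact
  interpret H: abelian_subgroup "submodule_generated K F R" F
    by (rule abelian_subgroup_of_submodule[OF module_F submodule_relations])
  define g where "g = (SOME g. g \<in> proj f)"
  have L: "lin_comb K N h \<in> linear_maps K F N" by (rule lin_comb_linear[OF assms(1,2)])
  have fP: "proj f \<in> carrier P" by (rule linear_maps_closed[OF proj_linear assms(4)])
  have g: "g \<in> carrier F" "proj g = proj f"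
    using some_representative[OF fP] by (simp_all add: g_def)
  have "g \<oplus>\<^bsub>F\<^esub> \<ominus>\<^bsub>F\<^esub> f \<in> submodule_generated K F R"
    using H.a_rcos_self[OF g(1)] unfolding g(2) by (rule H.a_rcos_module_imp[OF assms(4)])
  moreover have "submodule_generated K F R \<subseteq> {x \<in> carrier F. lin_comb K N h x = \<zero>\<^bsub>N\<^esub>}"
    using linear_maps_kernel_submodule[OF module_F assms(1) L] relations assms(3)
    by (auto simp: submodule_generated_def)
  ultimately have "lin_comb K N h (g \<ominus>\<^bsub>F\<^esub> f) = \<zero>\<^bsub>N\<^esub>" by (auto simp: a_minus_def)
  then have "lin_comb K N h g \<ominus>\<^bsub>N\<^esub> lin_comb K N h f = \<zero>\<^bsub>N\<^esub>"
    using linear_maps_minus[OF module_F assms(1) L g(1) assms(4)] by simp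
  then have "lin_comb K N h g = lin_comb K N h f"
    using linear_maps_closed[OF L g(1)] linear_maps_closed[OF L assms(4)]
    by (simp add: N.M.minus_eq_zero_iff)
  then show ?thesis by (simp add: lin_ext_eq_lin_comb g_def)
qed

lemma lin_ext_linear:
  assumes "module K N" "h \<in> X \<rightarrow> carrier N" "\<And>r. r \<in> R \<Longrightarrow> lin_comb K N h r = \<zero>\<^bsub>N\<^esub>"
  shows "lin_ext K N h \<in> linear_maps K P N"
proof (rule linear_mapsI)
  interpret F: module K F by (rule module_F)
  have L: "lin_comb K N h \<in> linear_maps K F N" by (rule lin_comb_linear[OF assms(1,2)])
  note e = lin_ext_proj[OF assms]
  fix s assume "s \<in> carrier P"
  then obtain f where f: "f \<in> carrier F" "s = proj f" by (rule proj_cases)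
  show "lin_ext K N h s \<in> carrier N"
    using f linear_maps_closed[OF L] by (simp add: e)
  {
    fix t assume "t \<in> carrier P"
    then obtain g where g: "g \<in> carrier F" "t = proj g" by (rule proj_cases)
    have "lin_ext K N h (s \<oplus>\<^bsub>P\<^esub> t) = lin_comb K N h (f \<oplus>\<^bsub>F\<^esub> g)"
      unfolding f(2) g(2) linear_maps_add[OF proj_linear f(1) g(1), symmetric]
      using f(1) g(1) by (intro e F.M.a_closed)
    then show "lin_ext K N h (s \<oplus>\<^bsub>P\<^esub> t) = lin_ext K N h s \<oplus>\<^bsub>N\<^esub> lin_ext K N h t"
      using f g linear_maps_add[OF L f(1) g(1)] by (simp add: e)
  }
  fix c assume c: "c \<in> carrier K"
  have "lin_ext K N h (c \<odot>\<^bsub>P\<^esub> s) = lin_comb K N h (c \<odot>\<^bsub>F\<^esub> f)"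
    unfolding f(2) linear_maps_smult[OF proj_linear c f(1), symmetric]
    using f(1) c by (intro e F.smult_closed)
  then show "lin_ext K N h (c \<odot>\<^bsub>P\<^esub> s) = c \<odot>\<^bsub>N\<^esub> lin_ext K N h s"
    using f linear_maps_smult[OF L c f(1)] by (simp add: e)
qed

lemma lin_ext_gen:
  assumes "module K N" "h \<in> X \<rightarrow> carrier N" "\<And>r. r \<in> R \<Longrightarrow> lin_comb K N h r = \<zero>\<^bsub>N\<^esub>" "x \<in> X"
  shows "lin_ext K N h (gen x) = h x"
  unfolding presented_gen_def
  using lin_ext_proj[OF assms(1-3) basis_elt_in_free_module[OF cring assms(4)]]
    lin_comb_basis_elt[OF assms(1), of h x] assms(2,4) by auto

end

section \<open>Slot relations and multilinearity\<close>

lemma slot_relations_subset: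
  assumes "module K M" "\<And>m. m \<in> carrier M \<Longrightarrow> s m \<in> X"
  shows "slot_relations K X M s \<subseteq> carrier (free_module K X)"
proof -
  interpret M: module K M by fact
  interpret F: module K "free_module K X" by (rule free_module_module[OF M.R.is_cring])
  show ?thesis
    using assms(2) by (auto simp: slot_relations_def intro!: F.M.minus_closed F.M.a_closed
        F.smult_closed basis_elt_in_free_module[OF M.R.is_cring])
qed

text \<open>On a relation the combination becomes h(s(m + m')) - (h(s m) + h(s m')), or its scalar
  analogue. Extending a map to a tensor space thus reduces to linearity in each slot.\<close>

lemma lin_comb_slot_relation:
  assumes "module K M" "module K N" "\<And>m. m \<in> carrier M \<Longrightarrow> s m \<in> X"
    and "h \<in> X \<rightarrow> carrier N" "(\<lambda>m. h (s m)) \<in> linear_maps K M N"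
    and "r \<in> slot_relations K X M s"
  shows "lin_comb K N h r = \<zero>\<^bsub>N\<^esub>"
proof -
  interpret M: module K M by fact
  interpret N: module K N by fact
  interpret F: module K "free_module K X" by (rule free_module_module[OF M.R.is_cring])
  have L: "lin_comb K N h \<in> linear_maps K (free_module K X) N"
    by (rule lin_comb_linear[OF assms(2,4)])
  note L' = linear_maps_minus[OF F.module_axioms assms(2) L] linear_maps_add[OF L] linear_maps_smult[OF L]
  have b: "basis_elt K (s m) \<in> carrier (free_module K X)" if "m \<in> carrier M" for m
    using that by (intro basis_elt_in_free_module[OF M.R.is_cring] assms(3))
  have e: "lin_comb K N h (basis_elt K (s m)) = h (s m)" if "m \<in> carrier M" for m
    using that assms(3,4) by (intro lin_comb_basis_elt[OF assms(2)]) auto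
  have hs: "h (s m) \<in> carrier N" if "m \<in> carrier M" for m
    using that assms(3,4) by auto
  from assms(6) show ?thesis
    unfolding slot_relations_def
    by (auto simp: L' b e linear_maps_add[OF assms(5)] linear_maps_smult[OF assms(5)] hs
        N.M.minus_eq_zero_iff)
qed

text \<open>Relations project to zero, and each of them equates the two sides of one linearity
  law.\<close>

lemma (in presentation) gen_slot_linear:
  assumes "module K M" "\<And>m. m \<in> carrier M \<Longrightarrow> s m \<in> X" "slot_relations K X M s \<subseteq> R"
  shows "(\<lambda>m. gen (s m)) \<in> linear_maps K M P"
proof -
  interpret M: module K M by fact
  interpret F: module K F by (rule module_F)
  interpret P: module K P by (rule module_P)
  note J = linear_maps_minus[OF module_F module_P proj_linear] linear_maps_add[OF proj_linear]
    linear_maps_smult[OF proj_linear]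
  have b: "basis_elt K (s m) \<in> carrier (free_module K X)" if "m \<in> carrier M" for m
    using that by (intro basis_elt_in_free_module[OF cring] assms(2))
  note eqI = P.M.minus_eq_zero_iff[THEN iffD1]
  show ?thesis
  proof (rule linear_mapsI)
    fix m assume m: "m \<in> carrier M"
    then show "gen (s m) \<in> carrier P" by (intro gen_closed assms(2))
    fix m' assume m': "m' \<in> carrier M"
    have "proj (basis_elt K (s (m \<oplus>\<^bsub>M\<^esub> m')) \<ominus>\<^bsub>F\<^esub> (basis_elt K (s m) \<oplus>\<^bsub>F\<^esub> basis_elt K (s m'))) = \<zero>\<^bsub>P\<^esub>"
      using m m' assms(3) by (intro proj_relation) (auto simp: slot_relations_def)
    then show "gen (s (m \<oplus>\<^bsub>M\<^esub> m')) = gen (s m) \<oplus>\<^bsub>P\<^esub> gen (s m')"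
      using m m' linear_maps_closed[OF proj_linear b]
      by - (rule eqI, simp_all add: J b presented_gen_def)
  next
    fix c m assume c: "c \<in> carrier K" and m: "m \<in> carrier M"
    have "proj (basis_elt K (s (c \<odot>\<^bsub>M\<^esub> m)) \<ominus>\<^bsub>F\<^esub> (c \<odot>\<^bsub>F\<^esub> basis_elt K (s m))) = \<zero>\<^bsub>P\<^esub>"
      using m c assms(3) by (intro proj_relation) (auto simp: slot_relations_def)
    then show "gen (s (c \<odot>\<^bsub>M\<^esub> m)) = c \<odot>\<^bsub>P\<^esub> gen (s m)"
      using m c linear_maps_closed[OF proj_linear b]
      by - (rule eqI, simp_all add: J b presented_gen_def)
  qed
qed

section \<open>Multilinear maps on tensor powers and on typed words\<close>

definition bilinear_maps ::
    "('k, 'r) ring_scheme \<Rightarrow> ('k, 'm, 'p) module_scheme \<Rightarrow> ('k, 'n, 'q) module_scheme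
     \<Rightarrow> ('k, 'l, 's) module_scheme \<Rightarrow> ('m \<Rightarrow> 'n \<Rightarrow> 'l) set" where
  "bilinear_maps K M N L = {h. (\<forall>m\<in>carrier M. h m \<in> linear_maps K N L) \<and>
     (\<forall>n\<in>carrier N. (\<lambda>m. h m n) \<in> linear_maps K M L)}"

lemma bilinear_mapsI:
  assumes "\<And>m. m \<in> carrier M \<Longrightarrow> (\<lambda>n. h m n) \<in> linear_maps K N L"
    and "\<And>n. n \<in> carrier N \<Longrightarrow> (\<lambda>m. h m n) \<in> linear_maps K M L"
  shows "h \<in> bilinear_maps K M N L"
  using assms by (simp add: bilinear_maps_def)

lemma bilinear_maps_left:
  "h \<in> bilinear_maps K M N L \<Longrightarrow> n \<in> carrier N \<Longrightarrow> (\<lambda>m. h m n) \<in> linear_maps K M L"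
  by (simp add: bilinear_maps_def)

lemma bilinear_maps_right:
  "h \<in> bilinear_maps K M N L \<Longrightarrow> m \<in> carrier M \<Longrightarrow> (\<lambda>n. h m n) \<in> linear_maps K N L"
  by (simp add: bilinear_maps_def)

lemma bilinear_maps_closed:
  "h \<in> bilinear_maps K M N L \<Longrightarrow> m \<in> carrier M \<Longrightarrow> n \<in> carrier N \<Longrightarrow> h m n \<in> carrier L"
  by (rule linear_maps_closed[OF bilinear_maps_right])

section \<open>Universal property of tensor powers; two and three factors\<close>

lemma tensor_presentation:
  assumes "module K A"
  shows "presentation K (tensor_words A n) (tensor_relations K A n)"
proof -
  interpret A: module K A by fact
  show ?thesis
  proof (rule presentation.intro)
    show "cring K" by (rule A.R.is_cring)
    show "tensor_relations K A n \<subseteq> carrier (free_module K (tensor_words A n))"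
      unfolding tensor_relations_def
    proof (rule Union_least)
      fix S
      assume "S \<in> {slot_relations K (tensor_words A n) A (\<lambda>a. u @ a # v) | u v.
        u \<in> lists (carrier A) \<and> v \<in> lists (carrier A) \<and> length u + length v + 1 = n}"
      then obtain u v where S: "S = slot_relations K (tensor_words A n) A (\<lambda>a. u @ a # v)"
        and "u \<in> lists (carrier A)" "v \<in> lists (carrier A)" "length u + length v + 1 = n"
        by blast
      then show "S \<subseteq> carrier (free_module K (tensor_words A n))"
        unfolding S by (intro slot_relations_subset[OF assms]) (auto simp: tensor_words_def)
    qed
  qed
qed

lemma tensor_power_module: "module K A \<Longrightarrow> module K (tensor_power K A n)"
  unfolding tensor_power_def by (rule presentation.module_P[OF tensor_presentation])

lemma pure_tensor_closed:
  "module K A \<Longrightarrow> w \<in> tensor_words A n \<Longrightarrow> pure_tensor K A w \<in> carrier (tensor_power K A n)"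
  using presentation.gen_closed[OF tensor_presentation, of K A w n]
  by (simp add: tensor_power_def pure_tensor_def tensor_words_def)

lemma pure_tensor_slot_linear:
  assumes "module K A" "u \<in> lists (carrier A)" "v \<in> lists (carrier A)" "length u + length v + 1 = n"
  shows "(\<lambda>a. pure_tensor K A (u @ a # v)) \<in> linear_maps K A (tensor_power K A n)"
proof -
  interpret presentation K "tensor_words A n" "tensor_relations K A n"
    by (rule tensor_presentation) fact
  have "slot_relations K (tensor_words A n) A (\<lambda>a. u @ a # v) \<subseteq> tensor_relations K A n"
    using assms(2-4) unfolding tensor_relations_def by blast
  with assms have "(\<lambda>a. gen (u @ a # v)) \<in> linear_maps K A P"
    by (intro gen_slot_linear) (auto simp: tensor_words_def)
  then show ?thesis
    using assms(4) by (simp add: tensor_power_def pure_tensor_def)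
qed

lemma tensor_power_eqI:
  assumes "module K A" "module K N"
    and "f \<in> linear_maps K (tensor_power K A n) N" "g \<in> linear_maps K (tensor_power K A n) N"
    and "\<And>w. w \<in> tensor_words A n \<Longrightarrow> f (pure_tensor K A w) = g (pure_tensor K A w)"
    and "t \<in> carrier (tensor_power K A n)"
  shows "f t = g t"
  using presentation.linear_maps_eqI[OF tensor_presentation[OF assms(1)] assms(2), of f n g t] assms(3-6)
  by (simp add: tensor_power_def pure_tensor_def tensor_words_def)

context
  fixes K :: "('k, 'r) ring_scheme" and A :: "('k, 'a, 'p) module_scheme"
    and N :: "('k, 'n, 'q) module_scheme" and h :: "'a list \<Rightarrow> 'n" and n :: nat
  assumes A: "module K A" and N: "module K N"
    and h: "\<And>w. w \<in> tensor_words A n \<Longrightarrow> h w \<in> carrier N"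
    and slots: "\<And>u v. u \<in> lists (carrier A) \<Longrightarrow> v \<in> lists (carrier A) \<Longrightarrow>
      length u + length v + 1 = n \<Longrightarrow> (\<lambda>a. h (u @ a # v)) \<in> linear_maps K A N"
begin

interpretation presentation K "tensor_words A n" "tensor_relations K A n"
  by (rule tensor_presentation) (rule A)

lemma tensor_relations_vanish: "r \<in> tensor_relations K A n \<Longrightarrow> lin_comb K N h r = \<zero>\<^bsub>N\<^esub>"
  unfolding tensor_relations_def
  using h slots by (auto simp: tensor_words_def elim!: lin_comb_slot_relation[OF A N, rotated -1])

lemma tensor_lin_ext_linear: "lin_ext K N h \<in> linear_maps K (tensor_power K A n) N"
  unfolding tensor_power_def using h tensor_relations_vanish by (intro lin_ext_linear N) auto

lemma tensor_lin_ext_pure: "w \<in> tensor_words A n \<Longrightarrow> lin_ext K N h (pure_tensor K A w) = h w"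
  using lin_ext_gen[OF N, of h w] h tensor_relations_vanish
  by (auto simp: pure_tensor_def tensor_words_def)

end

lemma tensor_words_2_iff: "w \<in> tensor_words A 2 \<longleftrightarrow> (\<exists>a\<in>carrier A. \<exists>b\<in>carrier A. w = [a, b])"
  by (auto simp: tensor_words_def length_Suc_conv numeral_2_eq_2)

lemma tensor_words_3_iff:
  "w \<in> tensor_words A 3 \<longleftrightarrow> (\<exists>a\<in>carrier A. \<exists>b\<in>carrier A. \<exists>c\<in>carrier A. w = [a, b, c])"
  by (auto simp: tensor_words_def length_Suc_conv numeral_3_eq_3)

lemma tensor2_lin_ext:
  assumes "module K A" "module K N" "h \<in> bilinear_maps K A A N"
  shows "lin_ext K N (\<lambda>w. h (w ! 0) (w ! 1)) \<in> linear_maps K (tensor_power K A 2) N"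
    and "a \<in> carrier A \<Longrightarrow> b \<in> carrier A \<Longrightarrow>
      lin_ext K N (\<lambda>w. h (w ! 0) (w ! 1)) (pure_tensor K A [a, b]) = h a b"
proof -
  have cl: "h (w ! 0) (w ! 1) \<in> carrier N" if "w \<in> tensor_words A 2" for w
    using that bilinear_maps_closed[OF assms(3)] by (auto simp: tensor_words_2_iff)
  have slots: "(\<lambda>a. h ((u @ a # v) ! 0) ((u @ a # v) ! 1)) \<in> linear_maps K A N"
    if uv: "u \<in> lists (carrier A)" "v \<in> lists (carrier A)" "length u + length v + 1 = 2" for u v
  proof (cases u)
    case Nil
    then obtain b where "v = [b]" using uv(3) by (auto simp: length_Suc_conv)
    then show ?thesis using that Nil bilinear_maps_left[OF assms(3)] by simp
  next
    case (Cons b u')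
    then show ?thesis using that bilinear_maps_right[OF assms(3)] by simp
  qed
  show "lin_ext K N (\<lambda>w. h (w ! 0) (w ! 1)) \<in> linear_maps K (tensor_power K A 2) N"
    using assms(1,2) cl slots by (rule tensor_lin_ext_linear)
  show "lin_ext K N (\<lambda>w. h (w ! 0) (w ! 1)) (pure_tensor K A [a, b]) = h a b"
    if "a \<in> carrier A" "b \<in> carrier A"
    using that
    by (subst tensor_lin_ext_pure[where n = 2, OF assms(1,2) cl slots]) (auto simp: tensor_words_2_iff)
qed

lemma tensor3_lin_ext:
  assumes "module K A" "module K N"
    and "\<And>b c. b \<in> carrier A \<Longrightarrow> c \<in> carrier A \<Longrightarrow> (\<lambda>a. h a b c) \<in> linear_maps K A N"
    and "\<And>a c. a \<in> carrier A \<Longrightarrow> c \<in> carrier A \<Longrightarrow> (\<lambda>b. h a b c) \<in> linear_maps K A N"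
    and "\<And>a b. a \<in> carrier A \<Longrightarrow> b \<in> carrier A \<Longrightarrow> (\<lambda>c. h a b c) \<in> linear_maps K A N"
  shows "lin_ext K N (\<lambda>w. h (w ! 0) (w ! 1) (w ! 2)) \<in> linear_maps K (tensor_power K A 3) N"
    and "a \<in> carrier A \<Longrightarrow> b \<in> carrier A \<Longrightarrow> c \<in> carrier A \<Longrightarrow>
      lin_ext K N (\<lambda>w. h (w ! 0) (w ! 1) (w ! 2)) (pure_tensor K A [a, b, c]) = h a b c"
proof -
  have cl: "h (w ! 0) (w ! 1) (w ! 2) \<in> carrier N" if "w \<in> tensor_words A 3" for w
    using that linear_maps_closed[OF assms(3)] by (auto simp: tensor_words_3_iff)
  have slots: "(\<lambda>a. h ((u @ a # v) ! 0) ((u @ a # v) ! 1) ((u @ a # v) ! 2)) \<in> linear_maps K A N"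
    if uv: "u \<in> lists (carrier A)" "v \<in> lists (carrier A)" "length u + length v + 1 = 3" for u v
  proof -
    \<comment> \<open>The length of \<open>u\<close> is the position of the slot; each case is one
      of the three linearity assumptions.\<close>
    consider "u = []" "length v = 2" | "length u = 1" "length v = 1" | "length u = 2" "v = []"
      using uv(3) by (cases "length u = 0"; cases "length v = 0") (fastforce, fastforce, fastforce, linarith)
    then show ?thesis
      using that assms(3-5) by cases (auto simp: length_Suc_conv numeral_2_eq_2)
  qed
  show "lin_ext K N (\<lambda>w. h (w ! 0) (w ! 1) (w ! 2)) \<in> linear_maps K (tensor_power K A 3) N"
    using assms(1,2) cl slots by (rule tensor_lin_ext_linear)
  show "lin_ext K N (\<lambda>w. h (w ! 0) (w ! 1) (w ! 2)) (pure_tensor K A [a, b, c]) = h a b c"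
    if "a \<in> carrier A" "b \<in> carrier A" "c \<in> carrier A"
    using that
    by (subst tensor_lin_ext_pure[where n = 3, OF assms(1,2) cl slots]) (auto simp: tensor_words_3_iff)
qed

lemma pure_tensor2_bilinear:
  assumes "module K A"
  shows "(\<lambda>a b. pure_tensor K A [a, b]) \<in> bilinear_maps K A A (tensor_power K A 2)"
  using pure_tensor_slot_linear[OF assms, of "[_]" "[]" 2] pure_tensor_slot_linear[OF assms, of "[]" "[_]" 2]
  by (intro bilinear_mapsI) auto

lemma pure_tensor3_linear:
  assumes "module K A" "x \<in> carrier A" "y \<in> carrier A"
  shows "(\<lambda>a. pure_tensor K A [a, x, y]) \<in> linear_maps K A (tensor_power K A 3)"
    and "(\<lambda>a. pure_tensor K A [x, a, y]) \<in> linear_maps K A (tensor_power K A 3)"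
    and "(\<lambda>a. pure_tensor K A [x, y, a]) \<in> linear_maps K A (tensor_power K A 3)"
  using pure_tensor_slot_linear[OF assms(1), of "[]" "[x, y]" 3]
    pure_tensor_slot_linear[OF assms(1), of "[x]" "[y]" 3]
    pure_tensor_slot_linear[OF assms(1), of "[x, y]" "[]" 3] assms(2,3)
  by simp_all

lemma tensor_flip_linear:
  assumes "module K A"
  shows "tensor_flip K A \<in> linear_maps K (tensor_power K A 2) (tensor_power K A 2)"
    and "a \<in> carrier A \<Longrightarrow> b \<in> carrier A \<Longrightarrow>
      tensor_flip K A (pure_tensor K A [a, b]) = pure_tensor K A [b, a]"
proof -
  have "(\<lambda>a b. pure_tensor K A [b, a]) \<in> bilinear_maps K A A (tensor_power K A 2)"
    using pure_tensor2_bilinear[OF assms] by (simp add: bilinear_maps_def)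
  note * = tensor2_lin_ext[OF assms tensor_power_module[OF assms] this]
  show "tensor_flip K A \<in> linear_maps K (tensor_power K A 2) (tensor_power K A 2)"
    using *(1) by (simp add: tensor_flip_def)
  show "a \<in> carrier A \<Longrightarrow> b \<in> carrier A \<Longrightarrow>
      tensor_flip K A (pure_tensor K A [a, b]) = pure_tensor K A [b, a]"
    using *(2) by (simp add: tensor_flip_def)
qed

section \<open>Sweedler sums, and \<Phi> acting on two of three tensor factors\<close>

locale phi_map =
  fixes K :: "('k, 'r) ring_scheme" and A :: "('k, 'a, 'p) module_scheme"
    and \<Phi> :: "('a list \<Rightarrow> 'k) set \<Rightarrow> ('a list \<Rightarrow> 'k) set"
  assumes module_A: "module K A"
    and phi: "\<Phi> \<in> linear_maps K (tensor_power K A 2) (tensor_power K A 2)"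
begin

lemma phi_pure_closed:
  "a \<in> carrier A \<Longrightarrow> b \<in> carrier A \<Longrightarrow> \<Phi> (pure_tensor K A [a, b]) \<in> carrier (tensor_power K A 2)"
  by (rule linear_maps_closed[OF phi bilinear_maps_closed[OF pure_tensor2_bilinear[OF module_A]]])

text \<open>The coefficients and index words of the sum come from \<Phi>(a \<otimes> b) alone, so
  \<open>h\<close> may be replaced termwise.\<close>

lemma sweedler_cong:
  assumes "module K N" "a \<in> carrier A" "b \<in> carrier A"
    and "\<And>p q. p \<in> carrier A \<Longrightarrow> q \<in> carrier A \<Longrightarrow> h p q = h' p q"
    and "\<And>p q. p \<in> carrier A \<Longrightarrow> q \<in> carrier A \<Longrightarrow> h' p q \<in> carrier N"
  shows "sweedler K A N \<Phi> h a b = sweedler K A N \<Phi> h' a b"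
  unfolding sweedler_def
  using phi_pure_closed[OF assms(2,3)] assms(4,5)
  by (intro presentation.lin_ext_cong[OF tensor_presentation[OF module_A, of 2] assms(1)])
    (auto simp: tensor_words_2_iff tensor_power_def)

lemma linear_map_sweedler:
  assumes "module K N" "module K N'" "g \<in> linear_maps K N N'" "a \<in> carrier A" "b \<in> carrier A"
    and "\<And>p q. p \<in> carrier A \<Longrightarrow> q \<in> carrier A \<Longrightarrow> h p q \<in> carrier N"
  shows "g (sweedler K A N \<Phi> h a b) = sweedler K A N' \<Phi> (\<lambda>p q. g (h p q)) a b"
  unfolding sweedler_def
  using phi_pure_closed[OF assms(4,5)] assms(6)
  by (intro presentation.linear_map_lin_ext[OF tensor_presentation[OF module_A, of 2] assms(1-3)])
    (auto simp: tensor_words_2_iff tensor_power_def)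

lemma sweedler_linear_parameter:
  assumes "module K M" "module K N" "a \<in> carrier A" "b \<in> carrier A"
    and "\<And>p q. p \<in> carrier A \<Longrightarrow> q \<in> carrier A \<Longrightarrow> (\<lambda>m. h m p q) \<in> linear_maps K M N"
  shows "(\<lambda>m. sweedler K A N \<Phi> (h m) a b) \<in> linear_maps K M N"
  unfolding sweedler_def
  using phi_pure_closed[OF assms(3,4)] assms(5)
  by (intro presentation.lin_ext_linear_parameter[OF tensor_presentation[OF module_A, of 2] assms(1,2)])
    (auto simp: tensor_words_2_iff tensor_power_def)

text \<open>Unlike the preceding facts, this one varies the tensor \<Phi>(a \<otimes> b) itself, and
  so bilinearity of \<open>h\<close> enters. The rest is composition with \<Phi> and with the pure
  tensor.\<close>

lemma sweedler_bilinear: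
  assumes "module K N" "h \<in> bilinear_maps K A A N"
  shows "sweedler K A N \<Phi> h \<in> bilinear_maps K A A N"
proof -
  note L = linear_maps_comp[OF phi tensor2_lin_ext(1)[OF module_A assms]]
  note P = pure_tensor2_bilinear[OF module_A]
  show ?thesis
    using linear_maps_comp[OF bilinear_maps_left[OF P] L] linear_maps_comp[OF bilinear_maps_right[OF P] L]
    by (intro bilinear_mapsI) (simp_all add: sweedler_def)
qed

text \<open>The slots are linear for different reasons: the untouched one is a mere parameter of the
  Sweedler sum, while the two fed to \<Phi> are covered by \<open>sweedler_bilinear\<close>.\<close>

lemma id_tensor_linear: "id_tensor K A \<Phi> \<in> linear_maps K (tensor_power K A 3) (tensor_power K A 3)"
  and id_tensor_pure: "a \<in> carrier A \<Longrightarrow> b \<in> carrier A \<Longrightarrow> c \<in> carrier A \<Longrightarrow>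
    id_tensor K A \<Phi> (pure_tensor K A [a, b, c]) =
      sweedler K A (tensor_power K A 3) \<Phi> (\<lambda>p q. pure_tensor K A [a, p, q]) b c"
proof -
  let ?T = "tensor_power K A 3"
  let ?h = "\<lambda>a b c. sweedler K A ?T \<Phi> (\<lambda>p q. pure_tensor K A [a, p, q]) b c"
  note T = tensor_power_module[OF module_A, of 3]
  note P = pure_tensor3_linear[OF module_A]
  have B: "?h a \<in> bilinear_maps K A A ?T" if "a \<in> carrier A" for a
    using that P by (intro sweedler_bilinear[OF T] bilinear_mapsI) auto
  have e: "id_tensor K A \<Phi> = lin_ext K ?T (\<lambda>w. ?h (w ! 0) (w ! 1) (w ! 2))"
    by (simp add: id_tensor_def sweedler_def)
  have 1: "(\<lambda>a. ?h a b c) \<in> linear_maps K A ?T" if "b \<in> carrier A" "c \<in> carrier A" for b c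
    using that P by (intro sweedler_linear_parameter[OF module_A T]) auto
  note * = tensor3_lin_ext[where h = ?h, OF module_A T 1 bilinear_maps_left[OF B] bilinear_maps_right[OF B]]
  show "id_tensor K A \<Phi> \<in> linear_maps K ?T ?T" unfolding e by (rule *(1)) assumption+
  show "id_tensor K A \<Phi> (pure_tensor K A [a, b, c]) = ?h a b c"
    if "a \<in> carrier A" "b \<in> carrier A" "c \<in> carrier A"
    unfolding e by (rule *(2)) (simp_all add: that)
qed

lemma tensor_id_linear: "tensor_id K A \<Phi> \<in> linear_maps K (tensor_power K A 3) (tensor_power K A 3)"
  and tensor_id_pure: "a \<in> carrier A \<Longrightarrow> b \<in> carrier A \<Longrightarrow> c \<in> carrier A \<Longrightarrow>
    tensor_id K A \<Phi> (pure_tensor K A [a, b, c]) =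
      sweedler K A (tensor_power K A 3) \<Phi> (\<lambda>p q. pure_tensor K A [p, q, c]) a b"
proof -
  let ?T = "tensor_power K A 3"
  let ?h = "\<lambda>a b c. sweedler K A ?T \<Phi> (\<lambda>p q. pure_tensor K A [p, q, c]) a b"
  note T = tensor_power_module[OF module_A, of 3]
  note P = pure_tensor3_linear[OF module_A]
  have B: "(\<lambda>a b. ?h a b c) \<in> bilinear_maps K A A ?T" if "c \<in> carrier A" for c
    using that P by (intro sweedler_bilinear[OF T] bilinear_mapsI) auto
  have e: "tensor_id K A \<Phi> = lin_ext K ?T (\<lambda>w. ?h (w ! 0) (w ! 1) (w ! 2))"
    by (simp add: tensor_id_def sweedler_def)
  have 3: "(\<lambda>c. ?h a b c) \<in> linear_maps K A ?T" if "a \<in> carrier A" "b \<in> carrier A" for a b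
    using that P by (intro sweedler_linear_parameter[OF module_A T]) auto
  note * = tensor3_lin_ext[where h = ?h, OF module_A T bilinear_maps_left[OF B] bilinear_maps_right[OF B] 3]
  show "tensor_id K A \<Phi> \<in> linear_maps K ?T ?T" unfolding e by (rule *(1)) assumption+
  show "tensor_id K A \<Phi> (pure_tensor K A [a, b, c]) = ?h a b c"
    if "a \<in> carrier A" "b \<in> carrier A" "c \<in> carrier A"
    unfolding e by (rule *(2)) (simp_all add: that)
qed

context
  fixes N :: "('k, 'n, 'q) module_scheme" and H
  assumes N: "module K N" and H: "H \<in> linear_maps K (tensor_power K A 3) N"
begin

text \<open>A dictionary between maps on triple tensors and Sweedler sums: chained, such equations
  turn the composites in the \<ell>EAS equation into nested sums.\<close>

lemma linear_map_id_tensor_pure: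
  assumes "a \<in> carrier A" "b \<in> carrier A" "c \<in> carrier A"
  shows "H (id_tensor K A \<Phi> (pure_tensor K A [a, b, c])) =
    sweedler K A N \<Phi> (\<lambda>p q. H (pure_tensor K A [a, p, q])) b c"
  unfolding id_tensor_pure[OF assms]
  using assms by (intro linear_map_sweedler[OF tensor_power_module[OF module_A] N H])
    (auto intro: pure_tensor_closed[OF module_A] simp: tensor_words_3_iff)

lemma linear_map_tensor_id_pure:
  assumes "a \<in> carrier A" "b \<in> carrier A" "c \<in> carrier A"
  shows "H (tensor_id K A \<Phi> (pure_tensor K A [a, b, c])) =
    sweedler K A N \<Phi> (\<lambda>p q. H (pure_tensor K A [p, q, c])) a b"
  unfolding tensor_id_pure[OF assms]
  using assms by (intro linear_map_sweedler[OF tensor_power_module[OF module_A] N H])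
    (auto intro: pure_tensor_closed[OF module_A] simp: tensor_words_3_iff)

end

text \<open>The flip is a linear endomorphism of the tensor square as well, so it can take the place
  of \<Phi>; for this reason the locale asks of \<Phi> nothing but linearity.\<close>

lemma id_tensor_flip_linear:
  "id_tensor K A (tensor_flip K A) \<in> linear_maps K (tensor_power K A 3) (tensor_power K A 3)"
  by (intro phi_map.id_tensor_linear phi_map.intro module_A tensor_flip_linear)

lemma id_tensor_flip_pure:
  assumes "a \<in> carrier A" "b \<in> carrier A" "c \<in> carrier A"
  shows "id_tensor K A (tensor_flip K A) (pure_tensor K A [a, b, c]) = pure_tensor K A [a, c, b]"
proof -
  interpret flip: phi_map K A "tensor_flip K A"
    by (intro phi_map.intro module_A tensor_flip_linear)
  have "(\<lambda>p q. pure_tensor K A [a, p, q]) \<in> bilinear_maps K A A (tensor_power K A 3)"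
    using assms by (intro bilinear_mapsI pure_tensor3_linear[OF module_A])
  note * = tensor2_lin_ext(2)[OF module_A tensor_power_module[OF module_A] this assms(3,2)]
  show ?thesis
    unfolding flip.id_tensor_pure[OF assms] sweedler_def tensor_flip_linear(2)[OF module_A assms(2,3)]
    by (rule *)
qed

end

section \<open>Universal property of the space of typed words\<close>

lemma typed_word_presentation:
  assumes "module K A" "module K V"
  shows "presentation K (typed_word_gens A V) (typed_word_relations K A V)"
proof -
  interpret A: module K A by fact
  let ?X = "typed_word_gens A V"
  show ?thesis
  proof (rule presentation.intro)
    show "cring K" by (rule A.R.is_cring)
    have "slot_relations K ?X A (\<lambda>a. (u @ a # v, xs)) \<subseteq> carrier (free_module K ?X)"
      if "u \<in> lists (carrier A)" "v \<in> lists (carrier A)" "xs \<in> lists (carrier V)"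
        "length xs = length u + length v + 2" for u v xs
      using that by (intro slot_relations_subset[OF assms(1)]) (auto simp: typed_word_gens_def)
    moreover have "slot_relations K ?X V (\<lambda>x. (as, u @ x # v)) \<subseteq> carrier (free_module K ?X)"
      if "as \<in> lists (carrier A)" "u \<in> lists (carrier V)" "v \<in> lists (carrier V)"
        "length u + length v = length as" for as u v
      using that by (intro slot_relations_subset[OF assms(2)]) (auto simp: typed_word_gens_def)
    ultimately show "typed_word_relations K A V \<subseteq> carrier (free_module K ?X)"
      unfolding typed_word_relations_def by (intro Un_least Union_least) blast+
  qed
qed

locale typed_words =
  fixes K :: "('k, 'r) ring_scheme" and A :: "('k, 'a, 'p) module_scheme"
    and V :: "('k, 'v, 'q) module_scheme"
  assumes module_A: "module K A" and module_V: "module K V"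
begin

abbreviation "T \<equiv> typed_word_space K A V"
abbreviation "word \<equiv> typed_word K A V"
abbreviation "snoc \<equiv> append_letter K A V"

interpretation presentation K "typed_word_gens A V" "typed_word_relations K A V"
  by (rule typed_word_presentation) (rule module_A module_V)+

lemma module_T: "module K T"
  using module_P by (simp add: typed_word_space_def)

lemma word_closed:
  "as \<in> lists (carrier A) \<Longrightarrow> xs \<in> lists (carrier V) \<Longrightarrow> length xs = length as + 1 \<Longrightarrow>
    word as xs \<in> carrier T"
  unfolding typed_word_def typed_word_space_def
  by (rule gen_closed) (simp add: typed_word_gens_def)

lemma word_type_slot_linear:
  assumes "u \<in> lists (carrier A)" "v \<in> lists (carrier A)" "xs \<in> lists (carrier V)"
    "length xs = length u + length v + 2"
  shows "(\<lambda>a. word (u @ a # v) xs) \<in> linear_maps K A T"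
proof -
  have "slot_relations K (typed_word_gens A V) A (\<lambda>a. (u @ a # v, xs)) \<subseteq> typed_word_relations K A V"
    using assms unfolding typed_word_relations_def by blast
  with assms show ?thesis
    unfolding typed_word_def typed_word_space_def
    by (intro gen_slot_linear module_A) (auto simp: typed_word_gens_def)
qed

lemma word_letter_slot_linear:
  assumes "as \<in> lists (carrier A)" "u \<in> lists (carrier V)" "v \<in> lists (carrier V)"
    "length u + length v = length as"
  shows "(\<lambda>x. word as (u @ x # v)) \<in> linear_maps K V T"
proof -
  have "slot_relations K (typed_word_gens A V) V (\<lambda>x. (as, u @ x # v)) \<subseteq> typed_word_relations K A V"
    using assms unfolding typed_word_relations_def by blast
  with assms show ?thesis
    unfolding typed_word_def typed_word_space_def
    by (intro gen_slot_linear module_V) (auto simp: typed_word_gens_def)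
qed

lemma word_linear_maps_eqI:
  assumes "module K N" "f \<in> linear_maps K T N" "g \<in> linear_maps K T N"
    and "\<And>as xs. as \<in> lists (carrier A) \<Longrightarrow> xs \<in> lists (carrier V) \<Longrightarrow> length xs = length as + 1 \<Longrightarrow>
      f (word as xs) = g (word as xs)"
    and "t \<in> carrier T"
  shows "f t = g t"
  using linear_maps_eqI[OF assms(1), of f g t] assms(2-5)
  by (auto simp: typed_word_space_def typed_word_def typed_word_gens_def)

context
  fixes N :: "('k, 'n, 's) module_scheme" and h :: "'a list \<Rightarrow> 'v list \<Rightarrow> 'n"
  assumes N: "module K N"
    and h: "\<And>as xs. as \<in> lists (carrier A) \<Longrightarrow> xs \<in> lists (carrier V) \<Longrightarrow>
      length xs = length as + 1 \<Longrightarrow> h as xs \<in> carrier N"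
    and type_slots: "\<And>u v xs. u \<in> lists (carrier A) \<Longrightarrow> v \<in> lists (carrier A) \<Longrightarrow>
      xs \<in> lists (carrier V) \<Longrightarrow> length xs = length u + length v + 2 \<Longrightarrow>
      (\<lambda>a. h (u @ a # v) xs) \<in> linear_maps K A N"
    and letter_slots: "\<And>as u v. as \<in> lists (carrier A) \<Longrightarrow> u \<in> lists (carrier V) \<Longrightarrow>
      v \<in> lists (carrier V) \<Longrightarrow> length u + length v = length as \<Longrightarrow>
      (\<lambda>x. h as (u @ x # v)) \<in> linear_maps K V N"
begin

lemma typed_word_relations_vanish:
  assumes "r \<in> typed_word_relations K A V"
  shows "lin_comb K N (\<lambda>(as, xs). h as xs) r = \<zero>\<^bsub>N\<^esub>"
proof -
  let ?X = "typed_word_gens A V"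
  have h': "(\<lambda>(as, xs). h as xs) \<in> ?X \<rightarrow> carrier N"
    using h by (auto simp: typed_word_gens_def)
  from assms consider
    u v xs where "r \<in> slot_relations K ?X A (\<lambda>a. (u @ a # v, xs))"
      "u \<in> lists (carrier A)" "v \<in> lists (carrier A)" "xs \<in> lists (carrier V)"
      "length xs = length u + length v + 2"
  | as u v where "r \<in> slot_relations K ?X V (\<lambda>x. (as, u @ x # v))"
      "as \<in> lists (carrier A)" "u \<in> lists (carrier V)" "v \<in> lists (carrier V)"
      "length u + length v = length as"
    unfolding typed_word_relations_def by blast
  then show ?thesis
  proof cases
    case 1
    show ?thesis
      by (rule lin_comb_slot_relation[OF module_A N _ h' _ 1(1)])
        (use 1 type_slots in \<open>auto simp: typed_word_gens_def\<close>)
  next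
    case 2
    show ?thesis
      by (rule lin_comb_slot_relation[OF module_V N _ h' _ 2(1)])
        (use 2 letter_slots in \<open>auto simp: typed_word_gens_def\<close>)
  qed
qed

lemma word_lin_ext_linear: "lin_ext K N (\<lambda>(as, xs). h as xs) \<in> linear_maps K T N"
  unfolding typed_word_space_def
  by (rule lin_ext_linear[OF N _ typed_word_relations_vanish]) (auto simp: typed_word_gens_def in_lists_conv_set h)

lemma word_lin_ext_word:
  assumes "as \<in> lists (carrier A)" "xs \<in> lists (carrier V)" "length xs = length as + 1"
  shows "lin_ext K N (\<lambda>(as, xs). h as xs) (word as xs) = h as xs"
  unfolding typed_word_def
  by (subst lin_ext_gen[OF N _ typed_word_relations_vanish]) (use assms in \<open>auto simp: typed_word_gens_def in_lists_conv_set h\<close>)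

end

section \<open>Appending a letter\<close>

lemma append_linear:
  assumes "a \<in> carrier A" "x \<in> carrier V"
  shows "(\<lambda>w. snoc w a x) \<in> linear_maps K T T"
  unfolding append_letter_def
  by (rule word_lin_ext_linear[OF module_T word_closed])
    (use assms word_type_slot_linear[of _ "_ @ [a]"] word_letter_slot_linear[of _ _ "_ @ [x]"] in auto)

lemma append_word:
  assumes "a \<in> carrier A" "x \<in> carrier V"
    and "as \<in> lists (carrier A)" "xs \<in> lists (carrier V)" "length xs = length as + 1"
  shows "snoc (word as xs) a x = word (as @ [a]) (xs @ [x])"
  unfolding append_letter_def
  by (rule word_lin_ext_word[OF module_T word_closed])
    (use assms word_type_slot_linear[of _ "_ @ [a]"] word_letter_slot_linear[of _ _ "_ @ [x]"] in auto)

text \<open>Here \<open>w\<close> is any element, not only a word. At a fixed representative of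
  \<open>w\<close>, the type \<open>a\<close> occurs only in the values on generators, where it
  fills the last type slot.\<close>

lemma append_type_linear:
  assumes "w \<in> carrier T" "x \<in> carrier V"
  shows "(\<lambda>a. snoc w a x) \<in> linear_maps K A T"
  unfolding append_letter_def
  by (rule lin_ext_linear_parameter[OF module_A module_T])
    (use assms word_type_slot_linear[of _ "[]"] in \<open>auto simp: typed_word_gens_def typed_word_space_def in_lists_conv_set\<close>)

lemma append_letter_linear:
  assumes "w \<in> carrier T" "a \<in> carrier A"
  shows "(\<lambda>x. snoc w a x) \<in> linear_maps K V T"
  unfolding append_letter_def
  by (rule lin_ext_linear_parameter[OF module_V module_T])
    (use assms word_letter_slot_linear[of _ _ "[]"] in \<open>auto simp: typed_word_gens_def typed_word_space_def in_lists_conv_set\<close>)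

lemma append_closed:
  "w \<in> carrier T \<Longrightarrow> a \<in> carrier A \<Longrightarrow> x \<in> carrier V \<Longrightarrow> snoc w a x \<in> carrier T"
  by (rule linear_maps_closed[OF append_linear])

lemma letter_linear: "letter K A V \<in> linear_maps K V T"
  using word_letter_slot_linear[of "[]" "[]" "[]"] by (simp add: letter_def[abs_def])

lemma letter_closed: "x \<in> carrier V \<Longrightarrow> letter K A V x \<in> carrier T"
  by (rule linear_maps_closed[OF letter_linear])

text \<open>Words span the space, and each arises from one letter by appending; the cases
  \<open>letter\<close> and \<open>append\<close> mirror the two clauses of the product.\<close>

lemma word_induct [consumes 1, case_names letter append add smult]:
  assumes "t \<in> carrier T"
    and letter: "\<And>x. x \<in> carrier V \<Longrightarrow> Q (letter K A V x)"
    and append: "\<And>w a x. w \<in> carrier T \<Longrightarrow> a \<in> carrier A \<Longrightarrow> x \<in> carrier V \<Longrightarrow> Q w \<Longrightarrow> Q (snoc w a x)"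
    and add: "\<And>s t. s \<in> carrier T \<Longrightarrow> t \<in> carrier T \<Longrightarrow> Q s \<Longrightarrow> Q t \<Longrightarrow> Q (s \<oplus>\<^bsub>T\<^esub> t)"
    and smult: "\<And>c t. c \<in> carrier K \<Longrightarrow> t \<in> carrier T \<Longrightarrow> Q t \<Longrightarrow> Q (c \<odot>\<^bsub>T\<^esub> t)"
  shows "Q t"
proof -
  interpret T: module K T by (rule module_T)
  interpret V: module K V by (rule module_V)
  have words: "Q (word as xs)"
    if "as \<in> lists (carrier A)" "xs \<in> lists (carrier V)" "length xs = length as + 1" for as xs
    using that
  proof (induction as arbitrary: xs rule: rev_induct)
    case Nil
    then obtain x where "xs = [x]" by (auto simp: length_Suc_conv)
    then show ?case using letter Nil by (auto simp: letter_def)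
  next
    case (snoc a as)
    then obtain ys x where xs: "xs = ys @ [x]" by (cases xs rule: rev_cases) auto
    have "Q (snoc (word as ys) a x)"
      using snoc xs by (intro append word_closed) auto
    then show ?case using snoc.prems xs append_word[of a x as ys] by simp
  qed
  \<comment> \<open>Zero is the multiple by 0 of the letter of the zero vector.\<close>
  have zero: "Q \<zero>\<^bsub>T\<^esub>"
    using smult[of "\<zero>\<^bsub>K\<^esub>" "letter K A V \<zero>\<^bsub>V\<^esub>"] letter_closed letter by auto
  show ?thesis
    using assms(1) unfolding typed_word_space_def
    by (induction rule: gen_induct)
      (use zero words add smult in
        \<open>auto simp: typed_word_space_def typed_word_def typed_word_gens_def\<close>)
qed

section \<open>Linear recursion on typed words\<close>

text \<open>Both lists are reversed, so that the letter appended last comes first.\<close>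

context
  fixes N :: "('k, 'n, 's) module_scheme" and f :: "'v \<Rightarrow> 'n" and g :: "'n \<Rightarrow> 'a \<Rightarrow> 'v \<Rightarrow> 'n"
  assumes N: "module K N" and f: "f \<in> linear_maps K V N"
    and g1: "\<And>a x. a \<in> carrier A \<Longrightarrow> x \<in> carrier V \<Longrightarrow> (\<lambda>n. g n a x) \<in> linear_maps K N N"
    and g2: "\<And>n x. n \<in> carrier N \<Longrightarrow> x \<in> carrier V \<Longrightarrow> (\<lambda>a. g n a x) \<in> linear_maps K A N"
    and g3: "\<And>n a. n \<in> carrier N \<Longrightarrow> a \<in> carrier A \<Longrightarrow> (\<lambda>x. g n a x) \<in> linear_maps K V N"
begin

primrec rev_fold :: "'a list \<Rightarrow> 'v list \<Rightarrow> 'n" where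
  "rev_fold [] xs = f (hd xs)"
| "rev_fold (a # as) xs = g (rev_fold as (tl xs)) a (hd xs)"

lemma rev_fold_closed:
  assumes "as \<in> lists (carrier A)" "xs \<in> lists (carrier V)" "length xs = length as + 1"
  shows "rev_fold as xs \<in> carrier N"
  using assms
proof (induction as arbitrary: xs rule: lists.induct)
  case Nil
  then show ?case by (cases xs) (auto intro: linear_maps_closed[OF f])
next
  case (Cons a as)
  then show ?case by (cases xs) (auto intro!: linear_maps_closed[OF g1])
qed

text \<open>At the slot itself \<open>g2\<close> applies; everything appended after it acts through
  \<open>g1\<close> on the value reached so far.\<close>

lemma rev_fold_type_slot:
  assumes "u \<in> lists (carrier A)" "v \<in> lists (carrier A)" "xs \<in> lists (carrier V)"
    "length xs = length u + length v + 2"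
  shows "(\<lambda>a. rev_fold (u @ a # v) xs) \<in> linear_maps K A N"
  using assms
proof (induction u arbitrary: xs rule: lists.induct)
  case Nil
  then show ?case by (cases xs) (auto intro!: g2 rev_fold_closed)
next
  case (Cons b u)
  note b = Cons.hyps(1)
  obtain x ys where xs: "xs = x # ys" using Cons.prems by (cases xs) auto
  have "(\<lambda>a. rev_fold (u @ a # v) ys) \<in> linear_maps K A N"
    using Cons xs by (intro Cons.IH) auto
  then have "(\<lambda>a. g (rev_fold (u @ a # v) ys) b x) \<in> linear_maps K A N"
    using Cons.prems(2) xs b by (intro linear_maps_comp[OF _ g1]) auto
  then show ?case by (simp add: xs)
qed

text \<open>The first letter of the word enters through \<open>f\<close>, a later one through
  \<open>g3\<close>, and what is appended afterwards acts through \<open>g1\<close>.\<close>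

lemma rev_fold_letter_slot:
  assumes "as \<in> lists (carrier A)" "u \<in> lists (carrier V)" "v \<in> lists (carrier V)"
    "length u + length v = length as"
  shows "(\<lambda>x. rev_fold as (u @ x # v)) \<in> linear_maps K V N"
  using assms
proof (induction as arbitrary: u rule: lists.induct)
  case Nil
  then show ?case using f by simp
next
  case (Cons b as)
  note b = Cons.hyps(1,2)
  show ?case
  proof (cases u)
    case Nil
    then show ?thesis using Cons.prems(2,3) b by (simp add: g3 rev_fold_closed)
  next
    case u: (Cons y u')
    have "(\<lambda>x. rev_fold as (u' @ x # v)) \<in> linear_maps K V N"
      using Cons u by (intro Cons.IH) auto
    then have "(\<lambda>x. g (rev_fold as (u' @ x # v)) b y) \<in> linear_maps K V N"
        using Cons.prems(1) u b by (intro linear_maps_comp[OF _ g1]) auto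
    then show ?thesis by (simp add: u)
  qed
qed

text \<open>Both sides of the rule for \<open>snoc\<close> are linear in \<open>w\<close>, so it is
  checked on words; there reversal turns the appended pair into the head that
  \<open>rev_fold\<close> unfolds.\<close>

lemma word_recursion_exists:
  obtains F where "F \<in> linear_maps K T N"
    "\<And>x. x \<in> carrier V \<Longrightarrow> F (letter K A V x) = f x"
    "\<And>w a x. w \<in> carrier T \<Longrightarrow> a \<in> carrier A \<Longrightarrow> x \<in> carrier V \<Longrightarrow> F (snoc w a x) = g (F w) a x"
proof
  define h where "h as xs = rev_fold (rev as) (rev xs)" for as xs
  define F where "F = lin_ext K N (\<lambda>(as, xs). h as xs)"
  have h: "h as xs \<in> carrier N"
    if "as \<in> lists (carrier A)" "xs \<in> lists (carrier V)" "length xs = length as + 1" for as xs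
    using that unfolding h_def by (intro rev_fold_closed) auto
  have ts: "(\<lambda>a. h (u @ a # v) xs) \<in> linear_maps K A N"
    if "u \<in> lists (carrier A)" "v \<in> lists (carrier A)" "xs \<in> lists (carrier V)"
      "length xs = length u + length v + 2" for u v xs
    using that rev_fold_type_slot[of "rev v" "rev u" "rev xs"] by (simp add: h_def in_lists_conv_set)
  have ls: "(\<lambda>x. h as (u @ x # v)) \<in> linear_maps K V N"
    if "as \<in> lists (carrier A)" "u \<in> lists (carrier V)" "v \<in> lists (carrier V)"
      "length u + length v = length as" for as u v
    using that rev_fold_letter_slot[of "rev as" "rev v" "rev u"] by (simp add: h_def in_lists_conv_set)
  show F: "F \<in> linear_maps K T N"
    unfolding F_def by (rule word_lin_ext_linear[OF N h ts ls])
  have Fw: "F (word as xs) = h as xs"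
    if "as \<in> lists (carrier A)" "xs \<in> lists (carrier V)" "length xs = length as + 1" for as xs
    unfolding F_def by (rule word_lin_ext_word[OF N h ts ls that])
  show "F (letter K A V x) = f x" if "x \<in> carrier V" for x
    using that Fw[of "[]" "[x]"] by (simp add: letter_def h_def)
  show "F (snoc w a x) = g (F w) a x"
    if "w \<in> carrier T" "a \<in> carrier A" "x \<in> carrier V" for w a x
  proof (rule word_linear_maps_eqI[OF N _ _ _ that(1)])
    show "(\<lambda>w. F (snoc w a x)) \<in> linear_maps K T N"
      by (rule linear_maps_comp[OF append_linear F]) fact+
    show "(\<lambda>w. g (F w) a x) \<in> linear_maps K T N"
      by (rule linear_maps_comp[OF F g1]) fact+
    show "F (snoc (word as xs) a x) = g (F (word as xs)) a x"
      if "as \<in> lists (carrier A)" "xs \<in> lists (carrier V)" "length xs = length as + 1" for as xs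
      using that \<open>a \<in> carrier A\<close> \<open>x \<in> carrier V\<close> by (simp add: append_word Fw) (simp add: h_def)
  qed
qed

end

end

section \<open>Modules of linear maps\<close>

text \<open>Values outside the carrier are fixed because otherwise maps agreeing on the carrier
  would be different elements, and laws such as 0 + f = f would fail as equations between
  functions.\<close>

definition hom_module ::
    "('k, 'r) ring_scheme \<Rightarrow> ('k, 'm, 'p) module_scheme \<Rightarrow> ('k, 'n, 'q) module_scheme
     \<Rightarrow> ('k, 'm \<Rightarrow> 'n) module" where
  "hom_module K M N =
     \<lparr>carrier = linear_maps K M N \<inter> extensional (carrier M),
      mult = (\<lambda>_ _. undefined), one = undefined,
      zero = (\<lambda>x\<in>carrier M. \<zero>\<^bsub>N\<^esub>), add = (\<lambda>f g. \<lambda>x\<in>carrier M. f x \<oplus>\<^bsub>N\<^esub> g x),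
      smult = (\<lambda>c f. \<lambda>x\<in>carrier M. c \<odot>\<^bsub>N\<^esub> f x)\<rparr>"

lemma hom_module_simps:
  "f \<in> carrier (hom_module K M N) \<longleftrightarrow> f \<in> linear_maps K M N \<and> f \<in> extensional (carrier M)"
  "\<zero>\<^bsub>hom_module K M N\<^esub> = (\<lambda>x\<in>carrier M. \<zero>\<^bsub>N\<^esub>)"
  "f \<oplus>\<^bsub>hom_module K M N\<^esub> g = (\<lambda>x\<in>carrier M. f x \<oplus>\<^bsub>N\<^esub> g x)"
  "c \<odot>\<^bsub>hom_module K M N\<^esub> f = (\<lambda>x\<in>carrier M. c \<odot>\<^bsub>N\<^esub> f x)"
  by (auto simp: hom_module_def)

lemma linear_maps_add_fun:
  assumes "module K N" "f \<in> linear_maps K M N" "g \<in> linear_maps K M N"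
  shows "(\<lambda>x. f x \<oplus>\<^bsub>N\<^esub> g x) \<in> linear_maps K M N"
proof -
  interpret N: module K N by fact
  note f = linear_maps_closed[OF assms(2)] linear_maps_add[OF assms(2)] linear_maps_smult[OF assms(2)]
  note g = linear_maps_closed[OF assms(3)] linear_maps_add[OF assms(3)] linear_maps_smult[OF assms(3)]
  show ?thesis
    by (intro linear_mapsI) (simp_all add: f g N.M.a_ac N.smult_r_distr)
qed

lemma restrict_linear_maps:
  assumes "module K M" "f \<in> linear_maps K M N"
  shows "restrict f (carrier M) \<in> carrier (hom_module K M N)"
  using assms linear_maps_cong[OF assms(1), of "restrict f (carrier M)" f N]
  by (simp add: hom_module_simps)

lemma hom_module_module:
  assumes "module K M" "module K N"
  shows "module K (hom_module K M N)"
proof -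
  interpret M: module K M by fact
  interpret N: module K N by fact
  let ?H = "hom_module K M N"
  have cl: "f x \<in> carrier N" if "f \<in> carrier ?H" "x \<in> carrier M" for f x
    using that linear_maps_closed by (auto simp: hom_module_simps)
  have add: "f \<oplus>\<^bsub>?H\<^esub> g \<in> carrier ?H" if "f \<in> carrier ?H" "g \<in> carrier ?H" for f g
    using that restrict_linear_maps[OF assms(1) linear_maps_add_fun[OF assms(2)], of f g]
    by (simp add: hom_module_simps)
  have smult: "c \<odot>\<^bsub>?H\<^esub> f \<in> carrier ?H" if "c \<in> carrier K" "f \<in> carrier ?H" for c f
    using that restrict_linear_maps[OF assms(1) linear_maps_smult_fun[OF assms(2)], of f c]
    by (simp add: hom_module_simps)
  have zero: "\<zero>\<^bsub>?H\<^esub> \<in> carrier ?H"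
    using restrict_linear_maps[OF assms(1) linear_maps_zero_fun[OF assms(2)]]
    by (simp add: hom_module_simps)
  have eqI: "f = g" if "f \<in> carrier ?H" "g \<in> carrier ?H" "\<And>x. x \<in> carrier M \<Longrightarrow> f x = g x" for f g
    using that by (auto simp: hom_module_simps intro: extensionalityI)
  show ?thesis
  proof (rule moduleI)
    show "abelian_group ?H"
    proof (rule abelian_groupI)
      fix f assume f: "f \<in> carrier ?H"
      have m: "(\<ominus>\<^bsub>K\<^esub> \<one>\<^bsub>K\<^esub>) \<odot>\<^bsub>?H\<^esub> f \<in> carrier ?H" using f by (intro smult) auto
      show "\<exists>g\<in>carrier ?H. g \<oplus>\<^bsub>?H\<^esub> f = \<zero>\<^bsub>?H\<^esub>"
      proof (rule bexI[OF _ m], rule eqI[OF add[OF m f] zero])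
        fix x assume "x \<in> carrier M"
        then show "((\<ominus>\<^bsub>K\<^esub> \<one>\<^bsub>K\<^esub>) \<odot>\<^bsub>?H\<^esub> f \<oplus>\<^bsub>?H\<^esub> f) x = \<zero>\<^bsub>?H\<^esub> x"
          using cl[OF f] by (simp add: hom_module_simps N.smult_l_minus N.M.l_neg)
      qed
    next
      fix f g h assume "f \<in> carrier ?H" "g \<in> carrier ?H" "h \<in> carrier ?H"
      then show "f \<oplus>\<^bsub>?H\<^esub> g \<oplus>\<^bsub>?H\<^esub> h = f \<oplus>\<^bsub>?H\<^esub> (g \<oplus>\<^bsub>?H\<^esub> h)"
        by (intro eqI add) (simp_all add: hom_module_simps(2-4) cl N.M.a_assoc)
    next
      fix f g assume "f \<in> carrier ?H" "g \<in> carrier ?H"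
      then show "f \<oplus>\<^bsub>?H\<^esub> g = g \<oplus>\<^bsub>?H\<^esub> f"
        by (intro eqI add) (simp_all add: hom_module_simps(2-4) cl N.M.a_comm)
    next
      fix f assume "f \<in> carrier ?H"
      then show "\<zero>\<^bsub>?H\<^esub> \<oplus>\<^bsub>?H\<^esub> f = f"
        by (intro eqI add zero) (simp_all add: hom_module_simps(2-4) cl)
    qed (rule add zero; assumption)+
  next
    fix a b f assume "a \<in> carrier K" "b \<in> carrier K" "f \<in> carrier ?H"
    then show "(a \<oplus>\<^bsub>K\<^esub> b) \<odot>\<^bsub>?H\<^esub> f = a \<odot>\<^bsub>?H\<^esub> f \<oplus>\<^bsub>?H\<^esub> b \<odot>\<^bsub>?H\<^esub> f"
      "(a \<otimes>\<^bsub>K\<^esub> b) \<odot>\<^bsub>?H\<^esub> f = a \<odot>\<^bsub>?H\<^esub> (b \<odot>\<^bsub>?H\<^esub> f)"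
      by (intro eqI add smult;
          simp add: hom_module_simps(2-4) cl N.smult_l_distr N.smult_assoc1)+
  next
    fix a f g assume "a \<in> carrier K" "f \<in> carrier ?H" "g \<in> carrier ?H"
    then show "a \<odot>\<^bsub>?H\<^esub> (f \<oplus>\<^bsub>?H\<^esub> g) = a \<odot>\<^bsub>?H\<^esub> f \<oplus>\<^bsub>?H\<^esub> a \<odot>\<^bsub>?H\<^esub> g"
      by (intro eqI add smult) (simp_all add: hom_module_simps(2-4) cl N.smult_r_distr)
  next
    fix f assume f: "f \<in> carrier ?H"
    then show "\<one>\<^bsub>K\<^esub> \<odot>\<^bsub>?H\<^esub> f = f"
      by (intro eqI smult) (simp_all add: hom_module_simps(2-4) cl)
  qed (auto intro: smult M.R.is_cring)
qed

lemma eval_linear: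
  assumes "x \<in> carrier M"
  shows "(\<lambda>f. f x) \<in> linear_maps K (hom_module K M N) N"
  using assms linear_maps_closed
  by (intro linear_mapsI) (auto simp: hom_module_simps)

lemma hom_module_linearI:
  assumes "module K L" "module K M" "h \<in> bilinear_maps K L M N"
  shows "(\<lambda>l. restrict (h l) (carrier M)) \<in> linear_maps K L (hom_module K M N)"
  using restrict_linear_maps[OF assms(2) bilinear_maps_right[OF assms(3)]]
    linear_maps_add[OF bilinear_maps_left[OF assms(3)]] linear_maps_smult[OF bilinear_maps_left[OF assms(3)]]
  by (intro linear_mapsI) (auto simp: hom_module_simps(2-4))

text \<open>Twofold currying of a trilinear map. The recursion principle produces linear maps in one
  argument, so the other arguments have to be absorbed into the target.\<close>

lemma hom_module_linearI2:
  assumes "module K L" "module K M" "module K N"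
    and "\<And>m n. m \<in> carrier M \<Longrightarrow> n \<in> carrier N \<Longrightarrow> (\<lambda>l. h l m n) \<in> linear_maps K L P"
    and "\<And>l n. l \<in> carrier L \<Longrightarrow> n \<in> carrier N \<Longrightarrow> (\<lambda>m. h l m n) \<in> linear_maps K M P"
    and "\<And>l m. l \<in> carrier L \<Longrightarrow> m \<in> carrier M \<Longrightarrow> (\<lambda>n. h l m n) \<in> linear_maps K N P"
  shows "(\<lambda>l. \<lambda>m\<in>carrier M. \<lambda>n\<in>carrier N. h l m n)
    \<in> linear_maps K L (hom_module K M (hom_module K N P))"
  using assms(1,2)
proof (rule hom_module_linearI, intro bilinear_mapsI)
  fix l assume "l \<in> carrier L"
  then show "(\<lambda>m. \<lambda>n\<in>carrier N. h l m n) \<in> linear_maps K M (hom_module K N P)"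
    using assms by (intro hom_module_linearI bilinear_mapsI)
next
  fix m assume "m \<in> carrier M"
  then show "(\<lambda>l. \<lambda>n\<in>carrier N. h l m n) \<in> linear_maps K L (hom_module K N P)"
    using assms by (intro hom_module_linearI bilinear_mapsI)
qed

section \<open>The product of typed words\<close>

locale phi_words = phi_map K A \<Phi> + typed_words K A V
  for K :: "('k, 'r) ring_scheme" and A :: "('k, 'a, 'p) module_scheme"
    and \<Phi> :: "('a list \<Rightarrow> 'k) set \<Rightarrow> ('a list \<Rightarrow> 'k) set"
    and V :: "('k, 'v, 'q) module_scheme"
begin

abbreviation "sw \<equiv> sweedler K A T \<Phi>"

text \<open>Here \<phi> stands for the map sending q to \<open>star q u v\<close>, and the sum for
  the next value, at the word v followed by b and y. The first three claims fix \<phi>; the last,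
  linearity in \<phi> itself, makes the next value linear in u and in v.\<close>

lemma word_product_step_linear:
  assumes "b \<in> carrier A" "y \<in> carrier V" "a \<in> carrier A"
  shows "\<phi> \<in> linear_maps K A T \<Longrightarrow> (\<lambda>a. sw (\<lambda>p q. snoc (\<phi> q) p y) a b) \<in> linear_maps K A T"
    and "\<phi> \<in> linear_maps K A T \<Longrightarrow> (\<lambda>b. sw (\<lambda>p q. snoc (\<phi> q) p y) a b) \<in> linear_maps K A T"
    and "\<phi> \<in> linear_maps K A T \<Longrightarrow> (\<lambda>y. sw (\<lambda>p q. snoc (\<phi> q) p y) a b) \<in> linear_maps K V T"
    and "(\<lambda>\<phi>. sw (\<lambda>p q. snoc (\<phi> q) p y) a b) \<in> linear_maps K (hom_module K A T) T"
proof -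
  note HA = hom_module_module[OF module_A module_T]
  {
    assume phi: "\<phi> \<in> linear_maps K A T"
    have B: "(\<lambda>p q. snoc (\<phi> q) p y) \<in> bilinear_maps K A A T"
      using assms linear_maps_closed[OF phi]
      by (intro bilinear_mapsI append_type_linear linear_maps_comp[OF phi append_linear])
    note S = sweedler_bilinear[OF module_T B]
    show "(\<lambda>a. sw (\<lambda>p q. snoc (\<phi> q) p y) a b) \<in> linear_maps K A T"
      by (rule bilinear_maps_left[OF S assms(1)])
    show "(\<lambda>b. sw (\<lambda>p q. snoc (\<phi> q) p y) a b) \<in> linear_maps K A T"
      by (rule bilinear_maps_right[OF S assms(3)])
    show "(\<lambda>y. sw (\<lambda>p q. snoc (\<phi> q) p y) a b) \<in> linear_maps K V T"
      using assms linear_maps_closed[OF phi]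
      by (intro sweedler_linear_parameter[OF module_V module_T] append_letter_linear)
  }
  show "(\<lambda>\<phi>. sw (\<lambda>p q. snoc (\<phi> q) p y) a b) \<in> linear_maps K (hom_module K A T) T"
    using assms
    by (intro sweedler_linear_parameter[OF HA module_T] linear_maps_comp[OF eval_linear append_linear])
qed

lemma word_product_exists: "\<exists>star. is_word_product K A \<Phi> V star"
proof -
  let ?HA = "hom_module K A T"
  let ?N = "hom_module K T ?HA"
  note HA = hom_module_module[OF module_A module_T]
  note N = hom_module_module[OF module_T HA]
  define f where "f = (\<lambda>y. \<lambda>u\<in>carrier T. \<lambda>a\<in>carrier A. snoc u a y)"
  \<comment> \<open>The type \<open>a\<close> is not passed down: the recursive value is called at
    the second Sweedler component \<open>q\<close>, while the first one, \<open>p\<close>, becomes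
    the type of the appended letter.\<close>
  define g where "g = (\<lambda>\<phi> b y. \<lambda>u\<in>carrier T. \<lambda>a\<in>carrier A. sw (\<lambda>p q. snoc (\<phi> u q) p y) a b)"
  have phi1: "\<phi> u \<in> carrier ?HA" if "\<phi> \<in> carrier ?N" "u \<in> carrier T" for \<phi> u
    using that linear_maps_closed by (auto simp: hom_module_simps(1)[of _ K T])
  have phi2: "\<phi> u \<in> linear_maps K A T" if "\<phi> \<in> carrier ?N" "u \<in> carrier T" for \<phi> u
    using phi1[OF that] by (simp add: hom_module_simps(1))
  have phi0: "\<phi> \<in> linear_maps K T ?HA" if "\<phi> \<in> carrier ?N" for \<phi>
    using that by (simp add: hom_module_simps(1))
  note st = word_product_step_linear
  have step_phi: "(\<lambda>\<phi>. sw (\<lambda>p q. snoc (\<phi> u q) p y) a b) \<in> linear_maps K ?N T"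
    if "u \<in> carrier T" "a \<in> carrier A" "b \<in> carrier A" "y \<in> carrier V" for u a b y
    using that by (intro linear_maps_comp[OF eval_linear st(4)])
  have step_u: "(\<lambda>u. sw (\<lambda>p q. snoc (\<phi> u q) p y) a b) \<in> linear_maps K T T"
    if "\<phi> \<in> carrier ?N" "a \<in> carrier A" "b \<in> carrier A" "y \<in> carrier V" for \<phi> a b y
    using that by (intro linear_maps_comp[OF phi0 st(4)])
  have step_a: "(\<lambda>a. sw (\<lambda>p q. snoc (\<phi> u q) p y) a b) \<in> linear_maps K A T"
    if "\<phi> \<in> carrier ?N" "u \<in> carrier T" "b \<in> carrier A" "y \<in> carrier V" for \<phi> u b y
    using that by (intro st(1)[OF _ _ that(3) phi2])
  have step_b: "(\<lambda>b. sw (\<lambda>p q. snoc (\<phi> u q) p y) a b) \<in> linear_maps K A T"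
    if "\<phi> \<in> carrier ?N" "u \<in> carrier T" "a \<in> carrier A" "y \<in> carrier V" for \<phi> u a y
    using that by (intro st(2)[OF that(3) _ _ phi2])
  have step_y: "(\<lambda>y. sw (\<lambda>p q. snoc (\<phi> u q) p y) a b) \<in> linear_maps K V T"
    if "\<phi> \<in> carrier ?N" "u \<in> carrier T" "a \<in> carrier A" "b \<in> carrier A" for \<phi> u a b
  proof -
    interpret V: module K V by (rule module_V)
    \<comment> \<open>The rule fixes a letter although this claim abstracts over it; the zero vector
      fills that place.\<close>
    show ?thesis using that by (intro st(3)[OF _ V.M.zero_closed _ phi2])
  qed
  have f: "f \<in> linear_maps K V ?N" unfolding f_def
    by (rule hom_module_linearI2[OF module_V module_T module_A])
      (intro append_letter_linear append_linear append_type_linear; assumption)+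
  have g1: "(\<lambda>\<phi>. g \<phi> b y) \<in> linear_maps K ?N ?N" if "b \<in> carrier A" "y \<in> carrier V" for b y
    unfolding g_def
    by (rule hom_module_linearI2[OF N module_T module_A])
      (simp_all add: that step_phi step_u step_a)
  have g2: "(\<lambda>b. g \<phi> b y) \<in> linear_maps K A ?N" if "\<phi> \<in> carrier ?N" "y \<in> carrier V" for \<phi> y
    unfolding g_def
    by (rule hom_module_linearI2[OF module_A module_T module_A])
      (simp_all add: that step_b step_u step_a)
  have g3: "(\<lambda>y. g \<phi> b y) \<in> linear_maps K V ?N" if "\<phi> \<in> carrier ?N" "b \<in> carrier A" for \<phi> b
    unfolding g_def
    by (rule hom_module_linearI2[OF module_V module_T module_A])
      (simp_all add: that step_y step_u step_a)
  obtain F where F: "F \<in> linear_maps K T ?N"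
    "\<And>x. x \<in> carrier V \<Longrightarrow> F (letter K A V x) = f x"
    "\<And>w a x. w \<in> carrier T \<Longrightarrow> a \<in> carrier A \<Longrightarrow> x \<in> carrier V \<Longrightarrow> F (snoc w a x) = g (F w) a x"
    using word_recursion_exists[OF N f g1 g2 g3] by blast
  note FN = linear_maps_closed[OF F(1)]
  \<comment> \<open>The recursion runs on the right factor, hence the argument order of
    \<open>F\<close>. The restrictions provide the extensionality that
    \<open>is_word_product\<close> demands.\<close>
  define star where "star = (\<lambda>a\<in>carrier A. \<lambda>u\<in>carrier T. \<lambda>v\<in>carrier T. F v u a)"
  have Fcl: "F v u a \<in> carrier T" if "v \<in> carrier T" "u \<in> carrier T" "a \<in> carrier A" for v u a
    by (rule linear_maps_closed[OF phi2[OF FN[OF that(1)] that(2)] that(3)])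
  have "star \<in> carrier A \<rightarrow>\<^sub>E carrier T \<rightarrow>\<^sub>E carrier T \<rightarrow>\<^sub>E carrier T"
    using Fcl by (auto simp: star_def)
  moreover have "star \<in> typed_products K A T"
  proof -
    have "(\<lambda>a. star a u v) \<in> linear_maps K A T" if "u \<in> carrier T" "v \<in> carrier T" for u v
      using phi2[OF FN[OF that(2)] that(1)] that
      by (subst linear_maps_cong[OF module_A, of _ "F v u"]) (auto simp: star_def)
    moreover have "(\<lambda>u. star a u v) \<in> linear_maps K T T" if "a \<in> carrier A" "v \<in> carrier T" for a v
      using linear_maps_comp[OF phi0[OF FN[OF that(2)]] eval_linear[OF that(1)]] that
      by (subst linear_maps_cong[OF module_T, of _ "\<lambda>u. F v u a"]) (auto simp: star_def)
    moreover have "(\<lambda>v. star a u v) \<in> linear_maps K T T" if "a \<in> carrier A" "u \<in> carrier T" for a u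
      using linear_maps_comp[OF linear_maps_comp[OF F(1) eval_linear[OF that(2)]] eval_linear[OF that(1)]] that
      by (subst linear_maps_cong[OF module_T, of _ "\<lambda>v. F v u a"]) (auto simp: star_def)
    ultimately show ?thesis by (simp add: typed_products_def)
  qed
  moreover have "star a w (letter K A V z) = snoc w a z"
    if "a \<in> carrier A" "w \<in> carrier T" "z \<in> carrier V" for a w z
    using that F(2) letter_closed by (simp add: star_def f_def)
  moreover have "star a u (snoc v b z) = sw (\<lambda>p q. snoc (star q u v) p z) a b"
    if "a \<in> carrier A" "b \<in> carrier A" "u \<in> carrier T" "v \<in> carrier T" "z \<in> carrier V" for a b u v z
  proof -
    have "star a u (snoc v b z) = sw (\<lambda>p q. snoc (F v u q) p z) a b"
      using that F(3) append_closed by (simp add: star_def g_def)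
    also have "\<dots> = sw (\<lambda>p q. snoc (star q u v) p z) a b"
      using that Fcl by (intro sweedler_cong[OF module_T]) (auto simp: star_def intro!: append_closed)
    finally show ?thesis .
  qed
  ultimately show ?thesis
    unfolding is_word_product_def Let_def by (intro exI[of _ star] conjI ballI) assumption+
qed

end

text \<open>The product is any one obeying the two clauses, not the chosen
  \<open>word_product\<close>, so that uniqueness can be proved by interpreting the locale
  twice.\<close>

locale word_product_algebra = phi_words K A \<Phi> V
  for K :: "('k, 'r) ring_scheme" and A :: "('k, 'a, 'p) module_scheme"
    and \<Phi> :: "('a list \<Rightarrow> 'k) set \<Rightarrow> ('a list \<Rightarrow> 'k) set"
    and V :: "('k, 'v, 'q) module_scheme" +
  fixes star
  assumes star: "is_word_product K A \<Phi> V star"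
begin

lemma star_typed_product: "star \<in> typed_products K A T"
  using star by (simp add: is_word_product_def Let_def)

lemma star_type_linear: "u \<in> carrier T \<Longrightarrow> v \<in> carrier T \<Longrightarrow> (\<lambda>a. star a u v) \<in> linear_maps K A T"
  and star_left_linear: "a \<in> carrier A \<Longrightarrow> v \<in> carrier T \<Longrightarrow> (\<lambda>u. star a u v) \<in> linear_maps K T T"
  and star_right_linear: "a \<in> carrier A \<Longrightarrow> u \<in> carrier T \<Longrightarrow> (\<lambda>v. star a u v) \<in> linear_maps K T T"
  using star_typed_product by (simp_all add: typed_products_def)

lemma star_closed: "a \<in> carrier A \<Longrightarrow> u \<in> carrier T \<Longrightarrow> v \<in> carrier T \<Longrightarrow> star a u v \<in> carrier T"
  by (rule linear_maps_closed[OF star_right_linear])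

lemma star_letter:
  "a \<in> carrier A \<Longrightarrow> w \<in> carrier T \<Longrightarrow> z \<in> carrier V \<Longrightarrow> star a w (letter K A V z) = snoc w a z"
  using star by (simp add: is_word_product_def Let_def)

lemma star_snoc:
  "a \<in> carrier A \<Longrightarrow> b \<in> carrier A \<Longrightarrow> u \<in> carrier T \<Longrightarrow> v \<in> carrier T \<Longrightarrow> z \<in> carrier V \<Longrightarrow>
    star a u (snoc v b z) = sw (\<lambda>p q. snoc (star q u v) p z) a b"
  using star by (simp add: is_word_product_def Let_def)

lemma star_extensional:
  "star \<in> carrier A \<rightarrow>\<^sub>E carrier T \<rightarrow>\<^sub>E carrier T \<rightarrow>\<^sub>E carrier T"
  using star by (simp add: is_word_product_def Let_def)

end

section \<open>Uniqueness of the product\<close>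

context phi_words
begin

lemma word_product_unique:
  assumes "is_word_product K A \<Phi> V star" "is_word_product K A \<Phi> V star'"
  shows "star = star'"
proof -
  interpret S: word_product_algebra K A \<Phi> V star by unfold_locales fact
  interpret S': word_product_algebra K A \<Phi> V star' by unfold_locales fact
  \<comment> \<open>The type stays arbitrary, because the recursive clause uses the hypothesis at
    the second Sweedler components.\<close>
  have eq: "star a u v = star' a u v" if "v \<in> carrier T" "a \<in> carrier A" "u \<in> carrier T" for a u v
    using that
  proof (induction arbitrary: a rule: word_induct)
    case (letter x)
    then show ?case by (simp add: S.star_letter S'.star_letter)
  next
    case (append w b x)
    have "sw (\<lambda>p q. snoc (star q u w) p x) a b = sw (\<lambda>p q. snoc (star' q u w) p x) a b"
      using append by (intro sweedler_cong[OF module_T]) (auto intro!: append_closed S'.star_closed)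
    then show ?case using append by (simp add: S.star_snoc S'.star_snoc)
  next
    case (add s t)
    then show ?case
      by (simp add: linear_maps_add[OF S.star_right_linear] linear_maps_add[OF S'.star_right_linear])
  next
    case (smult c t)
    then show ?case
      by (simp add: linear_maps_smult[OF S.star_right_linear] linear_maps_smult[OF S'.star_right_linear])
  qed
  \<comment> \<open>The definite description needs equality of functions, not only of values on
    carriers; extensionality is used at each of the three argument levels.\<close>
  show ?thesis
  proof (rule PiE_ext[OF S.star_extensional S'.star_extensional])
    fix a assume a: "a \<in> carrier A"
    show "star a = star' a"
    proof (rule PiE_ext[OF PiE_mem[OF S.star_extensional a] PiE_mem[OF S'.star_extensional a]])
      fix u assume u: "u \<in> carrier T"
      show "star a u = star' a u"
        using eq a u
        by (intro PiE_ext[OF PiE_mem[OF PiE_mem[OF S.star_extensional a] u]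
              PiE_mem[OF PiE_mem[OF S'.star_extensional a] u]])
    qed
  qed
qed

lemma word_product_ex1: "\<exists>!star. is_word_product K A \<Phi> V star"
  using word_product_exists word_product_unique by blast

lemma word_product_is_word_product: "is_word_product K A \<Phi> V (word_product K A \<Phi> V)"
  unfolding word_product_def by (rule theI'[OF word_product_ex1])

end

section \<open>Associativity\<close>

context word_product_algebra
begin

text \<open>The types are quantified inside, since the passage to a longer third factor uses the law
  at types other than the given ones.\<close>

definition assoc_at where
  "assoc_at u v w \<longleftrightarrow> (\<forall>a\<in>carrier A. \<forall>b\<in>carrier A.
     star a u (star b v w) = sw (\<lambda>p q. star p (star q u v) w) a b)"

text \<open>The types in \<open>s\<close> are ordered from the outside in: entry 0 belongs to the
  appended letter, entry 2 to the innermost product.\<close>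

definition triple_product where
  "triple_product u v w t =
     lin_ext K T (\<lambda>s. snoc (star (s ! 1) (star (s ! 2) u v) w) (s ! 0) t)"

context
  fixes u v w t
  assumes u: "u \<in> carrier T" and v: "v \<in> carrier T" and w: "w \<in> carrier T" and t: "t \<in> carrier V"
begin

private abbreviation "G \<equiv> triple_product u v w t"

lemma triple_product_linear: "G \<in> linear_maps K (tensor_power K A 3) T"
  and triple_product_pure: "a \<in> carrier A \<Longrightarrow> b \<in> carrier A \<Longrightarrow> c \<in> carrier A \<Longrightarrow>
    G (pure_tensor K A [a, b, c]) = snoc (star b (star c u v) w) a t"
proof -
  let ?h = "\<lambda>a b c. snoc (star b (star c u v) w) a t"
  have 1: "(\<lambda>a. ?h a b c) \<in> linear_maps K A T" if "b \<in> carrier A" "c \<in> carrier A" for b c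
    using that u v w t by (intro append_type_linear star_closed)
  have 2: "(\<lambda>b. ?h a b c) \<in> linear_maps K A T" if "a \<in> carrier A" "c \<in> carrier A" for a c
    using that u v w t by (intro linear_maps_comp[OF star_type_linear append_linear] star_closed)
  have 3: "(\<lambda>c. ?h a b c) \<in> linear_maps K A T" if "a \<in> carrier A" "b \<in> carrier A" for a b
    using that u v w t
    by (intro linear_maps_comp[OF linear_maps_comp[OF star_type_linear star_left_linear] append_linear])
  note * = tensor3_lin_ext[where h = ?h, OF module_A module_T 1 2 3]
  show "G \<in> linear_maps K (tensor_power K A 3) T"
    unfolding triple_product_def by (rule *(1)) assumption+
  show "G (pure_tensor K A [a, b, c]) = ?h a b c"
    if "a \<in> carrier A" "b \<in> carrier A" "c \<in> carrier A"
    unfolding triple_product_def by (rule *(2)) (simp_all add: that)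
qed

text \<open>Each occurrence of \<Phi> is one expansion. The recursive clause at (b, c) gives the
  first Id \<otimes> \<Phi>, the clause at (a, p) gives \<Phi> \<otimes> Id, and the assumed
  associativity at (s, q) gives the last Id \<otimes> \<Phi>.\<close>

lemma star_star_snoc:
  assumes "assoc_at u v w" "a \<in> carrier A" "b \<in> carrier A" "c \<in> carrier A"
  shows "star a u (star b v (snoc w c t)) =
    G (id_tensor K A \<Phi> (tensor_id K A \<Phi> (id_tensor K A \<Phi> (pure_tensor K A [a, b, c]))))"
proof -
  note [simp] = u v w t star_closed append_closed
  note L1 = linear_maps_comp[OF id_tensor_linear triple_product_linear]
  note L2 = linear_maps_comp[OF tensor_id_linear L1]
  have "star a u (star b v (snoc w c t)) = star a u (sw (\<lambda>p q. snoc (star q v w) p t) b c)"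
    using assms by (simp add: star_snoc)
  also have "\<dots> = sw (\<lambda>p q. star a u (snoc (star q v w) p t)) b c"
    using assms by (intro linear_map_sweedler[OF module_T module_T star_right_linear]) auto
  also have "\<dots> = sw (\<lambda>p q. G (id_tensor K A \<Phi> (tensor_id K A \<Phi> (pure_tensor K A [a, p, q])))) b c"
  proof (rule sweedler_cong[OF module_T assms(3,4)])
    fix p q assume pq: "p \<in> carrier A" "q \<in> carrier A"
    have "star a u (snoc (star q v w) p t) = sw (\<lambda>r s. snoc (star s u (star q v w)) r t) a p"
      using assms pq by (simp add: star_snoc)
    also have "\<dots> = sw (\<lambda>r s. G (id_tensor K A \<Phi> (pure_tensor K A [r, s, q]))) a p"
    proof (rule sweedler_cong[OF module_T assms(2) pq(1)])
      fix r s assume rs: "r \<in> carrier A" "s \<in> carrier A"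
      have "snoc (star s u (star q v w)) r t = snoc (sw (\<lambda>k l. star k (star l u v) w) s q) r t"
        using assms(1) rs pq by (simp add: assoc_at_def)
      also have "\<dots> = sw (\<lambda>k l. snoc (star k (star l u v) w) r t) s q"
        using rs pq by (intro linear_map_sweedler[OF module_T module_T append_linear]) auto
      also have "\<dots> = sw (\<lambda>k l. G (pure_tensor K A [r, k, l])) s q"
        using rs pq by (intro sweedler_cong[OF module_T]) (auto simp: triple_product_pure)
      also have "\<dots> = G (id_tensor K A \<Phi> (pure_tensor K A [r, s, q]))"
        using rs pq by (intro linear_map_id_tensor_pure[OF module_T triple_product_linear, symmetric])
      finally show "snoc (star s u (star q v w)) r t = G (id_tensor K A \<Phi> (pure_tensor K A [r, s, q]))" .
      \<comment> \<open>The second obligation of \<open>sweedler_cong\<close>; closedness is plain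
        for the left side of the equation just proved.\<close>
      then show "G (id_tensor K A \<Phi> (pure_tensor K A [r, s, q])) \<in> carrier T"
        using rs pq by (metis append_closed star_closed u v w t)
    qed
    also have "\<dots> = G (id_tensor K A \<Phi> (tensor_id K A \<Phi> (pure_tensor K A [a, p, q])))"
      using assms pq by (intro linear_map_tensor_id_pure[OF module_T L1, symmetric])
    finally show "star a u (snoc (star q v w) p t) =
      G (id_tensor K A \<Phi> (tensor_id K A \<Phi> (pure_tensor K A [a, p, q])))" .
    then show "G (id_tensor K A \<Phi> (tensor_id K A \<Phi> (pure_tensor K A [a, p, q]))) \<in> carrier T"
      using assms pq by (metis append_closed star_closed u v w t)
  qed
  also have "\<dots> = G (id_tensor K A \<Phi> (tensor_id K A \<Phi> (id_tensor K A \<Phi> (pure_tensor K A [a, b, c]))))"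
    using assms by (intro linear_map_id_tensor_pure[OF module_T L2, symmetric])
  finally show ?thesis .
qed

text \<open>Once \<Phi> has acted on a \<otimes> b, the factors are p, q, c, but the recursive
  clause combines the outer type p with c while q stays with the inner product. The flip brings c
  next to p; this is its origin in the \<ell>EAS equation.\<close>

lemma star_star_snoc':
  assumes "a \<in> carrier A" "b \<in> carrier A" "c \<in> carrier A"
  shows "sw (\<lambda>p q. star p (star q u v) (snoc w c t)) a b =
    G (tensor_id K A \<Phi> (id_tensor K A (tensor_flip K A) (tensor_id K A \<Phi> (pure_tensor K A [a, b, c]))))"
proof -
  note [simp] = u v w t star_closed append_closed
  note L1 = linear_maps_comp[OF tensor_id_linear triple_product_linear]
  note L2 = linear_maps_comp[OF id_tensor_flip_linear L1]
  have "sw (\<lambda>p q. star p (star q u v) (snoc w c t)) a b =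
    sw (\<lambda>p q. G (tensor_id K A \<Phi> (id_tensor K A (tensor_flip K A) (pure_tensor K A [p, q, c])))) a b"
  proof (rule sweedler_cong[OF module_T assms(1,2)])
    fix p q assume pq: "p \<in> carrier A" "q \<in> carrier A"
    have "star p (star q u v) (snoc w c t) = sw (\<lambda>r s. snoc (star s (star q u v) w) r t) p c"
      using assms pq by (simp add: star_snoc)
    also have "\<dots> = sw (\<lambda>r s. G (pure_tensor K A [r, s, q])) p c"
      using assms pq by (intro sweedler_cong[OF module_T]) (auto simp: triple_product_pure)
    also have "\<dots> = G (tensor_id K A \<Phi> (pure_tensor K A [p, c, q]))"
      using assms pq by (intro linear_map_tensor_id_pure[OF module_T triple_product_linear, symmetric])
    also have "\<dots> = G (tensor_id K A \<Phi> (id_tensor K A (tensor_flip K A) (pure_tensor K A [p, q, c])))"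
      using assms pq by (simp add: id_tensor_flip_pure)
    finally show "star p (star q u v) (snoc w c t) =
      G (tensor_id K A \<Phi> (id_tensor K A (tensor_flip K A) (pure_tensor K A [p, q, c])))" .
    then show "G (tensor_id K A \<Phi> (id_tensor K A (tensor_flip K A) (pure_tensor K A [p, q, c]))) \<in> carrier T"
      using assms pq by (metis append_closed star_closed u v w t)
  qed
  also have "\<dots> = G (tensor_id K A \<Phi> (id_tensor K A (tensor_flip K A) (tensor_id K A \<Phi> (pure_tensor K A [a, b, c]))))"
    using assms by (intro linear_map_tensor_id_pure[OF module_T L2, symmetric])
  finally show ?thesis .
qed

end

text \<open>Multiplying by a letter is appending, so for a letter the law is the recursive clause of
  the product itself.\<close>

lemma assoc_at_letter:
  assumes "u \<in> carrier T" "v \<in> carrier T" "x \<in> carrier V"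
  shows "assoc_at u v (letter K A V x)"
  unfolding assoc_at_def
proof (intro ballI)
  fix a b assume ab: "a \<in> carrier A" "b \<in> carrier A"
  have "star a u (star b v (letter K A V x)) = sw (\<lambda>p q. snoc (star q u v) p x) a b"
    using assms ab by (simp add: star_letter star_snoc)
  also have "\<dots> = sw (\<lambda>p q. star p (star q u v) (letter K A V x)) a b"
    using assms ab letter_closed by (intro sweedler_cong[OF module_T]) (auto simp: star_letter star_closed append_closed)
  finally show "star a u (star b v (letter K A V x)) = sw (\<lambda>p q. star p (star q u v) (letter K A V x)) a b" .
qed

lemma phi_assoc_algebra_iff:
  "phi_assoc_algebra K A \<Phi> T star \<longleftrightarrow> (\<forall>u\<in>carrier T. \<forall>v\<in>carrier T. \<forall>w\<in>carrier T. assoc_at u v w)"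
  using module_T star_typed_product by (auto simp: phi_assoc_algebra_def assoc_at_def)

lemma phi_assoc_algebra_if_lEAS:
  assumes "lEAS K A \<Phi>"
  shows "phi_assoc_algebra K A \<Phi> T star"
  unfolding phi_assoc_algebra_iff
proof (intro ballI)
  fix u v w assume u: "u \<in> carrier T" and v: "v \<in> carrier T" and "w \<in> carrier T"
  \<comment> \<open>Linearity of both sides in the last factor settles the cases of sums and
    multiples.\<close>
  have L: "(\<lambda>w. star a u (star b v w)) \<in> linear_maps K T T"
    "(\<lambda>w. sw (\<lambda>p q. star p (star q u v) w) a b) \<in> linear_maps K T T"
    if "a \<in> carrier A" "b \<in> carrier A" for a b
    using that u v
    by (auto intro!: linear_maps_comp[OF star_right_linear star_right_linear]
        sweedler_linear_parameter[OF module_T module_T] star_right_linear star_closed)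
  from \<open>w \<in> carrier T\<close> show "assoc_at u v w"
  proof (induction rule: word_induct)
    case (letter x)
    then show ?case using u v by (rule assoc_at_letter[rotated 2])
  next
    case (append w c x)
    have "star a u (star b v (snoc w c x)) = sw (\<lambda>p q. star p (star q u v) (snoc w c x)) a b"
      if ab: "a \<in> carrier A" "b \<in> carrier A" for a b
    proof -
      have "pure_tensor K A [a, b, c] \<in> carrier (tensor_power K A 3)"
        using ab append by (intro pure_tensor_closed[OF module_A]) (simp add: tensor_words_3_iff)
      then show ?thesis
        using star_star_snoc[OF u v append(1,3,4) ab append(2)] star_star_snoc'[OF u v append(1,3) ab append(2)]
          assms by (simp add: lEAS_def)
    qed
    then show ?case by (simp add: assoc_at_def)
  next
    case (add s t)
    then show ?case
      by (simp add: assoc_at_def linear_maps_add[OF L(1)] linear_maps_add[OF L(2)])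
  next
    case (smult c t)
    then show ?case
      by (simp add: assoc_at_def linear_maps_smult[OF L(1)] linear_maps_smult[OF L(2)])
  qed
qed

end

section \<open>Linear forms\<close>

text \<open>A submodule maximal among those avoiding \<open>x\<close> is a complement of the line through \<open>x\<close>.\<close>

lemma exists_linear_form:
  assumes "field K" "module K V" "x \<in> carrier V" "x \<noteq> \<zero>\<^bsub>V\<^esub>"
  obtains f where "f \<in> linear_maps K V (self_module K)" "f x = \<one>\<^bsub>K\<^esub>"
proof -
  interpret K: field K by fact
  interpret V: module K V by fact
  define \<H> where "\<H> = {H. submodule H K V \<and> x \<notin> H}"
  have "\<exists>M\<in>\<H>. \<forall>H\<in>\<H>. M \<subseteq> H \<longrightarrow> H = M"
  proof (rule subset_Zorn_nonempty)
    have "{\<zero>\<^bsub>V\<^esub>} \<in> \<H>" unfolding \<H>_def using assms(4) by (auto intro!: V.submoduleI)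
    then show "\<H> \<noteq> {}" by blast
    fix C assume C: "C \<noteq> {}" "subset.chain \<H> C"
    then have sub: "H \<in> \<H>" if "H \<in> C" for H using that by (auto simp: subset.chain_def)
    have le: "H \<subseteq> H' \<or> H' \<subseteq> H" if "H \<in> C" "H' \<in> C" for H H'
      using C(2) that by (rule subset_chain_def[THEN iffD1, THEN conjunct2, rule_format])
    note S = V.submoduleE[OF sub[unfolded \<H>_def, simplified, THEN conjunct1]]
    have "submodule (\<Union>C) K V"
    proof (rule V.submoduleI)
      show "\<Union>C \<subseteq> carrier V" using S(1) by blast
      obtain H where "H \<in> C" using C(1) by blast
      then show "\<zero>\<^bsub>V\<^esub> \<in> \<Union>C"
        using sub[of H] subgroup.one_closed[OF submodule.axioms(1), of H K V] by (auto simp: \<H>_def)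
      show "a \<oplus>\<^bsub>V\<^esub> b \<in> \<Union>C" if ab: "a \<in> \<Union>C" "b \<in> \<Union>C" for a b
      proof -
        obtain H H' where HH: "H \<in> C" "a \<in> H" "H' \<in> C" "b \<in> H'" using ab by blast
        then show ?thesis using le[OF HH(1,3)] S(5) by blast
      qed
    qed (use S in blast)+
    moreover have "x \<notin> \<Union>C" using sub by (auto simp: \<H>_def)
    ultimately show "\<Union>C \<in> \<H>" by (simp add: \<H>_def)
  qed
  then obtain H where H: "submodule H K V" "x \<notin> H"
    and max: "\<And>H'. submodule H' K V \<Longrightarrow> x \<notin> H' \<Longrightarrow> H \<subseteq> H' \<Longrightarrow> H' = H"
    by (auto simp: \<H>_def)
  note HE = V.submoduleE[OF H(1)]
  have H0: "\<zero>\<^bsub>V\<^esub> \<in> H" using subgroup.one_closed[OF submodule.axioms(1)[OF H(1)]] by simp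
  \<comment> \<open>Uniqueness of the coefficient of x modulo \<open>H\<close>: if c and c' differ,
    then (c - c') x lies in \<open>H\<close>, and dividing by c - c' puts x into
    \<open>H\<close>.\<close>
  have cong: "(c \<in> carrier K \<and> c' \<in> carrier K \<and> h \<in> H \<and> h' \<in> H \<and>
      h \<oplus>\<^bsub>V\<^esub> c \<odot>\<^bsub>V\<^esub> x = h' \<oplus>\<^bsub>V\<^esub> c' \<odot>\<^bsub>V\<^esub> x) \<Longrightarrow> c = c'" for c c' h h'
  proof (rule ccontr)
    assume *: "c \<in> carrier K \<and> c' \<in> carrier K \<and> h \<in> H \<and> h' \<in> H \<and>
      h \<oplus>\<^bsub>V\<^esub> c \<odot>\<^bsub>V\<^esub> x = h' \<oplus>\<^bsub>V\<^esub> c' \<odot>\<^bsub>V\<^esub> x" and ne: "c \<noteq> c'"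
    then have hV: "h \<in> carrier V" "h' \<in> carrier V" using HE(1) by auto
    have d: "c \<ominus>\<^bsub>K\<^esub> c' \<in> carrier K" "c \<ominus>\<^bsub>K\<^esub> c' \<noteq> \<zero>\<^bsub>K\<^esub>"
      using * ne by (auto simp: K.minus_eq_zero_iff)
    then have U: "c \<ominus>\<^bsub>K\<^esub> c' \<in> Units K" by (simp add: K.field_Units)
    have cc: "c \<in> carrier K" "c' \<in> carrier K" using * by auto
    have "(c \<ominus>\<^bsub>K\<^esub> c') \<odot>\<^bsub>V\<^esub> x = c \<odot>\<^bsub>V\<^esub> x \<oplus>\<^bsub>V\<^esub> \<ominus>\<^bsub>V\<^esub> (c' \<odot>\<^bsub>V\<^esub> x)"
      using cc assms(3) by (simp add: a_minus_def V.smult_l_distr V.smult_l_minus)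
    also have "\<dots> = \<ominus>\<^bsub>V\<^esub> h \<oplus>\<^bsub>V\<^esub> (h \<oplus>\<^bsub>V\<^esub> c \<odot>\<^bsub>V\<^esub> x) \<oplus>\<^bsub>V\<^esub> \<ominus>\<^bsub>V\<^esub> (c' \<odot>\<^bsub>V\<^esub> x)"
      using cc assms(3) hV by (simp add: V.M.l_neg flip: V.M.a_assoc)
    also have "\<dots> = \<ominus>\<^bsub>V\<^esub> h \<oplus>\<^bsub>V\<^esub> (h' \<oplus>\<^bsub>V\<^esub> c' \<odot>\<^bsub>V\<^esub> x) \<oplus>\<^bsub>V\<^esub> \<ominus>\<^bsub>V\<^esub> (c' \<odot>\<^bsub>V\<^esub> x)"
      using * by simp
    also have "\<dots> = \<ominus>\<^bsub>V\<^esub> h \<oplus>\<^bsub>V\<^esub> h'"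
      using cc assms(3) hV by (simp add: V.M.a_assoc V.M.r_neg)
    also have "\<dots> \<in> H" using * HE(3,5) by blast
    finally have "inv\<^bsub>K\<^esub> (c \<ominus>\<^bsub>K\<^esub> c') \<odot>\<^bsub>V\<^esub> ((c \<ominus>\<^bsub>K\<^esub> c') \<odot>\<^bsub>V\<^esub> x) \<in> H"
      using HE(4)[OF K.Units_inv_closed[OF U]] by blast
    then have "x \<in> H"
      using U d(1) assms(3)
      by (metis K.Units_l_inv K.Units_inv_closed V.smult_assoc1 V.smult_one)
    then show False using H(2) by blast
  qed
  have decomp: "\<exists>h\<in>H. \<exists>c\<in>carrier K. y = h \<oplus>\<^bsub>V\<^esub> c \<odot>\<^bsub>V\<^esub> x" if y: "y \<in> carrier V" for y
  proof (cases "y \<in> H")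
    case True
    then show ?thesis using y assms(3) by (intro bexI[of _ y] bexI[of _ "\<zero>\<^bsub>K\<^esub>"]) auto
  next
    case False
    \<comment> \<open>This is H + K y. It is strictly larger than \<open>H\<close>, so maximality
      forces x into it. In x = h + c y the scalar c is nonzero, since x is not in \<open>H\<close>,
      and the equation can be solved for y.\<close>
    define H' where "H' = {h \<oplus>\<^bsub>V\<^esub> c \<odot>\<^bsub>V\<^esub> y | h c. h \<in> H \<and> c \<in> carrier K}"
    have HV: "h \<in> carrier V" if "h \<in> H" for h using that HE(1) by blast
    have "submodule H' K V"
    proof (rule V.submoduleI)
      show "H' \<subseteq> carrier V" using y HV by (auto simp: H'_def)
      show "\<zero>\<^bsub>V\<^esub> \<in> H'"
        unfolding H'_def using H0 y by (auto intro!: exI[of _ "\<zero>\<^bsub>V\<^esub>"] exI[of _ "\<zero>\<^bsub>K\<^esub>"])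
      show "\<ominus>\<^bsub>V\<^esub> z \<in> H'" if mem: "z \<in> H'" for z
      proof -
        obtain h c where "h \<in> H" "c \<in> carrier K" "z = h \<oplus>\<^bsub>V\<^esub> c \<odot>\<^bsub>V\<^esub> y"
          using mem by (auto simp: H'_def)
        moreover from this have "\<ominus>\<^bsub>V\<^esub> z = \<ominus>\<^bsub>V\<^esub> h \<oplus>\<^bsub>V\<^esub> (\<ominus>\<^bsub>K\<^esub> c) \<odot>\<^bsub>V\<^esub> y"
          using y HV by (simp add: V.M.minus_add V.smult_l_minus)
        ultimately show ?thesis unfolding H'_def using HE(3) K.a_inv_closed by blast
      qed
      show "z \<oplus>\<^bsub>V\<^esub> z' \<in> H'" if mem: "z \<in> H'" "z' \<in> H'" for z z'
      proof -
        obtain h c h' c' where "h \<in> H" "c \<in> carrier K" "z = h \<oplus>\<^bsub>V\<^esub> c \<odot>\<^bsub>V\<^esub> y"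
          "h' \<in> H" "c' \<in> carrier K" "z' = h' \<oplus>\<^bsub>V\<^esub> c' \<odot>\<^bsub>V\<^esub> y"
          using mem by (auto simp: H'_def)
        moreover from this have "z \<oplus>\<^bsub>V\<^esub> z' = (h \<oplus>\<^bsub>V\<^esub> h') \<oplus>\<^bsub>V\<^esub> (c \<oplus>\<^bsub>K\<^esub> c') \<odot>\<^bsub>V\<^esub> y"
          using y HV by (simp add: V.smult_l_distr V.M.a_ac)
        ultimately show ?thesis unfolding H'_def using HE(5) K.a_closed by blast
      qed
      show "a \<odot>\<^bsub>V\<^esub> z \<in> H'" if a: "a \<in> carrier K" and mem: "z \<in> H'" for a z
      proof -
        obtain h c where "h \<in> H" "c \<in> carrier K" "z = h \<oplus>\<^bsub>V\<^esub> c \<odot>\<^bsub>V\<^esub> y"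
          using mem by (auto simp: H'_def)
        moreover from this have "a \<odot>\<^bsub>V\<^esub> z = (a \<odot>\<^bsub>V\<^esub> h) \<oplus>\<^bsub>V\<^esub> (a \<otimes>\<^bsub>K\<^esub> c) \<odot>\<^bsub>V\<^esub> y"
          using a y HV by (simp add: V.smult_r_distr V.smult_assoc1)
        ultimately show ?thesis unfolding H'_def using HE(4) a K.m_closed by blast
      qed
    qed
    moreover have sub: "H \<subseteq> H'"
    proof
      fix h assume "h \<in> H"
      moreover from this have "h = h \<oplus>\<^bsub>V\<^esub> \<zero>\<^bsub>K\<^esub> \<odot>\<^bsub>V\<^esub> y" using HV y by simp
      ultimately show "h \<in> H'" unfolding H'_def by blast
    qed
    moreover have "y \<in> H'"
      unfolding H'_def using H0 y by (auto intro!: exI[of _ "\<zero>\<^bsub>V\<^esub>"] exI[of _ "\<one>\<^bsub>K\<^esub>"])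
    ultimately have "x \<in> H'" using max False by blast
    then obtain h c where hc: "h \<in> H" "c \<in> carrier K" "x = h \<oplus>\<^bsub>V\<^esub> c \<odot>\<^bsub>V\<^esub> y"
      by (auto simp: H'_def)
    have "c \<noteq> \<zero>\<^bsub>K\<^esub>" using hc HV y H(2) by auto
    then have U: "c \<in> Units K" using hc(2) by (simp add: K.field_Units)
    have ic: "inv\<^bsub>K\<^esub> c \<in> carrier K" using U by simp
    have "inv\<^bsub>K\<^esub> c \<odot>\<^bsub>V\<^esub> x = inv\<^bsub>K\<^esub> c \<odot>\<^bsub>V\<^esub> h \<oplus>\<^bsub>V\<^esub> y"
      using hc U ic HV y by (simp add: V.smult_r_distr K.Units_l_inv flip: V.smult_assoc1)
    then have "y = \<ominus>\<^bsub>V\<^esub> (inv\<^bsub>K\<^esub> c \<odot>\<^bsub>V\<^esub> h) \<oplus>\<^bsub>V\<^esub> inv\<^bsub>K\<^esub> c \<odot>\<^bsub>V\<^esub> x"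
      using hc(1) ic HV y by (simp add: V.M.l_neg flip: V.M.a_assoc)
    then show ?thesis using HE(3,4) hc(1) ic by blast
  qed
  \<comment> \<open>The coordinate of y along x in the decomposition into \<open>H\<close> and the
    line through x; \<open>decomp\<close> and \<open>cong\<close> make the description
    definite.\<close>
  define f where "f y = (THE c. c \<in> carrier K \<and> (\<exists>h\<in>H. y = h \<oplus>\<^bsub>V\<^esub> c \<odot>\<^bsub>V\<^esub> x))" for y
  have f: "f (h \<oplus>\<^bsub>V\<^esub> c \<odot>\<^bsub>V\<^esub> x) = c" if "h \<in> H" "c \<in> carrier K" for h c
    unfolding f_def using that cong by (intro the_equality) blast+
  have HV: "h \<in> carrier V" if "h \<in> H" for h using that HE(1) by blast
  have "f \<in> linear_maps K V (self_module K)"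
  proof (rule linear_mapsI)
    fix y assume "y \<in> carrier V"
    then obtain h c where y: "h \<in> H" "c \<in> carrier K" "y = h \<oplus>\<^bsub>V\<^esub> c \<odot>\<^bsub>V\<^esub> x" using decomp by blast
    then show "f y \<in> carrier (self_module K)" by (simp add: f self_module_def)
    {
      fix z assume "z \<in> carrier V"
      then obtain h' c' where z: "h' \<in> H" "c' \<in> carrier K" "z = h' \<oplus>\<^bsub>V\<^esub> c' \<odot>\<^bsub>V\<^esub> x"
        using decomp by blast
      have "y \<oplus>\<^bsub>V\<^esub> z = (h \<oplus>\<^bsub>V\<^esub> h') \<oplus>\<^bsub>V\<^esub> (c \<oplus>\<^bsub>K\<^esub> c') \<odot>\<^bsub>V\<^esub> x"
        using y z HV assms(3) by (simp add: V.smult_l_distr V.M.a_ac)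
      then show "f (y \<oplus>\<^bsub>V\<^esub> z) = f y \<oplus>\<^bsub>self_module K\<^esub> f z"
        using y z HE(5) by (simp add: f self_module_def)
    }
    fix a assume a: "a \<in> carrier K"
    have "a \<odot>\<^bsub>V\<^esub> y = (a \<odot>\<^bsub>V\<^esub> h) \<oplus>\<^bsub>V\<^esub> (a \<otimes>\<^bsub>K\<^esub> c) \<odot>\<^bsub>V\<^esub> x"
      using a y HV assms(3) by (simp add: V.smult_r_distr V.smult_assoc1)
    then show "f (a \<odot>\<^bsub>V\<^esub> y) = a \<odot>\<^bsub>self_module K\<^esub> f y"
      using a y HE(4) by (simp add: f self_module_def)
  qed
  moreover have "f x = \<one>\<^bsub>K\<^esub>" using f[OF H0 K.one_closed] assms(3) by simp
  ultimately show thesis by (rule that)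
qed

section \<open>Recovering tensors from typed words\<close>

context typed_words
begin

text \<open>The reversal undoes the one in the map \<open>G\<close>, which sends \<open>p \<otimes> q \<otimes> r\<close> to the word
  \<open>r q p x x x x\<close>.\<close>

lemma exists_type_projection:
  assumes "f \<in> linear_maps K V (self_module K)"
  obtains J where "J \<in> linear_maps K T (tensor_power K A n)"
    "\<And>as x. as \<in> tensor_words A n \<Longrightarrow> x \<in> carrier V \<Longrightarrow> f x = \<one>\<^bsub>K\<^esub> \<Longrightarrow>
      J (word as (replicate (Suc n) x)) = pure_tensor K A (rev as)"
proof -
  let ?P = "tensor_power K A n"
  interpret A: module K A by (rule module_A)
  interpret P: module K ?P by (rule tensor_power_module[OF module_A])
  \<comment> \<open>The product of the values of the form over all letters: it removes the letters
    and leaves a scalar.\<close>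
  define pf where "pf xs = foldr (\<lambda>x c. f x \<otimes>\<^bsub>K\<^esub> c) xs \<one>\<^bsub>K\<^esub>" for xs
  \<comment> \<open>Words with another number of types go to zero, so the extension factors through
    one summand of \<open>T\<close>, the one with n types and n + 1 letters.\<close>
  define h where "h as xs = (if length as = n then pf xs \<odot>\<^bsub>?P\<^esub> pure_tensor K A (rev as) else \<zero>\<^bsub>?P\<^esub>)"
    for as xs
  have fc: "f x \<in> carrier K" if "x \<in> carrier V" for x
    using linear_maps_closed[OF assms that] by (simp add: self_module_def)
  have pf: "pf xs \<in> carrier K" if "xs \<in> lists (carrier V)" for xs
    using that by (induction xs rule: lists.induct) (auto simp: pf_def fc)
  \<comment> \<open>The factor of one letter is moved to the end, which exhibits the dependence on
    that slot as a fixed scalar times f y.\<close>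
  have pf_append: "pf (xs @ y # ys) = pf xs \<otimes>\<^bsub>K\<^esub> pf ys \<otimes>\<^bsub>K\<^esub> f y"
    if "xs \<in> lists (carrier V)" "y \<in> carrier V" "ys \<in> lists (carrier V)" for xs y ys
    using that(1)
  proof (induction xs rule: lists.induct)
    case Nil
    then show ?case using that pf[of ys] fc by (simp add: pf_def A.R.m_comm)
  next
    case (Cons x xs)
    then show ?case using that pf[of ys] pf[of xs] fc by (simp add: pf_def A.R.m_assoc)
  qed
  have pt: "pure_tensor K A (rev as) \<in> carrier ?P" if "as \<in> lists (carrier A)" "length as = n" for as
    using that by (intro pure_tensor_closed[OF module_A]) (auto simp: tensor_words_def)
  have hc: "h as xs \<in> carrier ?P"
    if "as \<in> lists (carrier A)" "xs \<in> lists (carrier V)" "length xs = length as + 1" for as xs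
    using that pt pf by (simp add: h_def)
  have ts: "(\<lambda>a. h (u @ a # v) xs) \<in> linear_maps K A ?P"
    if "u \<in> lists (carrier A)" "v \<in> lists (carrier A)" "xs \<in> lists (carrier V)"
      "length xs = length u + length v + 2" for u v xs
  proof (cases "length u + length v + 1 = n")
    case True
    have "(\<lambda>a. pure_tensor K A (rev v @ a # rev u)) \<in> linear_maps K A ?P"
      using that True by (intro pure_tensor_slot_linear[OF module_A]) auto
    from linear_maps_smult_fun[OF P.module_axioms this pf[OF that(3)]] show ?thesis
      using True by (simp add: h_def)
  next
    case False
    then show ?thesis using linear_maps_zero_fun[OF P.module_axioms] by (simp add: h_def)
  qed
  have ls: "(\<lambda>x. h as (u @ x # v)) \<in> linear_maps K V ?P"
    if "as \<in> lists (carrier A)" "u \<in> lists (carrier V)" "v \<in> lists (carrier V)"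
      "length u + length v = length as" for as u v
  proof (cases "length as = n")
    case True
    let ?c = "pf u \<otimes>\<^bsub>K\<^esub> pf v"
    have c: "?c \<in> carrier K" using that pf by simp
    have "(\<lambda>k. k \<odot>\<^bsub>?P\<^esub> pure_tensor K A (rev as)) \<in> linear_maps K (self_module K) ?P"
      using pt[OF that(1) True]
      by (intro linear_mapsI) (auto simp: self_module_def P.smult_l_distr P.smult_assoc1)
    from linear_maps_comp[OF assms linear_maps_smult_fun[OF P.module_axioms this c]]
    have "(\<lambda>x. ?c \<odot>\<^bsub>?P\<^esub> (f x \<odot>\<^bsub>?P\<^esub> pure_tensor K A (rev as))) \<in> linear_maps K V ?P" .
    moreover have "?c \<odot>\<^bsub>?P\<^esub> (f x \<odot>\<^bsub>?P\<^esub> pure_tensor K A (rev as)) = h as (u @ x # v)"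
      if "x \<in> carrier V" for x
      using that True fc pf[OF \<open>u \<in> _\<close>] pf[OF \<open>v \<in> _\<close>] pt[OF \<open>as \<in> _\<close> True] \<open>u \<in> _\<close> \<open>v \<in> _\<close>
      by (simp add: h_def pf_append P.smult_assoc1)
    ultimately show ?thesis by (subst (asm) linear_maps_cong[OF module_V]) auto
  next
    case False
    then show ?thesis using linear_maps_zero_fun[OF P.module_axioms] by (simp add: h_def)
  qed
  show thesis
  proof (rule that)
    show "lin_ext K ?P (\<lambda>(as, xs). h as xs) \<in> linear_maps K T ?P"
      by (rule word_lin_ext_linear[OF P.module_axioms hc ts ls])
    fix as x assume as: "as \<in> tensor_words A n" and x: "x \<in> carrier V" "f x = \<one>\<^bsub>K\<^esub>"
    have "lin_ext K ?P (\<lambda>(as, xs). h as xs) (word as (replicate (Suc n) x)) = h as (replicate (Suc n) x)"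
      using as x
      by (intro word_lin_ext_word[OF P.module_axioms hc ts ls]) (auto simp: tensor_words_def in_lists_conv_set)
    also have "\<dots> = pure_tensor K A (rev as)"
    proof -
      have "pf (replicate m x) = \<one>\<^bsub>K\<^esub>" for m by (induction m) (simp_all add: pf_def x(2))
      then show ?thesis using as pt[of as] by (simp add: h_def tensor_words_def del: replicate_Suc)
    qed
    finally show "lin_ext K ?P (\<lambda>(as, xs). h as xs) (word as (replicate (Suc n) x)) =
      pure_tensor K A (rev as)" .
  qed
qed

end

section \<open>From associativity back to the \<ell>EAS equation\<close>

context word_product_algebra
begin

text \<open>Associativity is invoked only with the letter x in the first two places and, in the
  third, that letter or that letter followed by c and x. Cancelling \<open>?G\<close> by
  \<open>J\<close> then compares the two sides on pure tensors.\<close>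

lemma lEAS_if_phi_assoc_algebra:
  assumes "field K" "carrier V \<noteq> {\<zero>\<^bsub>V\<^esub>}" "phi_assoc_algebra K A \<Phi> T star"
  shows "lEAS K A \<Phi>"
proof -
  let ?P = "tensor_power K A 3"
  let ?l = "\<lambda>s. id_tensor K A \<Phi> (tensor_id K A \<Phi> (id_tensor K A \<Phi> s))"
  let ?r = "\<lambda>s. tensor_id K A \<Phi> (id_tensor K A (tensor_flip K A) (tensor_id K A \<Phi> s))"
  note P = tensor_power_module[OF module_A, of 3]
  interpret V: module K V by (rule module_V)
  obtain x where x: "x \<in> carrier V" "x \<noteq> \<zero>\<^bsub>V\<^esub>"
    using assms(2) V.M.zero_closed by blast
  obtain f where f: "f \<in> linear_maps K V (self_module K)" "f x = \<one>\<^bsub>K\<^esub>"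
    using exists_linear_form[OF assms(1) module_V x] by blast
  \<comment> \<open>Applied to pure tensors, \<open>?G\<close> yields words with three types and
    four letters equal to x, hence n = 3.\<close>
  obtain J where J: "J \<in> linear_maps K T ?P"
    "\<And>as. as \<in> tensor_words A 3 \<Longrightarrow> J (word as (replicate (Suc 3) x)) = pure_tensor K A (rev as)"
    using exists_type_projection[OF f(1), of 3] f(2) x(1) by metis
  let ?z = "letter K A V x"
  have z: "?z \<in> carrier T" using x(1) by (rule letter_closed)
  let ?G = "triple_product ?z ?z ?z x"
  note G = triple_product_linear[OF z z z x(1)]
  have JG: "J (?G s) = s" if "s \<in> carrier ?P" for s
  proof (rule tensor_power_eqI[OF module_A P linear_maps_comp[OF G J(1)] _ _ that, where g = "\<lambda>s. s"])
    show "(\<lambda>s. s) \<in> linear_maps K ?P ?P" by (rule linear_mapsI) simp_all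
    fix w assume "w \<in> tensor_words A 3"
    then obtain a b c where w: "w = [a, b, c]" "a \<in> carrier A" "b \<in> carrier A" "c \<in> carrier A"
      by (auto simp: tensor_words_3_iff)
    have "star c ?z ?z = word [c] [x, x]"
      using w x z append_word[of c x "[]" "[x]"] by (simp add: star_letter) (simp add: letter_def)
    moreover have "star b (word [c] [x, x]) ?z = word [c, b] [x, x, x]"
      using w x append_word[of b x "[c]" "[x, x]"] by (simp add: star_letter word_closed)
    moreover have "snoc (word [c, b] [x, x, x]) a x = word [c, b, a] [x, x, x, x]"
      using w x append_word[of a x "[c, b]" "[x, x, x]"] by simp
    ultimately have "?G (pure_tensor K A w) = word [c, b, a] (replicate (Suc 3) x)"
      using triple_product_pure[OF z z z x(1) w(2-4)] w(1) by (simp add: numeral_3_eq_3)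
    then show "J (?G (pure_tensor K A w)) = pure_tensor K A w"
      using J(2)[of "[c, b, a]"] w by (simp add: tensor_words_3_iff)
  qed
  have l: "?l \<in> linear_maps K ?P ?P"
    by (rule linear_maps_comp[OF linear_maps_comp[OF id_tensor_linear tensor_id_linear] id_tensor_linear])
  have r: "?r \<in> linear_maps K ?P ?P"
    by (rule linear_maps_comp[OF linear_maps_comp[OF tensor_id_linear id_tensor_flip_linear] tensor_id_linear])
  have "?l s = ?r s" if "s \<in> carrier ?P" for s
  proof (rule tensor_power_eqI[OF module_A P l r _ that])
    fix w assume "w \<in> tensor_words A 3"
    then obtain a b c where w: "w = [a, b, c]" "a \<in> carrier A" "b \<in> carrier A" "c \<in> carrier A"
      by (auto simp: tensor_words_3_iff)
    have wP: "pure_tensor K A w \<in> carrier ?P"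
      using \<open>w \<in> _\<close> by (rule pure_tensor_closed[OF module_A])
    have assoc: "assoc_at ?z ?z y" if "y \<in> carrier T" for y
      using assms(3) z that by (simp add: phi_assoc_algebra_iff)
    have "?G (?l (pure_tensor K A w)) = star a ?z (star b ?z (snoc ?z c x))"
      unfolding w(1) by (rule star_star_snoc[OF z z z x(1) assoc[OF z] w(2-4), symmetric])
    also have "\<dots> = sw (\<lambda>p q. star p (star q ?z ?z) (snoc ?z c x)) a b"
      using assoc[OF append_closed[OF z w(4) x(1)]] w by (simp add: assoc_at_def)
    also have "\<dots> = ?G (?r (pure_tensor K A w))"
      unfolding w(1) by (rule star_star_snoc'[OF z z z x(1) w(2-4)])
    finally have "J (?G (?l (pure_tensor K A w))) = J (?G (?r (pure_tensor K A w)))" by simp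
    then show "?l (pure_tensor K A w) = ?r (pure_tensor K A w)"
      using JG[OF linear_maps_closed[OF l wP]] JG[OF linear_maps_closed[OF r wP]] by simp
  qed
  then show ?thesis using module_A phi by (simp add: lEAS_def)
qed

section \<open>The universal property\<close>

text \<open>Appending is multiplication by a letter, so a homomorphism has a forced value there, and
  this is the step of the recursion. That it respects all products follows by induction on the right
  factor, with associativity in \<open>W\<close> folding the Sweedler sum back together.\<close>

lemma word_hom_extends:
  fixes W :: "('k, 'w) module"
  assumes "phi_assoc_algebra K A \<Phi> W starW" "f \<in> linear_maps K V W"
  obtains F where "F \<in> phi_assoc_homs K A T star W starW" "\<And>x. x \<in> carrier V \<Longrightarrow> F (letter K A V x) = f x"
proof -
  have W: "module K W" and tp: "starW \<in> typed_products K A W"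
    and assoc: "\<And>a b x y z. a \<in> carrier A \<Longrightarrow> b \<in> carrier A \<Longrightarrow> x \<in> carrier W \<Longrightarrow> y \<in> carrier W \<Longrightarrow>
      z \<in> carrier W \<Longrightarrow>
      starW a x (starW b y z) = sweedler K A W \<Phi> (\<lambda>p q. starW p (starW q x y) z) a b"
    using assms(1) by (auto simp: phi_assoc_algebra_def)
  have W1: "(\<lambda>a. starW a x y) \<in> linear_maps K A W" if "x \<in> carrier W" "y \<in> carrier W" for x y
    using tp that by (simp add: typed_products_def)
  have W2: "(\<lambda>x. starW a x y) \<in> linear_maps K W W" if "a \<in> carrier A" "y \<in> carrier W" for a y
    using tp that by (simp add: typed_products_def)
  have W3: "(\<lambda>y. starW a x y) \<in> linear_maps K W W" if "a \<in> carrier A" "x \<in> carrier W" for a x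
    using tp that by (simp add: typed_products_def)
  have Wcl: "starW a x y \<in> carrier W" if "a \<in> carrier A" "x \<in> carrier W" "y \<in> carrier W" for a x y
    by (rule linear_maps_closed[OF W3[OF that(1,2)] that(3)])
  note fcl = linear_maps_closed[OF assms(2)]
  obtain F where F: "F \<in> linear_maps K T W"
    and Fl: "\<And>x. x \<in> carrier V \<Longrightarrow> F (letter K A V x) = f x"
    and Fs: "\<And>w a x. w \<in> carrier T \<Longrightarrow> a \<in> carrier A \<Longrightarrow> x \<in> carrier V \<Longrightarrow>
      F (snoc w a x) = starW a (F w) (f x)"
    by (rule word_recursion_exists[OF W assms(2), of "\<lambda>n a x. starW a n (f x)"])
      (use W1 W2 linear_maps_comp[OF assms(2) W3] fcl in blast)+
  note Fcl = linear_maps_closed[OF F]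
  have "F (star a u v) = starW a (F u) (F v)" if "v \<in> carrier T" "a \<in> carrier A" "u \<in> carrier T" for a u v
    using that
  proof (induction arbitrary: a rule: word_induct)
    case (letter x)
    then show ?case by (simp add: star_letter Fl Fs)
  next
    case (append v b x)
    have "F (star a u (snoc v b x)) = F (sw (\<lambda>p q. snoc (star q u v) p x) a b)"
      using append by (simp add: star_snoc)
    also have "\<dots> = sweedler K A W \<Phi> (\<lambda>p q. F (snoc (star q u v) p x)) a b"
      using append by (intro linear_map_sweedler[OF module_T W F]) (auto intro: append_closed star_closed)
    also have "\<dots> = sweedler K A W \<Phi> (\<lambda>p q. starW p (starW q (F u) (F v)) (f x)) a b"
      using append
      by (intro sweedler_cong[OF W]) (auto simp: Fs star_closed intro!: Wcl Fcl fcl)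
    also have "\<dots> = starW a (F u) (F (snoc v b x))"
      using append by (simp add: Fs assoc Fcl fcl)
    finally show ?case .
  next
    case (add s t)
    then show ?case
      by (simp add: linear_maps_add[OF star_right_linear] linear_maps_add[OF F] linear_maps_add[OF W3]
          star_closed Fcl)
  next
    case (smult c t)
    then show ?case
      by (simp add: linear_maps_smult[OF star_right_linear] linear_maps_smult[OF F] linear_maps_smult[OF W3]
          star_closed Fcl)
  qed
  then have "F \<in> phi_assoc_homs K A T star W starW"
    using F by (simp add: phi_assoc_homs_def)
  then show thesis using Fl that by blast
qed

text \<open>Letters generate \<open>T\<close> under the products, because appending is
  multiplication by a letter.\<close>

lemma word_hom_unique:
  assumes "F \<in> phi_assoc_homs K A T star W starW" "F' \<in> phi_assoc_homs K A T star W starW"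
    and "\<And>x. x \<in> carrier V \<Longrightarrow> F (letter K A V x) = F' (letter K A V x)" "w \<in> carrier T"
  shows "F w = F' w"
proof -
  have F: "F \<in> linear_maps K T W" "F' \<in> linear_maps K T W"
    and hom: "\<And>a u v. a \<in> carrier A \<Longrightarrow> u \<in> carrier T \<Longrightarrow> v \<in> carrier T \<Longrightarrow> F (star a u v) = starW a (F u) (F v)"
      "\<And>a u v. a \<in> carrier A \<Longrightarrow> u \<in> carrier T \<Longrightarrow> v \<in> carrier T \<Longrightarrow> F' (star a u v) = starW a (F' u) (F' v)"
    using assms(1,2) by (auto simp: phi_assoc_homs_def)
  from assms(4) show ?thesis
  proof (induction rule: word_induct)
    case (letter x)
    then show ?case by (rule assms(3))
  next
    case (append w a x)
    then have "F (star a w (letter K A V x)) = F' (star a w (letter K A V x))"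
      by (simp add: hom letter_closed assms(3))
    then show ?case using append by (simp add: star_letter)
  qed (simp_all add: linear_maps_add[OF F(1)] linear_maps_add[OF F(2)]
      linear_maps_smult[OF F(1)] linear_maps_smult[OF F(2)])
qed

lemma free_phi_assoc_algebra_words:
  assumes "lEAS K A \<Phi>"
  shows "free_phi_assoc_algebra TYPE('w) K A \<Phi> V T star (letter K A V)"
  unfolding free_phi_assoc_algebra_def
proof (intro conjI allI impI)
  show "phi_assoc_algebra K A \<Phi> T star" by (rule phi_assoc_algebra_if_lEAS) fact
  show "letter K A V \<in> linear_maps K V T" by (rule letter_linear)
  fix W :: "('k, 'w) module" and starW f
  assume "phi_assoc_algebra K A \<Phi> W starW \<and> f \<in> linear_maps K V W"
  then obtain F where F: "F \<in> phi_assoc_homs K A T star W starW"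
    "\<And>x. x \<in> carrier V \<Longrightarrow> F (letter K A V x) = f x"
    using word_hom_extends by blast
  \<comment> \<open>Uniqueness is claimed among extensional maps, so \<open>F\<close> is cut down to
    the carrier.\<close>
  let ?F = "restrict F (carrier T)"
  have hom: "?F \<in> phi_assoc_homs K A T star W starW"
    using F(1) linear_maps_cong[OF module_T, of ?F F W] by (simp add: phi_assoc_homs_def star_closed)
  show "\<exists>!F. F \<in> extensional (carrier T) \<and> F \<in> phi_assoc_homs K A T star W starW \<and>
    (\<forall>x\<in>carrier V. F (letter K A V x) = f x)"
  proof (rule ex1I)
    show "?F \<in> extensional (carrier T) \<and> ?F \<in> phi_assoc_homs K A T star W starW \<and>
      (\<forall>x\<in>carrier V. ?F (letter K A V x) = f x)"
      using hom F(2) letter_closed by simp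
    fix F' assume "F' \<in> extensional (carrier T) \<and> F' \<in> phi_assoc_homs K A T star W starW \<and>
      (\<forall>x\<in>carrier V. F' (letter K A V x) = f x)"
    then show "F' = ?F"
      using F word_hom_unique[of F' W starW F] by (intro extensionalityI[of _ "carrier T"]) auto
  qed
qed

end

text \<open>The field, transported along \<open>e\<close> into the type of vectors, is a
  one-dimensional space; the image of 1 is nonzero.\<close>

lemma exists_nonzero_module:
  fixes e :: "'k \<Rightarrow> 'v"
  assumes "field K" "inj_on e (carrier K)"
  obtains V :: "('k, 'v) module" where "module K V" "carrier V \<noteq> {\<zero>\<^bsub>V\<^esub>}"
proof -
  interpret K: field K by fact
  define d where "d = inv_into (carrier K) e"
  have d: "d (e k) = k" if "k \<in> carrier K" for k
    using assms(2) that by (simp add: d_def)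
  define V :: "('k, 'v) module" where "V = \<lparr>carrier = e ` carrier K, mult = (\<lambda>_ _. undefined),
    one = undefined, zero = e \<zero>\<^bsub>K\<^esub>, add = (\<lambda>x y. e (d x \<oplus>\<^bsub>K\<^esub> d y)), smult = (\<lambda>c x. e (c \<otimes>\<^bsub>K\<^esub> d x))\<rparr>"
  have "module K V"
  proof (rule moduleI)
    show "abelian_group V"
    proof (rule abelian_groupI)
      fix x assume "x \<in> carrier V"
      then obtain k where k: "k \<in> carrier K" "x = e k" by (auto simp: V_def)
      then show "\<exists>y\<in>carrier V. y \<oplus>\<^bsub>V\<^esub> x = \<zero>\<^bsub>V\<^esub>"
        by (intro bexI[of _ "e (\<ominus>\<^bsub>K\<^esub> k)"]) (auto simp: V_def d K.l_neg)
    qed (auto simp: V_def d K.a_ac)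
  qed (auto simp: V_def d K.is_cring K.l_distr K.r_distr K.m_assoc)
  moreover have "e \<one>\<^bsub>K\<^esub> \<in> carrier V" "e \<one>\<^bsub>K\<^esub> \<noteq> \<zero>\<^bsub>V\<^esub>"
    using assms(2) by (auto simp: V_def inj_on_eq_iff)
  ultimately show thesis using that by blast
qed

text \<open>The first conjunct gives the definite description \<open>word_product\<close> its
  meaning, so that the others speak about the product determined by the two clauses. The type
  \<open>'w\<close> of the algebras testing freeness is independent of \<open>'v\<close>.\<close>

theorem theorem3p5:
  fixes K :: "'k ring"
    and A :: "('k, 'a) module"
    and \<Phi> :: "('a list \<Rightarrow> 'k) set \<Rightarrow> ('a list \<Rightarrow> 'k) set"
  assumes "field K"
    and "module K A"
    and "\<Phi> \<in> linear_maps K (tensor_power K A 2) (tensor_power K A 2)"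
    and "\<exists>e :: 'k \<Rightarrow> 'v. inj_on e (carrier K)"
      (* the vector spaces V below have their carriers in the type 'v, which must be large enough
         to hold a nonzero one *)
  shows "(\<forall>V :: ('k, 'v) module. module K V \<longrightarrow> (\<exists>!star. is_word_product K A \<Phi> V star)) \<and>
    (lEAS K A \<Phi> \<longleftrightarrow>
      (\<forall>V :: ('k, 'v) module. module K V \<longrightarrow>
         phi_assoc_algebra K A \<Phi> (typed_word_space K A V) (word_product K A \<Phi> V))) \<and>
    (lEAS K A \<Phi> \<longleftrightarrow>
      (\<exists>V :: ('k, 'v) module. module K V \<and> carrier V \<noteq> {\<zero>\<^bsub>V\<^esub>} \<and>
         phi_assoc_algebra K A \<Phi> (typed_word_space K A V) (word_product K A \<Phi> V))) \<and>
    (lEAS K A \<Phi> \<longrightarrow>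
      (\<forall>V :: ('k, 'v) module. module K V \<longrightarrow>
         free_phi_assoc_algebra TYPE('w) K A \<Phi> V
           (typed_word_space K A V) (word_product K A \<Phi> V) (letter K A V)))"
proof -
  have words: "phi_words K A \<Phi> V" if "module K V" for V :: "('k, 'v) module"
    using assms(2,3) that by (intro phi_words.intro phi_map.intro typed_words.intro)
  have alg: "word_product_algebra K A \<Phi> V (word_product K A \<Phi> V)" if "module K V"
    for V :: "('k, 'v) module"
    using words[OF that] phi_words.word_product_is_word_product[OF words[OF that]]
    by (intro word_product_algebra.intro word_product_algebra_axioms.intro)
  \<comment> \<open>On the zero space associativity holds trivially, so the condition on all spaces
    yields the \<ell>EAS equation only through a nonzero one of the given type; the same space
    witnesses the existential condition.\<close>
  obtain V :: "('k, 'v) module" where V: "module K V" "carrier V \<noteq> {\<zero>\<^bsub>V\<^esub>}"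
    using assms(4) exists_nonzero_module[OF assms(1)] by blast
  note 1 = phi_words.word_product_ex1[OF words]
  note 2 = word_product_algebra.phi_assoc_algebra_if_lEAS[OF alg]
  note 3 = word_product_algebra.lEAS_if_phi_assoc_algebra[OF alg assms(1)]
  note 4 = word_product_algebra.free_phi_assoc_algebra_words[OF alg]
  show ?thesis
  proof (intro conjI iffI allI impI)
    assume "lEAS K A \<Phi>"
    then show "\<exists>V :: ('k, 'v) module. module K V \<and> carrier V \<noteq> {\<zero>\<^bsub>V\<^esub>} \<and>
        phi_assoc_algebra K A \<Phi> (typed_word_space K A V) (word_product K A \<Phi> V)"
      using V 2 by blast
  next
    assume "\<forall>V :: ('k, 'v) module. module K V \<longrightarrow>
      phi_assoc_algebra K A \<Phi> (typed_word_space K A V) (word_product K A \<Phi> V)"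
    then show "lEAS K A \<Phi>" using V 3 by blast
  qed (use 1 2 3 4 in blast)+
qed

end
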